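(* Let $\varphi:\mathbb{C}\to S^2$ be an everywhere non-conformal harmonic map, let $\Phi:\mathbb{C}\to\Lambda_{\mathrm{hol}}\mathrm{SO}(3,\mathbb{C})$ be an extended framing associated to $\varphi$ with $\Phi_\mu(z_0)=1$ for all $\mu\in\mathbb{C}^*$ (for some fixed $z_0\in\mathbb{C}$), and let $\lambda\in\mathbb{C}^*$. Let $F^\lambda=-i\lambda\frac{\partial\Phi}{\partial\lambda}\Phi_\lambda^{-1}$ be the associated (real or complex) surface of constant Gauss curvature $K=1$, with normal $\varphi^\lambda=\Phi_\lambda\varphi_0\Phi_\lambda^{-1}$. Let $\alpha\in\mathbb{C}\setminus\{0,\pm\lambda\}$ and let $L\subset\mathbb{C}^3$ be a $1$-dimensional isotropic subspace with $QL\neq L$. Put $\tilde L=\Phi(\alpha)^{-1}L$, $\tilde h=p_{\alpha,\tilde L}$, and define, on the open set of points of $\mathbb{C}$ where $Q\tilde L\ne\tilde L$, $$\tilde F^\lambda=F^\lambda+i\lambda\,\Phi_\lambda\,\tilde h_\lambda^{-1}\frac{\partial\tilde h}{\partial\lambda}\,\Phi_\lambda^{-1},\qquad(\ast)$$ with normal $\tilde\varphi^\lambda=\Phi_\lambda\tilde h_\lambda^{-1}\varphi_0\tilde h_\lambda\Phi_\lambda^{-1}$. Then $\tilde F^\lambda\in\mathbf{BB}_\beta(F^\lambda)$ with $\beta=\ln(\alpha/\lambda)$. Moreover, any Bianchi-Bäcklund transform of $F^\lambda$ is of the form $(\ast)$ for some simple factor $p_{\alpha,L}$.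
   Context: Identify $\mathbb{C}^3$ with $\mathfrak{so}(3,\mathbb{C})$ via $u\mapsto\xi_u$, $\xi_u(v)=u\times v$; the complex bilinear form on $\mathbb{C}^3$ extending the standard inner product of $\mathbb{R}^3$ becomes $(\xi,\eta)=-\frac12\mathrm{Tr}\,\xi\eta$, and $\times$ becomes the commutator. "Isotropic" means $(L,L)=0$. Let $e_1,e_2,e_3$ be the canonical basis of $\mathbb{R}^3$, $\varphi_0=\xi_{e_1}$, $Q=\mathrm{diag}(1,-1,-1)$, and let $\tau$ be conjugation by $Q$ on $\mathrm{SO}(3,\mathbb{C})$; on $\mathfrak{so}(3,\mathbb{C})$ its $+1$ and $-1$ eigenspaces are $\mathfrak{k}^{\mathbb{C}}=\mathbb{C}\xi_{e_1}$ and $\mathfrak{m}^{\mathbb{C}}=\mathbb{C}\xi_{e_2}\oplus\mathbb{C}\xi_{e_3}$. $\Lambda_{\mathrm{hol}}\mathrm{SO}(3,\mathbb{C})$ is the group of holomorphic maps $\gamma:\mathbb{C}^*\to\mathrm{SO}(3,\mathbb{C})$ with $\tau\gamma(\lambda)=\gamma(-\lambda)$. For a map $\Phi$ into it write $\Phi_\lambda(z)=\Phi(z)(\lambda)$, and $\Phi(\alpha)$ for $\Phi_\alpha$. Extended framing of $\varphi$: a smooth $\Phi:\mathbb{C}\to\Lambda_{\mathrm{hol}}\mathrm{SO}(3,\mathbb{C})$ with $\Phi_\lambda\in\mathrm{SO}(3,\mathbb{R})$ for $|\lambda|=1$, with $\Phi^{-1}d\Phi=\lambda^{-1}\alpha'_{\mathfrak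 m}+\alpha_{\mathfrak k}+\lambda\alpha''_{\mathfrak m}$, where $\alpha_{\mathfrak k}$ is $\mathfrak{k}$-valued and $\alpha'_{\mathfrak m},\alpha''_{\mathfrak m}$ are $\mathfrak{m}^{\mathbb{C}}$-valued of type $(1,0)$ and $(0,1)$, and with $\varphi=\Phi_1\varphi_0\Phi_1^{-1}$. Simple factor: for $\alpha\in\mathbb{C}\setminus\{0\}$ and a $1$-dimensional isotropic $L$ with $QL\ne L$, let $L_0=(L\oplus QL)^\perp$, let $\pi_L,\pi_{L_0},\pi_{QL}$ be the projections for $\mathbb{C}^3=L\oplus L_0\oplus QL$, and put $p_{\alpha,L}(\lambda)=\frac{\alpha-\lambda}{\alpha+\lambda}\pi_L+\pi_{L_0}+\frac{\alpha+\lambda}{\alpha-\lambda}\pi_{QL}$. For a map $\tilde L$ into lines, $\tilde h_\lambda=p_{\alpha,\tilde L}(\lambda)$ pointwise. Curvature line coordinates: the conformal coordinate $z=x+iy$ on $\mathbb{C}$ is assumed to be a curvature line coordinate for $F=F^1$, with $\mathrm{I}_F=\cosh^2\omega\,dx^2+\sinh^2\omega\,dy^2$ and $\mathrm{II}_F$ a multiple of $dx^2+dy^2$, where $\omega$ solves $\Delta\omega+\sinh\omega\cosh\omega=0$. The corresponding coordinate for $F^\lambda$ is obtained by replacing $(z,\bar z)$ by $(\lambda^{-1}z,\lambda\bar z)$, i.e. $x_\lambda=\frac12(\lambda^{-1}z+\lambda\bar z)$, $y_\lambda=\frac1{2i}(\lambda^{-1}z-\lambda\bar z)$ (complex-valued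 if $|\lambda|\neq1$). It is a curvature line coordinate for a surface if the first fundamental form is diagonal in $dx_\lambda,dy_\lambda$ and the second is a multiple of $dx_\lambda^2+dy_\lambda^2$. All fundamental forms of complex surfaces use the bilinear form; surfaces are considered where they are immersions. Bianchi-Bäcklund transform: a complex surface $\tilde F$ with normal $\tilde\varphi$ is a Bianchi-Bäcklund transform of $F^\lambda$ (with normal $\varphi^\lambda$) if the coordinate $(x_\lambda,y_\lambda)$, where $x_\lambda=\frac12(\lambda^{-1}z+\lambda\bar z)$ and $y_\lambda=\frac1{2i}(\lambda^{-1}z-\lambda\bar z)$, is a curvature line coordinate for both $F^\lambda$ and $\tilde F$; $(\tilde F-F^\lambda,\varphi^\lambda)=(\tilde F-F^\lambda,\tilde\varphi)=0$; $\tilde F-F^\lambda$ has constant length (non-zero $(\tilde F-F^\lambda,\tilde F-F^\lambda)$); and the normals make a constant angle. Its spectral parameter is $\beta\in\mathbb{C}\setminus\{in\pi:n\in\mathbb{Z}\}$ if $\tilde F-F^\lambda=\frac{1}{\sinh\beta}u$ with $(u,u)=1$, $(\varphi^\lambda,\tilde\varphi)=\cos\sigma$, $\varphi^\lambda\times\tilde\varphi=\sin\sigma\,u$ and $\cot\sigma=-i\cosh\beta$, for a constant $\sigma\in\mathbb{C}$. $\mathbf{BB}_\beta(F^\lambda)$ is the set of Bianchi-Bäcklund transforms of $F^\lambda$ with spectral parameter $\beta$ (it depends only on $\beta$ modulo $i\pi$, so the branch of $\ln$ is irrelevant).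
   Formalization: In the converse the transform lives on a connected domain, its normal is determined up to sign, and QL≠L is claimed only if the domain contains z_0; otherwise only that L is isotropic with QL̃≠L̃ throughout the domain, since a Q-fixed L can occur there. *)

theory Defs
  imports "HOL-Analysis.Analysis"
begin

section \<open>Smooth maps between normed spaces\<close>

primrec Ck_on :: "nat \<Rightarrow> 'a::real_normed_vector set \<Rightarrow> ('a \<Rightarrow> 'b::real_normed_vector) \<Rightarrow> bool"
where
  "Ck_on 0 U f \<longleftrightarrow> continuous_on U f"
| "Ck_on (Suc k) U f \<longleftrightarrow> (\<forall>x\<in>U. f differentiable (at x)) \<and>
     (\<forall>v. Ck_on k U (\<lambda>x. frechet_derivative f (at x) v))"

text \<open>Only used for open \<open>U\<close>. The complex plane and \<open>complex^3^3\<close> are regarded as real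
  vector spaces here.\<close>

definition smooth_on :: "'a::real_normed_vector set \<Rightarrow> ('a \<Rightarrow> 'b::real_normed_vector) \<Rightarrow> bool" where
  "smooth_on U f \<longleftrightarrow> (\<forall>k. Ck_on k U f)"

abbreviation pd :: "complex \<Rightarrow> (complex \<Rightarrow> 'b::real_normed_vector) \<Rightarrow> complex \<Rightarrow> 'b" where
  "pd v f z \<equiv> frechet_derivative f (at z) v"

definition laplacian :: "(complex \<Rightarrow> 'b::real_normed_vector) \<Rightarrow> complex \<Rightarrow> 'b" where
  "laplacian f z = pd 1 (pd 1 f) z + pd \<i> (pd \<i> f) z"


section \<open>Harmonic maps into the unit sphere\<close>

definition harmonic_sphere_map :: "(complex \<Rightarrow> real^3) \<Rightarrow> bool" where
  "harmonic_sphere_map \<phi> \<longleftrightarrow> smooth_on UNIV \<phi> \<and> (\<forall>z. norm (\<phi> z) = 1) \<and>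
     (\<forall>z. laplacian \<phi> z = - ((norm (pd 1 \<phi> z))\<^sup>2 + (norm (pd \<i> \<phi> z))\<^sup>2) *\<^sub>R \<phi> z)"

definition conformal_at :: "(complex \<Rightarrow> real^3) \<Rightarrow> complex \<Rightarrow> bool" where
  "conformal_at \<phi> z \<longleftrightarrow>
     norm (pd 1 \<phi> z) = norm (pd \<i> \<phi> z) \<and> pd 1 \<phi> z \<bullet> pd \<i> \<phi> z = 0"


section \<open>Complex 3-space and so(3,C)\<close>

type_synonym cvec = "complex^3"
type_synonym cmat = "complex^3^3"

text \<open>\<open>*s\<close> and \<open>*\<^sub>R\<close> do not provide multiplication of a complex matrix by a complex number.\<close>

definition mscale :: "complex \<Rightarrow> cmat \<Rightarrow> cmat"  (infixr "*\<^sub>m" 75) where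
  "c *\<^sub>m M = (\<chi> i j. c * M $ i $ j)"

definition cform :: "cvec \<Rightarrow> cvec \<Rightarrow> complex" where
  "cform u v = (\<Sum>i\<in>UNIV. u $ i * v $ i)"

definition ccross :: "cvec \<Rightarrow> cvec \<Rightarrow> cvec" where
  "ccross u v = vector [u$2 * v$3 - u$3 * v$2, u$3 * v$1 - u$1 * v$3, u$1 * v$2 - u$2 * v$1]"

definition xi :: "cvec \<Rightarrow> cmat" where
  "xi u = matrix (ccross u)"

definition bform :: "cmat \<Rightarrow> cmat \<Rightarrow> complex" where
  "bform A B = - (1/2) * trace (A ** B)"

definition commutator :: "cmat \<Rightarrow> cmat \<Rightarrow> cmat" where
  "commutator A B = A ** B - B ** A"

definition so3C :: "cmat set" where
  "so3C = {A. transpose A = - A}"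

definition SO3C :: "cmat set" where
  "SO3C = {A. orthogonal_matrix A \<and> det A = 1}"

definition complexify :: "real^3 \<Rightarrow> cvec" where
  "complexify u = (\<chi> i. complex_of_real (u $ i))"

definition phi0 :: cmat where
  "phi0 = xi (axis 1 1)"

lemma ccross_xi: "xi u *v v = ccross u v"
  unfolding xi_def
  by (simp add: vec_eq_iff forall_3 matrix_def matrix_vector_mult_def sum_3 ccross_def axis_def)

lemma xi_entries:
  "xi u = vector [vector [0, - u$3, u$2], vector [u$3, 0, - u$1], vector [- u$2, u$1, 0]]"
  unfolding xi_def by (simp add: vec_eq_iff forall_3 matrix_def ccross_def axis_def)

lemma bform_xi: "bform (xi u) (xi v) = cform u v"
  by (simp add: bform_def cform_def trace_def matrix_matrix_mult_def sum_3 xi_entries algebra_simps)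

lemma commutator_xi: "commutator (xi u) (xi v) = xi (ccross u v)"
  by (simp add: commutator_def vec_eq_iff forall_3 matrix_matrix_mult_def sum_3 xi_entries
      ccross_def)


section \<open>The twisted loop group and extended framings\<close>

definition Qmat :: cmat where
  "Qmat = (\<chi> i j. if i = j then (if i = 1 then 1 else - 1) else 0)"

definition tau :: "cmat \<Rightarrow> cmat" where
  "tau A = Qmat ** A ** matrix_inv Qmat"

definition Lambda_hol :: "(complex \<Rightarrow> cmat) set" where
  "Lambda_hol = {\<gamma>. (\<forall>\<mu>. \<mu> \<noteq> 0 \<longrightarrow> \<gamma> \<mu> \<in> SO3C \<and> tau (\<gamma> \<mu>) = \<gamma> (- \<mu>)) \<and>
     (\<forall>i j. (\<lambda>\<mu>. \<gamma> \<mu> $ i $ j) holomorphic_on - {0})}"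

text \<open>The real form \<open>\<kk>\<close> and the complexification of \<open>\<mm>\<close>.\<close>

definition k_real :: "cmat set" where
  "k_real = {complex_of_real t *\<^sub>m xi (axis 1 1) | t. True}"

definition m_cplx :: "cmat set" where
  "m_cplx = {a *\<^sub>m xi (axis 2 1) + b *\<^sub>m xi (axis 3 1) | a b. True}"

text \<open>\<open>\<Phi> z \<mu>\<close> is the value at \<open>\<mu>\<close> of the loop \<open>\<Phi> z\<close>. Smoothness as a map into the loop group is
  joint smoothness in \<open>(z, \<mu>)\<close>. In the Maurer-Cartan form, evaluated on a tangent vector \<open>v\<close>, the
  terms \<open>v *\<^sub>m A z\<close> and \<open>cnj v *\<^sub>m B z\<close> are the forms \<open>A dz\<close> and \<open>B d(cnj z)\<close>, i.e. the general
  forms of type (1,0) and (0,1).\<close>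

definition extended_framing ::
  "(complex \<Rightarrow> real^3) \<Rightarrow> (complex \<Rightarrow> complex \<Rightarrow> cmat) \<Rightarrow> bool" where
  "extended_framing \<phi> \<Phi> \<longleftrightarrow>
     (\<forall>z. \<Phi> z \<in> Lambda_hol) \<and>
     smooth_on (UNIV \<times> - {0}) (\<lambda>(z, \<mu>). \<Phi> z \<mu>) \<and>
     (\<forall>z \<mu>. norm \<mu> = 1 \<longrightarrow> (\<forall>i j. \<Phi> z \<mu> $ i $ j \<in> \<real>)) \<and>
     (\<exists>A \<kappa> B. (\<forall>z. A z \<in> m_cplx \<and> B z \<in> m_cplx \<and> (\<forall>v. \<kappa> z v \<in> k_real)) \<and>
        (\<forall>z v \<mu>. \<mu> \<noteq> 0 \<longrightarrow>
           matrix_inv (\<Phi> z \<mu>) ** pd v (\<lambda>w. \<Phi> w \<mu>) z =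
             inverse \<mu> *\<^sub>m (v *\<^sub>m A z) + \<kappa> z v + \<mu> *\<^sub>m (cnj v *\<^sub>m B z))) \<and>
     (\<forall>z. xi (complexify (\<phi> z)) = \<Phi> z 1 ** phi0 ** matrix_inv (\<Phi> z 1))"

text \<open>The complex derivative of a loop with respect to its parameter.\<close>

definition mderiv :: "(complex \<Rightarrow> cmat) \<Rightarrow> complex \<Rightarrow> cmat" where
  "mderiv \<gamma> \<mu> = (\<chi> i j. deriv (\<lambda>\<nu>. \<gamma> \<nu> $ i $ j) \<mu>)"

definition assoc_surface :: "(complex \<Rightarrow> complex \<Rightarrow> cmat) \<Rightarrow> complex \<Rightarrow> complex \<Rightarrow> cmat" where
  "assoc_surface \<Phi> lam z = (- \<i> * lam) *\<^sub>m (mderiv (\<Phi> z) lam ** matrix_inv (\<Phi> z lam))"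

definition assoc_normal :: "(complex \<Rightarrow> complex \<Rightarrow> cmat) \<Rightarrow> complex \<Rightarrow> complex \<Rightarrow> cmat" where
  "assoc_normal \<Phi> lam z = \<Phi> z lam ** phi0 ** matrix_inv (\<Phi> z lam)"


section \<open>Simple factors\<close>

definition isotropic_line :: "cvec set \<Rightarrow> bool" where
  "isotropic_line L \<longleftrightarrow> vec.subspace L \<and> vec.dim L = 1 \<and> (\<forall>u\<in>L. \<forall>v\<in>L. cform u v = 0)"

definition Qim :: "cvec set \<Rightarrow> cvec set" where
  "Qim L = (\<lambda>v. Qmat *v v) ` L"

definition L0 :: "cvec set \<Rightarrow> cvec set" where
  "L0 L = {v. \<forall>a\<in>L. \<forall>b\<in>Qim L. cform (a + b) v = 0}"

text \<open>The projection onto the first summand of a decomposition of 3-space as a direct sum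
  \<open>A \<oplus> B \<oplus> C\<close>.\<close>

definition proj3 :: "cvec set \<Rightarrow> cvec set \<Rightarrow> cvec set \<Rightarrow> cmat" where
  "proj3 A B C = (THE P. (\<forall>v\<in>A. P *v v = v) \<and> (\<forall>v\<in>B. P *v v = 0) \<and> (\<forall>v\<in>C. P *v v = 0))"

definition simple_factor :: "complex \<Rightarrow> cvec set \<Rightarrow> complex \<Rightarrow> cmat" where
  "simple_factor \<alpha> L \<mu> =
     ((\<alpha> - \<mu>) / (\<alpha> + \<mu>)) *\<^sub>m proj3 L (L0 L) (Qim L)
     + proj3 (L0 L) L (Qim L)
     + ((\<alpha> + \<mu>) / (\<alpha> - \<mu>)) *\<^sub>m proj3 (Qim L) L (L0 L)"

text \<open>The line \<open>\<Phi>(\<alpha>)\<inverse> L\<close>, the set where it is not fixed by \<open>Q\<close>, and the surface obtained by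
  dressing with the simple factor, together with its normal.\<close>

definition Ltilde ::
  "(complex \<Rightarrow> complex \<Rightarrow> cmat) \<Rightarrow> complex \<Rightarrow> cvec set \<Rightarrow> complex \<Rightarrow> cvec set" where
  "Ltilde \<Phi> \<alpha> L z = (\<lambda>v. matrix_inv (\<Phi> z \<alpha>) *v v) ` L"

definition regular_set ::
  "(complex \<Rightarrow> complex \<Rightarrow> cmat) \<Rightarrow> complex \<Rightarrow> cvec set \<Rightarrow> complex set" where
  "regular_set \<Phi> \<alpha> L = {z. Qim (Ltilde \<Phi> \<alpha> L z) \<noteq> Ltilde \<Phi> \<alpha> L z}"

definition dressed_surface ::
  "(complex \<Rightarrow> complex \<Rightarrow> cmat) \<Rightarrow> complex \<Rightarrow> complex \<Rightarrow> cvec set \<Rightarrow> complex \<Rightarrow> cmat" where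
  "dressed_surface \<Phi> lam \<alpha> L z =
     (let h = simple_factor \<alpha> (Ltilde \<Phi> \<alpha> L z) in
      assoc_surface \<Phi> lam z +
      (\<i> * lam) *\<^sub>m (\<Phi> z lam ** matrix_inv (h lam) ** mderiv h lam ** matrix_inv (\<Phi> z lam)))"

definition dressed_normal ::
  "(complex \<Rightarrow> complex \<Rightarrow> cmat) \<Rightarrow> complex \<Rightarrow> complex \<Rightarrow> cvec set \<Rightarrow> complex \<Rightarrow> cmat" where
  "dressed_normal \<Phi> lam \<alpha> L z =
     (let h = simple_factor \<alpha> (Ltilde \<Phi> \<alpha> L z) in
      \<Phi> z lam ** matrix_inv (h lam) ** phi0 ** h lam ** matrix_inv (\<Phi> z lam))"


section \<open>Complex surfaces\<close>

definition fform1 :: "(complex \<Rightarrow> cmat) \<Rightarrow> complex \<Rightarrow> complex \<Rightarrow> complex" where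
  "fform1 F z v = bform (pd v F z) (pd v F z)"

definition fform2 :: "(complex \<Rightarrow> cmat) \<Rightarrow> (complex \<Rightarrow> cmat) \<Rightarrow> complex \<Rightarrow> complex \<Rightarrow> complex" where
  "fform2 F N z v = - bform (pd v F z) (pd v N z)"

text \<open>A parametrised, possibly singular surface with unit normal \<open>N\<close>. Immersedness is a separate
  predicate: as the ambient space is complex, it refers to complex linear independence of the
  partial derivatives, equivalently (in the presence of a unit normal) to nondegeneracy of the
  first fundamental form.\<close>

definition csurface_on :: "complex set \<Rightarrow> (complex \<Rightarrow> cmat) \<Rightarrow> (complex \<Rightarrow> cmat) \<Rightarrow> bool" where
  "csurface_on U F N \<longleftrightarrow> open U \<and> smooth_on U F \<and> smooth_on U N \<and>
     (\<forall>z\<in>U. F z \<in> so3C \<and> N z \<in> so3C \<and> bform (N z) (N z) = 1 \<and>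
        (\<forall>v. bform (pd v F z) (N z) = 0))"

definition immersed_at :: "(complex \<Rightarrow> cmat) \<Rightarrow> complex \<Rightarrow> bool" where
  "immersed_at F z \<longleftrightarrow>
     (\<forall>a b. a *\<^sub>m pd 1 F z + b *\<^sub>m pd \<i> F z = 0 \<longrightarrow> a = 0 \<and> b = 0)"

text \<open>The differentials of \<open>x\<^sub>\<lambda>\<close> and \<open>y\<^sub>\<lambda>\<close>, evaluated on a tangent vector \<open>v\<close>.\<close>

definition dxl :: "complex \<Rightarrow> complex \<Rightarrow> complex" where
  "dxl lam v = (inverse lam * v + lam * cnj v) / 2"

definition dyl :: "complex \<Rightarrow> complex \<Rightarrow> complex" where
  "dyl lam v = (inverse lam * v - lam * cnj v) / (2 * \<i>)"

definition curvature_line_coord ::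
  "complex \<Rightarrow> complex set \<Rightarrow> (complex \<Rightarrow> cmat) \<Rightarrow> (complex \<Rightarrow> cmat) \<Rightarrow> bool" where
  "curvature_line_coord lam U F N \<longleftrightarrow>
     (\<forall>z\<in>U. (\<exists>E G. \<forall>v. fform1 F z v = E * (dxl lam v)\<^sup>2 + G * (dyl lam v)\<^sup>2) \<and>
            (\<exists>H. \<forall>v. fform2 F N z v = H * ((dxl lam v)\<^sup>2 + (dyl lam v)\<^sup>2)))"


section \<open>Bianchi-Baecklund transforms\<close>

definition bianchi_baecklund ::
  "complex \<Rightarrow> complex set \<Rightarrow> (complex \<Rightarrow> cmat) \<Rightarrow> (complex \<Rightarrow> cmat) \<Rightarrow>
   (complex \<Rightarrow> cmat) \<Rightarrow> (complex \<Rightarrow> cmat) \<Rightarrow> bool" where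
  "bianchi_baecklund lam U F N F' N' \<longleftrightarrow>
     csurface_on U F N \<and> csurface_on U F' N' \<and>
     curvature_line_coord lam U F N \<and> curvature_line_coord lam U F' N' \<and>
     (\<forall>z\<in>U. bform (F' z - F z) (N z) = 0 \<and> bform (F' z - F z) (N' z) = 0) \<and>
     (\<exists>c. c \<noteq> 0 \<and> (\<forall>z\<in>U. bform (F' z - F z) (F' z - F z) = c)) \<and>
     (\<exists>c. \<forall>z\<in>U. bform (N z) (N' z) = c)"

text \<open>In Isabelle \<open>cot \<sigma> = 0\<close> when \<open>sin \<sigma> = 0\<close>, hence the explicit condition on \<open>sin \<sigma>\<close>.\<close>

definition BB ::
  "complex \<Rightarrow> complex \<Rightarrow> complex set \<Rightarrow> (complex \<Rightarrow> cmat) \<Rightarrow> (complex \<Rightarrow> cmat) \<Rightarrow>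
   ((complex \<Rightarrow> cmat) \<times> (complex \<Rightarrow> cmat)) set" where
  "BB \<beta> lam U F N = {(F', N'). bianchi_baecklund lam U F N F' N' \<and>
     \<beta> \<notin> {\<i> * of_int n * of_real pi | n. True} \<and>
     (\<exists>\<sigma> u. sin \<sigma> \<noteq> 0 \<and> cot \<sigma> = - \<i> * cosh \<beta> \<and>
        (\<forall>z\<in>U. F' z - F z = (1 / sinh \<beta>) *\<^sub>m u z \<and> bform (u z) (u z) = 1 \<and>
           bform (N z) (N' z) = cos \<sigma> \<and> commutator (N z) (N' z) = sin \<sigma> *\<^sub>m u z))}"

end

theory Submission
  imports Defs
begin

text \<open>An isotropic line \<open>L\<close> with \<open>Q L \<noteq> L\<close> is spanned by \<open>e1 + m\<close> with \<open>m \<bottom> e1\<close> and \<open>(m, m) = -1\<close>, and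
  the simple factor is an exponential of \<open>xi n\<close>, \<open>n = e1 \<times> m\<close>. Hence dressing moves \<open>F\<close> along
  \<open>\<Phi> n\<close>, and all fundamental forms can be computed in the moving frame \<open>\<Phi> e1, \<Phi> m, \<Phi> n\<close>. There
  \<open>m\<close> has a single derivative coefficient \<open>nu\<close>, and the line \<open>\<Phi>\<^sub>\<alpha> (e1 + m)\<close> is constant if and only if
  \<open>nu = (\<alpha>\<inverse> A dz + \<alpha> B d(cnj z), m)\<close>. Conversely, for a Bianchi-Baecklund transform let \<open>\<Phi> n\<close> be a
  multiple of \<open>F' - F\<close>. That \<open>N'\<close> is normal to \<open>F'\<close> determines \<open>nu\<close>, and the curvature line
  conditions, together with immersedness at one point, fix the length of \<open>F' - F\<close> in terms of the angle
  between the normals; \<open>nu\<close> then has the form above for a suitable \<open>\<alpha>\<close>. The first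
  fundamental form of \<open>F\<^sup>1\<close> enters through \<open>(A, A) = (B, B) = -1/4\<close>.\<close>

section \<open>Calculus of smooth maps\<close>

text \<open>Two facts shape the proof. \<open>F\<close> contains the derivative of \<Phi> in the
  loop parameter, so its differential in z involves mixed second derivatives of \<Phi>. Once these
  are exchanged, the differential of \<open>F\<close>, seen in the frame \<Phi>, is i times the form
  A dz / lam - lam B d(cnj z), and the geometry becomes algebra in the coefficients of A and B.
  Moreover \<open>nu\<close> does not depend on the loop parameter. Tangency of F' is a condition at
  \<open>lam\<close>, constancy of the line one at \<alpha>, and both prescribe this same
  \<open>nu\<close>. With C = coth \<beta> and D = 1 / sinh \<beta> the two prescriptions agree
  because D / \<alpha> = (C - 1) / lam and D * \<alpha> = (C + 1) * lam; this is the origin of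
  \<beta> = ln (\<alpha> / lam). No differential equation has to be solved in either direction: the
  line is transported by \<Phi> at \<alpha>, and conversely a nowhere vanishing vector field whose
  derivative is a multiple of itself spans a constant line.\<close>

lemma frechet_derivative_eqI:
  assumes "(f has_derivative f') (at x)"
  shows "frechet_derivative f (at x) v = f' v"
  using frechet_derivative_at[OF assms] by simp

lemma pd_has_derivative:
  assumes "f differentiable (at x)"
  shows "(f has_derivative (\<lambda>v. frechet_derivative f (at x) v)) (at x)"
  using assms frechet_derivative_works by auto

text \<open>Openness makes \<open>f\<close> and \<open>g\<close> agree near each point of
  \<open>U\<close>, so their derivatives there coincide and the induction can pass to the derivative
  maps.\<close>

lemma Ck_on_cong:
  assumes "open U" "\<And>x. x \<in> U \<Longrightarrow> f x = g x"
  shows "Ck_on k U f \<longleftrightarrow> Ck_on k U g"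
  using assms(2)
proof (induction k arbitrary: f g)
  case 0
  then show ?case unfolding Ck_on.simps(1) by (intro continuous_on_cong refl)
next
  case (Suc k)
  have der: "(f has_derivative D) (at x) \<longleftrightarrow> (g has_derivative D) (at x)" if "x \<in> U" for x D
    using has_derivative_transform_within_open[OF _ \<open>open U\<close> that, of f D UNIV g]
      has_derivative_transform_within_open[OF _ \<open>open U\<close> that, of g D UNIV f] Suc.prems by auto
  then have d: "f differentiable (at x) \<longleftrightarrow> g differentiable (at x)" if "x \<in> U" for x
    using that by (simp add: differentiable_def)
  have fr: "frechet_derivative f (at x) = frechet_derivative g (at x)" if "x \<in> U" for x
    using der[OF that] by (simp add: frechet_derivative_def)
  have "Ck_on k U (\<lambda>x. frechet_derivative f (at x) v)
      \<longleftrightarrow> Ck_on k U (\<lambda>x. frechet_derivative g (at x) v)" for v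
    by (rule Suc.IH) (simp add: fr)
  with d show ?case unfolding Ck_on.simps(2) by blast
qed

text \<open>Lets an explicit derivative stand in for \<open>frechet_derivative\<close>, so that the
  closure properties become inductions over the usual differentiation rules.\<close>

lemma Ck_on_SucI:
  assumes "open U" "\<And>x. x \<in> U \<Longrightarrow> (f has_derivative f' x) (at x)"
    "\<And>v. Ck_on k U (\<lambda>x. f' x v)"
  shows "Ck_on (Suc k) U f"
proof -
  have "Ck_on k U (\<lambda>x. frechet_derivative f (at x) v)" for v
    using assms(3)[of v]
    by (subst Ck_on_cong[OF assms(1), where g = "\<lambda>x. f' x v"]) (simp_all add: frechet_derivative_eqI[OF assms(2)])
  moreover have "f differentiable (at x)" if "x \<in> U" for x
    using assms(2)[OF that] by (auto simp: differentiable_def)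
  ultimately show ?thesis unfolding Ck_on.simps(2) by blast
qed

lemma Ck_on_SucD:
  assumes "Ck_on (Suc k) U f" "x \<in> U"
  shows "(f has_derivative (\<lambda>v. frechet_derivative f (at x) v)) (at x)"
  using assms pd_has_derivative unfolding Ck_on.simps(2) by blast

lemma Ck_on_SucD': "Ck_on (Suc k) U f \<Longrightarrow> Ck_on k U (\<lambda>x. frechet_derivative f (at x) v)"
  unfolding Ck_on.simps(2) by blast

lemma Ck_on_Suc_weaken: "Ck_on (Suc k) U f \<Longrightarrow> Ck_on k U f"
proof (induction k arbitrary: f)
  case 0
  then have "f differentiable_on U"
    by (meson Ck_on.simps(2) differentiable_at_imp_differentiable_on)
  then show ?case by (simp add: differentiable_imp_continuous_on)
next
  case (Suc k)
  show ?case
    unfolding Ck_on.simps(2)[of k] using Suc.prems[unfolded Ck_on.simps(2)[of "Suc k"]] Suc.IH by blast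
qed

lemma smooth_on_imp_continuous_on: "smooth_on U f \<Longrightarrow> continuous_on U f"
  unfolding smooth_on_def Ck_on.simps(1)[symmetric] by blast

lemma smooth_on_has_derivative:
  "smooth_on U f \<Longrightarrow> x \<in> U \<Longrightarrow> (f has_derivative (\<lambda>v. frechet_derivative f (at x) v)) (at x)"
  unfolding smooth_on_def using Ck_on_SucD by blast

lemma smooth_on_frechet: "smooth_on U f \<Longrightarrow> smooth_on U (\<lambda>x. frechet_derivative f (at x) v)"
  unfolding smooth_on_def using Ck_on_SucD' by blast

lemma smooth_on_cong:
  "open U \<Longrightarrow> (\<And>x. x \<in> U \<Longrightarrow> f x = g x) \<Longrightarrow> smooth_on U f \<longleftrightarrow> smooth_on U g"
  unfolding smooth_on_def using Ck_on_cong by blast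

lemma Ck_on_subset: "Ck_on k U f \<Longrightarrow> V \<subseteq> U \<Longrightarrow> Ck_on k V f"
proof (induction k arbitrary: f)
  case 0
  then show ?case using continuous_on_subset by (simp only: Ck_on.simps(1))
next
  case (Suc k)
  then show ?case unfolding Ck_on.simps(2) by blast
qed

lemma smooth_on_subset: "smooth_on U f \<Longrightarrow> V \<subseteq> U \<Longrightarrow> smooth_on V f"
  unfolding smooth_on_def using Ck_on_subset by blast

section \<open>Closure properties of the classes C^k\<close>

lemma Ck_on_const: "Ck_on k U (\<lambda>x. c)"
proof (induction k arbitrary: c)
  case (Suc k)
  have "frechet_derivative (\<lambda>x. c) (at x) = (\<lambda>v. 0)" for x
    by (simp add: fun_eq_iff frechet_derivative_eqI[OF has_derivative_const])
  then show ?case using Suc.IH[of 0] by simp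
qed simp

lemma smooth_on_const: "smooth_on U (\<lambda>x. c)"
  unfolding smooth_on_def using Ck_on_const by blast

lemma Ck_on_bounded_linear:
  assumes "open U" "bounded_linear L" "Ck_on k U f"
  shows "Ck_on k U (\<lambda>x. L (f x))"
  using assms(3)
proof (induction k arbitrary: f)
  case 0
  then show ?case by (simp add: bounded_linear.continuous_on[OF assms(2)])
next
  case (Suc k)
  show ?case
  proof (rule Ck_on_SucI[OF assms(1)])
    show "((\<lambda>x. L (f x)) has_derivative (\<lambda>v. L (frechet_derivative f (at x) v))) (at x)"
      if "x \<in> U" for x
      using bounded_linear.has_derivative[OF assms(2) Ck_on_SucD[OF Suc.prems that]] .
    show "Ck_on k U (\<lambda>x. L (frechet_derivative f (at x) v))" for v
      by (intro Suc.IH Ck_on_SucD' Suc.prems)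
  qed
qed

lemma Ck_on_add:
  assumes "open U" "Ck_on k U f" "Ck_on k U g"
  shows "Ck_on k U (\<lambda>x. f x + g x)"
  using assms(2,3)
proof (induction k arbitrary: f g)
  case 0
  then show ?case by (simp add: continuous_on_add)
next
  case (Suc k)
  show ?case
    by (rule Ck_on_SucI[OF assms(1) has_derivative_add[OF Ck_on_SucD[OF Suc.prems(1)] Ck_on_SucD[OF Suc.prems(2)]]])
      (assumption | intro Suc.IH Ck_on_SucD' Suc.prems)+
qed

text \<open>The product rule gives two terms of the same shape, one order lower; the
  undifferentiated factor is weakened from order k + 1 to k to fit the induction hypothesis.\<close>

lemma Ck_on_bilinear:
  assumes "open U" "bounded_bilinear B" "Ck_on k U f" "Ck_on k U g"
  shows "Ck_on k U (\<lambda>x. B (f x) (g x))"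
  using assms(3,4)
proof (induction k arbitrary: f g)
  case 0
  then show ?case by (simp add: bounded_bilinear.continuous_on[OF assms(2)])
next
  case (Suc k)
  show ?case
  proof (rule Ck_on_SucI[OF assms(1) bounded_bilinear.FDERIV[OF assms(2) Ck_on_SucD[OF Suc.prems(1)] Ck_on_SucD[OF Suc.prems(2)]]])
    fix v
    show "Ck_on k U (\<lambda>x. B (f x) (frechet_derivative g (at x) v) +
            B (frechet_derivative f (at x) v) (g x))"
      by (intro Ck_on_add assms(1) Suc.IH Ck_on_SucD' Suc.prems Ck_on_Suc_weaken[OF Suc.prems(1)]
          Ck_on_Suc_weaken[OF Suc.prems(2)])
  qed
qed

text \<open>The derivative -(1/f) Df (1/f) contains 1/f again, so the induction hypothesis combines
  with the product rule \<open>Ck_on_bilinear\<close>.\<close>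

lemma Ck_on_inverse:
  fixes f :: "'a::real_normed_vector \<Rightarrow> 'b::real_normed_field"
  assumes "open U" "\<And>x. x \<in> U \<Longrightarrow> f x \<noteq> 0" "Ck_on k U f"
  shows "Ck_on k U (\<lambda>x. inverse (f x))"
  using assms(3)
proof (induction k)
  case 0
  then show ?case using assms(2) by (auto intro!: continuous_on_inverse)
next
  case (Suc k)
  have i: "Ck_on k U (\<lambda>x. inverse (f x))"
    using Suc.IH Ck_on_Suc_weaken[OF Suc.prems] by simp
  show ?case
  proof (rule Ck_on_SucI[OF assms(1)])
    show "((\<lambda>x. inverse (f x)) has_derivative
        (\<lambda>h. - (inverse (f x) * frechet_derivative f (at x) h * inverse (f x)))) (at x)" if "x \<in> U" for x
      using Deriv.has_derivative_inverse[OF _ Ck_on_SucD[OF Suc.prems that]] assms(2) that by auto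
    show "Ck_on k U (\<lambda>x. - (inverse (f x) * frechet_derivative f (at x) v * inverse (f x)))" for v
      by (intro Ck_on_bounded_linear[OF assms(1) bounded_linear_minus[OF bounded_linear_ident]]
          Ck_on_bilinear[OF assms(1) bounded_bilinear_mult] i Ck_on_SucD' Suc.prems)
  qed
qed

lemma smooth_on_bounded_linear:
  "open U \<Longrightarrow> bounded_linear L \<Longrightarrow> smooth_on U f \<Longrightarrow> smooth_on U (\<lambda>x. L (f x))"
  unfolding smooth_on_def using Ck_on_bounded_linear by blast

lemma smooth_on_add:
  "open U \<Longrightarrow> smooth_on U f \<Longrightarrow> smooth_on U g \<Longrightarrow> smooth_on U (\<lambda>x. f x + g x)"
  unfolding smooth_on_def using Ck_on_add by blast

lemma smooth_on_bilinear:
  "open U \<Longrightarrow> bounded_bilinear B \<Longrightarrow> smooth_on U f \<Longrightarrow> smooth_on U g \<Longrightarrow>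
    smooth_on U (\<lambda>x. B (f x) (g x))"
  unfolding smooth_on_def using Ck_on_bilinear by blast

lemma smooth_on_inverse:
  fixes f :: "'a::real_normed_vector \<Rightarrow> 'b::real_normed_field"
  shows "open U \<Longrightarrow> (\<And>x. x \<in> U \<Longrightarrow> f x \<noteq> 0) \<Longrightarrow> smooth_on U f \<Longrightarrow> smooth_on U (\<lambda>x. inverse (f x))"
  unfolding smooth_on_def using Ck_on_inverse by blast

section \<open>Joint smoothness restricted to one variable\<close>

lemma slice_has_derivative:
  assumes "(G has_derivative G') (at (z, \<mu>))"
  shows "((\<lambda>w. G (w, \<mu>)) has_derivative (\<lambda>v. G' (v, 0))) (at z)"
    and "((\<lambda>\<nu>. G (z, \<nu>)) has_derivative (\<lambda>t. G' (0, t))) (at \<mu>)"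
proof -
  have "((\<lambda>w. (w, \<mu>)) has_derivative (\<lambda>v. (v, 0))) (at z)"
    "((\<lambda>\<nu>. (z, \<nu>)) has_derivative (\<lambda>t. (0, t))) (at \<mu>)"
    by (auto intro!: derivative_eq_intros)
  from has_derivative_compose[OF this(1) assms] has_derivative_compose[OF this(2) assms]
  show "((\<lambda>w. G (w, \<mu>)) has_derivative (\<lambda>v. G' (v, 0))) (at z)"
    "((\<lambda>\<nu>. G (z, \<nu>)) has_derivative (\<lambda>t. G' (0, t))) (at \<mu>)" by simp_all
qed

text \<open>The derivative of the slice in direction v is the slice of the derivative of
  \<open>G\<close> in direction (v, 0); hence the induction over arbitrary \<open>G\<close>.\<close>

lemma Ck_on_slice:
  assumes "open U" "\<And>z. z \<in> U \<Longrightarrow> (z, \<mu>) \<in> W" "Ck_on k W G"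
  shows "Ck_on k U (\<lambda>z. G (z, \<mu>))"
  using assms(3)
proof (induction k arbitrary: G)
  case 0
  then have "continuous_on W G" by simp
  then show ?case
    using assms(2) by (auto intro!: continuous_intros continuous_on_compose2[of W G])
next
  case (Suc k)
  show ?case
  proof (rule Ck_on_SucI[OF assms(1)])
    show "((\<lambda>z. G (z, \<mu>)) has_derivative (\<lambda>v. frechet_derivative G (at (z, \<mu>)) (v, 0))) (at z)"
      if "z \<in> U" for z
      by (rule slice_has_derivative(1)[OF Ck_on_SucD[OF Suc.prems assms(2)[OF that]]])
    show "Ck_on k U (\<lambda>z. frechet_derivative G (at (z, \<mu>)) (v, 0))" for v
      by (intro Suc.IH Ck_on_SucD' Suc.prems)
  qed
qed

lemma smooth_on_slice:
  "open U \<Longrightarrow> (\<And>z. z \<in> U \<Longrightarrow> (z, \<mu>) \<in> W) \<Longrightarrow> smooth_on W G \<Longrightarrow> smooth_on U (\<lambda>z. G (z, \<mu>))"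
  unfolding smooth_on_def using Ck_on_slice by blast


text \<open>Differentiate \<open>f (x + s u + t v) - f (x + s u) = \<integral> D\<^sub>v f (x + s u + \<tau> v) d\<tau>\<close> under the
  integral with respect to \<open>s\<close>, and then with respect to \<open>t\<close>.\<close>

lemma frechet_derivative_commute:
  fixes f :: "'a::real_normed_vector \<Rightarrow> 'b::euclidean_space"
  assumes "open U" "smooth_on U f" "x \<in> U"
  shows "frechet_derivative (\<lambda>y. frechet_derivative f (at y) u) (at x) v =
    frechet_derivative (\<lambda>y. frechet_derivative f (at y) v) (at x) u"
proof -
  define Du where "Du = (\<lambda>y. frechet_derivative f (at y) u)"
  define Dv where "Dv = (\<lambda>y. frechet_derivative f (at y) v)"
  define Duv where "Duv = (\<lambda>y. frechet_derivative Dv (at y) u)"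
  have sDv: "smooth_on U Dv" and sDu: "smooth_on U Du" and sDuv: "smooth_on U Duv"
    unfolding Dv_def Du_def Duv_def using assms(2) smooth_on_frechet by blast+
  define p where "p = (\<lambda>s t::real. x + s *\<^sub>R u + t *\<^sub>R v)"
  have "open ((\<lambda>q. p (fst q) (snd q)) -` U)"
    unfolding p_def by (intro open_vimage assms(1) continuous_intros)
  moreover have "(0,0) \<in> (\<lambda>q. p (fst q) (snd q)) -` U"
    using assms(3) by (simp add: p_def)
  ultimately obtain S T where ST: "open S" "open T" "(0,0) \<in> S \<times> T" "S \<times> T \<subseteq> (\<lambda>q. p (fst q) (snd q)) -` U"
    by (rule open_prod_elim)
  obtain e1 where e1: "e1 > 0" "\<And>s. \<bar>s\<bar> < e1 \<Longrightarrow> s \<in> S"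
    using ST(1,3) by (fastforce simp: open_dist dist_real_def)
  obtain e2 where e2: "e2 > 0" "\<And>t. \<bar>t\<bar> < e2 \<Longrightarrow> t \<in> T"
    using ST(2,3) by (fastforce simp: open_dist dist_real_def)
  \<comment> \<open>Half of the minimum, so that the closed square with |s| and |t| at most
    \<open>e\<close> still lands in \<open>U\<close>; the integrals and the Leibniz rule live on
    closed intervals.\<close>
  define e where "e = min e1 e2 / 2"
  have pU: "p s t \<in> U" if "\<bar>s\<bar> \<le> e" "\<bar>t\<bar> \<le> e" for s t
  proof -
    have "s \<in> S" "t \<in> T" using that e1 e2 by (auto simp: e_def intro!: e1(2) e2(2))
    then show ?thesis using ST(4) by auto
  qed
  have e: "e > 0" using e1 e2 by (auto simp: e_def)
  have dp_t: "((\<lambda>t. p s t) has_derivative (\<lambda>h. h *\<^sub>R v)) (at t)"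
    and dp_s: "((\<lambda>s. p s t) has_derivative (\<lambda>h. h *\<^sub>R u)) (at s)" for s t
    unfolding p_def by (auto intro!: derivative_eq_intros)
  have along_t: "((\<lambda>t. g (p s t)) has_vector_derivative frechet_derivative g (at (p s t)) v) (at t)"
    and along_s: "((\<lambda>s. g (p s t)) has_vector_derivative frechet_derivative g (at (p s t)) u) (at s)"
    if "smooth_on U g" "\<bar>s\<bar> \<le> e" "\<bar>t\<bar> \<le> e" for g :: "'a \<Rightarrow> 'b" and s t
  proof -
    have d: "(g has_derivative (\<lambda>v. frechet_derivative g (at (p s t)) v)) (at (p s t))"
      by (rule smooth_on_has_derivative[OF that(1) pU[OF that(2,3)]])
    have l: "frechet_derivative g (at (p s t)) (h *\<^sub>R w) = h *\<^sub>R frechet_derivative g (at (p s t)) w" for h w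
      using d by (simp add: has_derivative_linear linear_cmul)
    show "((\<lambda>t. g (p s t)) has_vector_derivative frechet_derivative g (at (p s t)) v) (at t)"
      using has_derivative_compose[OF dp_t d] by (simp add: has_vector_derivative_def l)
    show "((\<lambda>s. g (p s t)) has_vector_derivative frechet_derivative g (at (p s t)) u) (at s)"
      using has_derivative_compose[OF dp_s d] by (simp add: has_vector_derivative_def l)
  qed
  have contp: "continuous_on ({-e..e} \<times> {-e..e}) (\<lambda>(s,t). g (p s t))" if "smooth_on U g" for g :: "'a \<Rightarrow> 'b"
  proof -
    have "continuous_on ({-e..e} \<times> {-e..e}) (\<lambda>q. p (fst q) (snd q))"
      unfolding p_def by (intro continuous_intros)
    moreover have "(\<lambda>q. p (fst q) (snd q)) ` ({-e..e} \<times> {-e..e}) \<subseteq> U"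
      by (auto intro!: pU)
    ultimately show ?thesis
      using continuous_on_compose2[OF smooth_on_imp_continuous_on[OF that]]
      by (fastforce simp: case_prod_beta)
  qed
  have ct: "continuous_on {0..t} (\<lambda>\<tau>. g (p s \<tau>))"
    if "smooth_on U g" "\<bar>s\<bar> \<le> e" "t \<le> e" for g :: "'a \<Rightarrow> 'b" and s t
    by (rule continuous_on_subset[of "{-e..e}"], rule continuous_on_compose2[OF contp[OF that(1)], where f = "\<lambda>\<tau>. (s,\<tau>)", simplified])
      (use that e in \<open>auto intro!: continuous_intros\<close>)
  have int1: "integral {0..t} (\<lambda>\<tau>. Dv (p s \<tau>)) = f (p s t) - f (p s 0)"
    if "\<bar>s\<bar> \<le> e" "0 \<le> t" "t \<le> e" for s t
  proof (rule integral_unique, rule fundamental_theorem_of_calculus[OF that(2)])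
    fix \<tau> assume "\<tau> \<in> {0..t}"
    then have "\<bar>\<tau>\<bar> \<le> e" using that by auto
    from along_t[OF assms(2) that(1) this]
    show "((\<lambda>\<tau>. f (p s \<tau>)) has_vector_derivative Dv (p s \<tau>)) (at \<tau> within {0..t})"
      unfolding Dv_def by (rule has_vector_derivative_at_within)
  qed
  \<comment> \<open>Both sides are the derivative at s = 0 of the integral in \<open>int1\<close>:
    one by differentiating under the integral, the other from its closed form.\<close>
  have int2: "integral {0..t} (\<lambda>\<tau>. Duv (p 0 \<tau>)) = Du (p 0 t) - Du (p 0 0)"
    if t: "0 \<le> t" "t \<le> e" for t
  proof -
    have "((\<lambda>s. integral (cbox 0 t) (\<lambda>\<tau>. Dv (p s \<tau>))) has_vector_derivative
        integral (cbox 0 t) (\<lambda>\<tau>. Duv (p 0 \<tau>))) (at 0 within {-e..e})"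
    proof (rule leibniz_rule_vector_derivative)
      fix s \<tau> :: real assume st: "s \<in> {-e..e}" "\<tau> \<in> cbox 0 t"
      have "\<bar>s\<bar> \<le> e" "\<bar>\<tau>\<bar> \<le> e" using st t by auto
      from along_s[OF sDv this]
      show "((\<lambda>s. Dv (p s \<tau>)) has_vector_derivative Duv (p s \<tau>)) (at s within {-e..e})"
        unfolding Duv_def by (rule has_vector_derivative_at_within)
    next
      fix s assume "s \<in> {-e..e}"
      then show "(\<lambda>\<tau>. Dv (p s \<tau>)) integrable_on cbox 0 t"
        unfolding cbox_interval by (intro integrable_continuous_real ct sDv) (use t in auto)
    next
      show "continuous_on ({-e..e} \<times> cbox 0 t) (\<lambda>(s,\<tau>). Duv (p s \<tau>))"
        by (rule continuous_on_subset[OF contp[OF sDuv]]) (use t e in auto)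
    qed (use e in auto)
    then have 1: "((\<lambda>s. integral {0..t} (\<lambda>\<tau>. Dv (p s \<tau>))) has_vector_derivative
        integral {0..t} (\<lambda>\<tau>. Duv (p 0 \<tau>))) (at 0 within {-e..e})" by (simp only: cbox_interval)
    have "((\<lambda>s. f (p s t) - f (p s 0)) has_vector_derivative Du (p 0 t) - Du (p 0 0)) (at 0 within {-e..e})"
      unfolding Du_def
      by (intro has_vector_derivative_at_within[OF has_vector_derivative_diff] along_s assms(2)) (use t e in auto)
    then have 2: "((\<lambda>s. integral {0..t} (\<lambda>\<tau>. Dv (p s \<tau>))) has_vector_derivative Du (p 0 t) - Du (p 0 0)) (at 0 within {-e..e})"
      by (rule has_vector_derivative_transform[rotated 2]) (use e t int1 in auto)
    have "at (0::real) within {-e..e} \<noteq> bot"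
      using e by (simp add: trivial_limit_within islimpt_Icc)
    then show ?thesis
      using vector_derivative_unique_within[OF _ 1 2] by simp
  qed
  \<comment> \<open>Since \<open>int2\<close> holds only for nonnegative t, the comparison uses
    one-sided derivatives at 0, which are unique within \<open>{0..e}\<close>.\<close>
  have "((\<lambda>t. integral {0..t} (\<lambda>\<tau>. Duv (p 0 \<tau>))) has_vector_derivative Duv (p 0 0)) (at 0 within {0..e})"
    by (rule integral_has_vector_derivative[OF ct[OF sDuv]]) (use e in auto)
  then have 3: "((\<lambda>t. Du (p 0 t) - Du (p 0 0)) has_vector_derivative Duv (p 0 0)) (at 0 within {0..e})"
    by (rule has_vector_derivative_transform[rotated 2]) (use e int2 in auto)
  have 4: "((\<lambda>t. Du (p 0 t) - Du (p 0 0)) has_vector_derivative frechet_derivative Du (at (p 0 0)) v - 0) (at 0 within {0..e})"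
    by (intro has_vector_derivative_at_within[OF has_vector_derivative_diff] along_t sDu has_vector_derivative_const) (use e in auto)
  have "at (0::real) within {0..e} \<noteq> bot"
    using e by (simp add: trivial_limit_within islimpt_Icc)
  from vector_derivative_unique_within[OF this 3 4]
  show ?thesis by (simp add: p_def Duv_def Du_def Dv_def)
qed

section \<open>Algebra in complex 3-space\<close>

lemma ccross_nth [simp]:
  "ccross u v $ 1 = u$2 * v$3 - u$3 * v$2"
  "ccross u v $ 2 = u$3 * v$1 - u$1 * v$3"
  "ccross u v $ 3 = u$1 * v$2 - u$2 * v$1"
  by (simp_all add: ccross_def)

lemma cform_3: "cform u v = u$1 * v$1 + u$2 * v$2 + u$3 * v$3"
  by (simp add: cform_def sum_3)

lemma cvec_eq_iff: "u = v \<longleftrightarrow> u$1 = v$1 \<and> u$2 = v$2 \<and> u$3 = v$3" for u v :: cvec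
  by (simp add: vec_eq_iff forall_3)

lemma cmat_mult_nth: "(A ** B) $ i $ j = A$i$1 * B$1$j + A$i$2 * B$2$j + A$i$3 * B$3$j" for A B :: cmat
  by (simp add: matrix_matrix_mult_def sum_3)

lemma cmat_vec_nth: "(A *v u) $ i = A$i$1 * u$1 + A$i$2 * u$2 + A$i$3 * u$3" for A :: cmat
  by (simp add: matrix_vector_mult_def sum_3)

lemma cmat_eq_iff: "A = B \<longleftrightarrow> (\<forall>i j. A$i$j = B$i$j)" for A B :: cmat
  by (simp add: vec_eq_iff)

lemma mscale_nth [simp]: "(c *\<^sub>m M) $ i $ j = c * M $ i $ j"
  by (simp add: mscale_def)

lemma xi_nth [simp]:
  "xi u $ 1 $ 1 = 0" "xi u $ 1 $ 2 = - u$3" "xi u $ 1 $ 3 = u$2"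
  "xi u $ 2 $ 1 = u$3" "xi u $ 2 $ 2 = 0" "xi u $ 2 $ 3 = - u$1"
  "xi u $ 3 $ 1 = - u$2" "xi u $ 3 $ 2 = u$1" "xi u $ 3 $ 3 = 0"
  by (simp_all add: xi_entries)

text \<open>Given by entries on all matrices, so that it is linear; on \<open>so3C\<close> it
  inverts \<open>xi\<close>.\<close>

definition vee :: "cmat \<Rightarrow> cvec" where
  "vee M = vector [M$3$2, M$1$3, M$2$1]"

lemma vee_nth [simp]: "vee M $ 1 = M$3$2" "vee M $ 2 = M$1$3" "vee M $ 3 = M$2$1"
  by (simp_all add: vee_def)

lemma vee_xi [simp]: "vee (xi u) = u"
  by (simp add: cvec_eq_iff)

lemma xi_vee: "M \<in> so3C \<Longrightarrow> xi (vee M) = M"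
proof -
  assume "M \<in> so3C"
  then have *: "M$j$i = - M$i$j" for i j
  proof -
    have "transpose M $ i $ j = (- M) $ i $ j"
      using \<open>M \<in> so3C\<close> unfolding so3C_def by simp
    then show ?thesis by (simp add: transpose_def)
  qed
  have d: "M$i$i = 0" for i
  proof -
    have "M$i$i + M$i$i = 0" by (subst (1) *) (rule left_minus)
    then show ?thesis by simp
  qed
  show ?thesis
    unfolding cmat_eq_iff forall_3
    by (simp only: xi_nth vee_nth d[of 1] d[of 2] d[of 3] *[of 1 2] *[of 1 3] *[of 2 3]) simp
qed

lemma xi_so3C: "xi u \<in> so3C"
  by (simp add: so3C_def vec_eq_iff forall_3 transpose_def)

lemma transpose_xi: "transpose (xi u) = - xi u"
  using xi_so3C by (simp add: so3C_def)

lemma xi_inject [simp]: "xi u = xi v \<longleftrightarrow> u = v"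
  by (metis vee_xi)

lemma xi_add: "xi (u + v) = xi u + xi v"
  and xi_minus: "xi (- u) = - xi u"
  and xi_smult: "xi (c *s u) = c *\<^sub>m xi u"
  and xi_0: "xi 0 = 0"
  by (simp_all add: cmat_eq_iff forall_3)

lemma linear_xi: "linear xi"
  by (rule linearI) (simp_all add: cmat_eq_iff forall_3)

lemma bounded_linear_xi: "bounded_linear xi"
  using linear_xi linear_conv_bounded_linear by blast

lemma bounded_linear_vee: "bounded_linear vee"
  by (rule linear_conv_bounded_linear[THEN iffD1], rule linearI) (simp_all add: cvec_eq_iff)

lemma bounded_linear_transpose: "bounded_linear (transpose :: cmat \<Rightarrow> cmat)"
  by (rule linear_conv_bounded_linear[THEN iffD1], rule linearI) (simp_all add: cmat_eq_iff transpose_def)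

lemma bounded_bilinear_cmat_mult: "bounded_bilinear ((**) :: cmat \<Rightarrow> cmat \<Rightarrow> cmat)"
  unfolding bilinear_conv_bounded_bilinear[symmetric] bilinear_def
  by (intro conjI allI linearI)
    (simp_all add: cmat_eq_iff cmat_mult_nth scaleR_add_right scaleR_diff_right algebra_simps)

lemma bounded_bilinear_cmat_vec: "bounded_bilinear ((*v) :: cmat \<Rightarrow> cvec \<Rightarrow> cvec)"
  unfolding bilinear_conv_bounded_bilinear[symmetric] bilinear_def
  by (intro conjI allI linearI)
    (simp_all add: cvec_eq_iff cmat_vec_nth scaleR_add_right scaleR_diff_right algebra_simps)

lemma bounded_bilinear_smult: "bounded_bilinear ((*s) :: complex \<Rightarrow> cvec \<Rightarrow> cvec)"
  unfolding bilinear_conv_bounded_bilinear[symmetric] bilinear_def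
  by (intro conjI allI linearI)
    (simp_all add: cvec_eq_iff scaleR_add_right scaleR_diff_right algebra_simps)

lemma bounded_bilinear_cform: "bounded_bilinear cform"
  unfolding bilinear_conv_bounded_bilinear[symmetric] bilinear_def
  by (intro conjI allI linearI)
    (simp_all add: cform_3 scaleR_add_right scaleR_diff_right algebra_simps)

lemma bounded_bilinear_ccross: "bounded_bilinear ccross"
  unfolding bilinear_conv_bounded_bilinear[symmetric] bilinear_def
  by (intro conjI allI linearI)
    (simp_all add: cvec_eq_iff scaleR_add_right scaleR_diff_right algebra_simps)

lemma bounded_linear_mscale: "bounded_linear (\<lambda>M. c *\<^sub>m M)"
  by (rule linear_conv_bounded_linear[THEN iffD1], rule linearI) (simp_all add: cmat_eq_iff algebra_simps)

lemma cform_linear: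
  "cform (u + v) w = cform u w + cform v w" "cform w (u + v) = cform w u + cform w v"
  "cform (u - v) w = cform u w - cform v w" "cform w (u - v) = cform w u - cform w v"
  "cform (- u) w = - cform u w" "cform w (- u) = - cform w u"
  "cform (c *s u) w = c * cform u w" "cform w (c *s u) = c * cform w u"
  by (simp_all add: cform_3 algebra_simps)

lemma cform_commute: "cform u v = cform v u"
  by (simp add: cform_3 algebra_simps)

lemma cmat_vec_linear:
  fixes M :: cmat
  shows "M *v (u + v) = M *v u + M *v v" "M *v (u - v) = M *v u - M *v v"
    "M *v (- u) = - (M *v u)" "M *v (c *s u) = c *s (M *v u)"
  by (simp_all add: cvec_eq_iff cmat_vec_nth algebra_simps)

lemma cform_nondegenerate: "(\<And>w. cform u w = cform v w) \<Longrightarrow> u = v"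
proof -
  assume *: "\<And>w. cform u w = cform v w"
  show ?thesis
    using *[of "axis 1 1"] *[of "axis 2 1"] *[of "axis 3 1"]
    by (simp add: cvec_eq_iff cform_3 axis_def)
qed

abbreviation e1 :: cvec where "e1 \<equiv> axis 1 1"

lemma e1_nth: "e1 $ 1 = 1" "e1 $ 2 = 0" "e1 $ 3 = 0"
  by (simp_all add: axis_def)

text \<open>\<open>matrix_inv\<close> is defined by choice; a two-sided inverse pins it
  down.\<close>

lemma matrix_inv_eqI:
  fixes A B :: cmat
  assumes "A ** B = mat 1" "B ** A = mat 1"
  shows "matrix_inv A = B"
proof -
  have "A ** matrix_inv A = mat 1 \<and> matrix_inv A ** A = mat 1"
    unfolding matrix_inv_def by (rule someI[of _ B]) (use assms in auto)
  then show ?thesis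
    by (metis assms(2) matrix_mul_assoc matrix_mul_lid matrix_mul_rid)
qed

text \<open>The rule would turn \<open>transpose M *v x\<close> into \<open>x v* M\<close> and hide
  the rotation by the inverse of an orthogonal \<open>M\<close>.\<close>

declare transpose_matrix_vector [simp del]

subsection \<open>The complex rotation group\<close>

lemma SO3C_transpose:
  assumes "M \<in> SO3C"
  shows "transpose M ** M = mat 1" "M ** transpose M = mat 1"
  using assms by (auto simp: SO3C_def orthogonal_matrix_def)

lemma SO3C_inv: "M \<in> SO3C \<Longrightarrow> matrix_inv M = transpose M"
  using SO3C_transpose by (intro matrix_inv_eqI) auto

lemma SO3C_mult_transpose:
  assumes "M \<in> SO3C"
  shows "transpose M *v (M *v u) = u" "M *v (transpose M *v u) = u"
  using SO3C_transpose[OF assms] by (simp_all add: matrix_vector_mul_assoc)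

lemma cform_transpose: "cform (M *v u) v = cform u (transpose M *v v)" for M :: cmat
  by (simp add: cform_3 cmat_vec_nth transpose_def algebra_simps)

lemma SO3C_cform: "M \<in> SO3C \<Longrightarrow> cform (M *v u) (M *v v) = cform u v"
  by (simp add: cform_transpose SO3C_mult_transpose)

lemma SO3C_transpose_mem: "M \<in> SO3C \<Longrightarrow> transpose M \<in> SO3C"
  by (simp add: SO3C_def orthogonal_matrix_def)

text \<open>A triple product is the determinant of its three columns, and \<open>M\<close> acts on
  all columns at once.\<close>

lemma cform_ccross_det: "cform (ccross (M *v u) (M *v v)) (M *v w) = det M * cform (ccross u v) w"
  for M :: cmat
  unfolding cform_3 ccross_nth cmat_vec_nth det_3 by algebra

text \<open>By nondegeneracy of the form it is enough to compare triple products. Here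
  \<open>det M = 1\<close> enters: determinant -1 would produce a sign.\<close>

lemma SO3C_ccross:
  assumes "M \<in> SO3C"
  shows "ccross (M *v u) (M *v v) = M *v ccross u v"
proof (rule cform_nondegenerate)
  fix w
  have "cform (ccross (M *v u) (M *v v)) (M *v (transpose M *v w)) = cform (ccross u v) (transpose M *v w)"
    using assms unfolding cform_ccross_det by (simp add: SO3C_def)
  then show "cform (ccross (M *v u) (M *v v)) w = cform (M *v ccross u v) w"
    using assms by (simp add: SO3C_mult_transpose cform_transpose)
qed

text \<open>Equivariance of the cross product as a matrix identity. Through it, normals and
  displacements written as conjugates become rotated vectors.\<close>

lemma SO3C_conj_xi:
  assumes "M \<in> SO3C"
  shows "M ** xi u ** matrix_inv M = xi (M *v u)"
proof -
  have "(M ** xi u ** transpose M) *v v = xi (M *v u) *v v" for v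
    using SO3C_ccross[OF assms, of u "transpose M *v v"] assms
    by (simp add: matrix_vector_mul_assoc[symmetric] ccross_xi SO3C_mult_transpose)
  then show ?thesis using assms by (simp add: SO3C_inv matrix_eq)
qed

section \<open>Derivatives of extended framings\<close>

lemma UNIV_times_punctured: "open (UNIV \<times> - {0} :: (complex \<times> complex) set)"
  by (intro open_Times open_UNIV open_Compl closed_singleton)

lemma mscale_so3C: "M \<in> so3C \<Longrightarrow> c *\<^sub>m M \<in> so3C"
proof -
  assume "M \<in> so3C"
  moreover have "transpose (c *\<^sub>m M) = c *\<^sub>m transpose M" "c *\<^sub>m (- M) = - (c *\<^sub>m M)"
    by (simp_all add: cmat_eq_iff transpose_def)
  ultimately show ?thesis by (simp add: so3C_def)
qed

text \<open>The data of an extended framing with matrices replaced by vectors through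
  \<open>xi\<close>: \<open>A_1\<close> and \<open>B_1\<close> place the two coefficients in m^C,
  and \<open>k\<close> is the scalar in front of \<open>e1\<close>.\<close>

locale framing =
  fixes \<Phi> :: "complex \<Rightarrow> complex \<Rightarrow> cmat" and A B :: "complex \<Rightarrow> cvec"
    and k :: "complex \<Rightarrow> complex \<Rightarrow> complex"
  assumes SO: "\<mu> \<noteq> 0 \<Longrightarrow> \<Phi> z \<mu> \<in> SO3C"
    and entries_holomorphic: "(\<lambda>\<mu>. \<Phi> z \<mu> $ i $ j) holomorphic_on - {0}"
    and smooth: "smooth_on (UNIV \<times> - {0}) (\<lambda>(z, \<mu>). \<Phi> z \<mu>)"
    and A_1: "A z $ 1 = 0" and B_1: "B z $ 1 = 0"
    and MC: "\<mu> \<noteq> 0 \<Longrightarrow> matrix_inv (\<Phi> z \<mu>) ** pd v (\<lambda>w. \<Phi> w \<mu>) z =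
      xi ((inverse \<mu> * v) *s A z + k z v *s e1 + (\<mu> * cnj v) *s B z)"
begin

definition mc_form :: "complex \<Rightarrow> complex \<Rightarrow> complex \<Rightarrow> cvec" where
  "mc_form z v \<mu> = (inverse \<mu> * v) *s A z + k z v *s e1 + (\<mu> * cnj v) *s B z"

text \<open>This is \<open>- \<mu>\<close> times the derivative of \<open>mc_form\<close> in
  \<open>\<mu>\<close>; up to the factor i it is the differential of the associated surface seen in
  the frame \<Phi>.\<close>

definition surface_form :: "complex \<Rightarrow> complex \<Rightarrow> complex \<Rightarrow> cvec" where
  "surface_form z v \<mu> = (inverse \<mu> * v) *s A z - (\<mu> * cnj v) *s B z"

lemma joint_deriv:
  assumes "\<mu> \<noteq> 0"
  shows "((\<lambda>(z, \<mu>). \<Phi> z \<mu>) has_derivative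
    (\<lambda>h. frechet_derivative (\<lambda>(z, \<mu>). \<Phi> z \<mu>) (at (z, \<mu>)) h)) (at (z, \<mu>))"
  using smooth_on_has_derivative[OF smooth] assms by auto

lemma framing_deriv:
  assumes "\<mu> \<noteq> 0"
  shows "((\<lambda>w. \<Phi> w \<mu>) has_derivative (\<lambda>v. \<Phi> z \<mu> ** xi (mc_form z v \<mu>))) (at z)"
proof -
  have d: "((\<lambda>w. \<Phi> w \<mu>) has_derivative (\<lambda>v. pd v (\<lambda>w. \<Phi> w \<mu>) z)) (at z)"
    using slice_has_derivative(1)[OF joint_deriv[OF assms]] differentiable_def
    by (intro pd_has_derivative) auto
  have "pd v (\<lambda>w. \<Phi> w \<mu>) z = \<Phi> z \<mu> ** xi (mc_form z v \<mu>)" for v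
    using arg_cong[OF MC[OF assms, of z v], of "\<lambda>M. \<Phi> z \<mu> ** M"]
    by (simp add: matrix_mul_assoc SO3C_inv[OF SO[OF assms]] SO3C_transpose[OF SO[OF assms]] mc_form_def)
  then show ?thesis using d by simp
qed

text \<open>In the rotating frame the derivative acquires a cross product with the Maurer-Cartan
  vector. The structure equations \<open>frame_m\<close>, \<open>frame_n\<close> and
  \<open>frame_e1\<close> are instances.\<close>

lemma rotated_deriv:
  assumes "\<mu> \<noteq> 0" "(X has_derivative X') (at z)"
  shows "((\<lambda>w. \<Phi> w \<mu> *v X w) has_derivative
    (\<lambda>v. \<Phi> z \<mu> *v (X' v + ccross (mc_form z v \<mu>) (X z)))) (at z)"
  using bounded_bilinear.FDERIV[OF bounded_bilinear_cmat_vec framing_deriv[OF assms(1)] assms(2)]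
  by (simp add: cmat_vec_linear matrix_vector_mul_assoc[symmetric] ccross_xi)

text \<open>Holomorphy identifies the entrywise complex derivative with the real derivative in
  direction 1, which inherits smoothness in z from the joint smoothness of \<Phi>.\<close>

lemma mderiv_eq:
  assumes "\<mu> \<noteq> 0"
  shows "mderiv (\<Phi> z) \<mu> = frechet_derivative (\<lambda>(z, \<mu>). \<Phi> z \<mu>) (at (z, \<mu>)) (0, 1)"
proof -
  let ?G = "frechet_derivative (\<lambda>(z, \<mu>). \<Phi> z \<mu>) (at (z, \<mu>))"
  have d: "((\<lambda>\<nu>. \<Phi> z \<nu>) has_derivative (\<lambda>t. ?G (0, t))) (at \<mu>)"
    using slice_has_derivative(2)[OF joint_deriv[OF assms]] by simp
  have "deriv (\<lambda>\<nu>. \<Phi> z \<nu> $ i $ j) \<mu> = ?G (0, 1) $ i $ j" for i j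
  proof -
    have 1: "((\<lambda>\<nu>. \<Phi> z \<nu> $ i $ j) has_derivative (\<lambda>t. ?G (0, t) $ i $ j)) (at \<mu>)"
      by (intro bounded_linear.has_derivative[OF bounded_linear_vec_nth] d)
    have "((\<lambda>\<nu>. \<Phi> z \<nu> $ i $ j) has_field_derivative deriv (\<lambda>\<nu>. \<Phi> z \<nu> $ i $ j) \<mu>) (at \<mu>)"
      by (rule holomorphic_derivI[OF entries_holomorphic]) (use assms in \<open>auto simp: open_Compl\<close>)
    from fun_cong[OF has_derivative_unique[OF 1 this[unfolded has_field_derivative_def]], of 1]
    show ?thesis by simp
  qed
  then show ?thesis by (simp add: mderiv_def cmat_eq_iff)
qed

lemma smooth_on_framing: "\<mu> \<noteq> 0 \<Longrightarrow> smooth_on UNIV (\<lambda>z. \<Phi> z \<mu>)"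
  using smooth_on_slice[OF open_UNIV _ smooth, of \<mu>] by simp

lemma smooth_on_mderiv: "\<mu> \<noteq> 0 \<Longrightarrow> smooth_on UNIV (\<lambda>z. mderiv (\<Phi> z) \<mu>)"
  using smooth_on_slice[OF open_UNIV _ smooth_on_frechet[OF smooth], of \<mu> "(0, 1)"]
  by (simp add: mderiv_eq)

lemma mc_form_deriv:
  assumes "\<mu> \<noteq> 0"
  shows "((\<lambda>\<mu>. mc_form z v \<mu>) has_derivative (\<lambda>t. (t * (- inverse \<mu>)) *s surface_form z v \<mu>)) (at \<mu>)"
proof -
  have "((\<lambda>\<mu>. mc_form z v \<mu>) has_derivative
     (\<lambda>t. (- (inverse \<mu> * t * inverse \<mu>) * v) *s A z + 0 + (t * cnj v) *s B z)) (at \<mu>)"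
    unfolding mc_form_def
    by (intro has_derivative_add has_derivative_const bounded_linear.has_derivative[OF bounded_bilinear.bounded_linear_left[OF bounded_bilinear_smult]]
        has_derivative_mult_left Deriv.has_derivative_inverse has_derivative_ident assms)
  then show ?thesis
    by (rule has_derivative_eq_rhs) (use assms in \<open>auto simp: fun_eq_iff surface_form_def cvec_eq_iff field_simps\<close>)
qed

text \<open>Mixed derivatives commute, so the left side is the derivative in \<open>\<mu>\<close> of
  \<Phi> times \<open>xi\<close> of \<open>mc_form\<close>; the product rule and
  \<open>mc_form_deriv\<close> give the two terms.\<close>

lemma mderiv_deriv:
  assumes "\<mu> \<noteq> 0"
  shows "((\<lambda>w. mderiv (\<Phi> w) \<mu>) has_derivative (\<lambda>v. mderiv (\<Phi> z) \<mu> ** xi (mc_form z v \<mu>) +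
     \<Phi> z \<mu> ** xi (- inverse \<mu> *s surface_form z v \<mu>))) (at z)"
proof -
  let ?F = "\<lambda>(z, \<mu>). \<Phi> z \<mu>"
  have z: "(z, \<mu>) \<in> UNIV \<times> - {0}" using assms by simp
  have "((\<lambda>w. mderiv (\<Phi> w) \<mu>) has_derivative
      (\<lambda>v. frechet_derivative (\<lambda>x. frechet_derivative ?F (at x) (0, 1)) (at (z, \<mu>)) (v, 0))) (at z)"
    using slice_has_derivative(1)[OF smooth_on_has_derivative[OF smooth_on_frechet[OF smooth] z, of "(0, 1)"]]
    by (simp add: mderiv_eq[OF assms])
  moreover have "frechet_derivative (\<lambda>x. frechet_derivative ?F (at x) (0, 1)) (at (z, \<mu>)) (v, 0) =
      mderiv (\<Phi> z) \<mu> ** xi (mc_form z v \<mu>) + \<Phi> z \<mu> ** xi (- inverse \<mu> *s surface_form z v \<mu>)" for v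
  proof -
    have c: "frechet_derivative (\<lambda>x. frechet_derivative ?F (at x) (0, 1)) (at (z, \<mu>)) (v, 0) =
       frechet_derivative (\<lambda>x. frechet_derivative ?F (at x) (v, 0)) (at (z, \<mu>)) (0, 1)"
      by (rule frechet_derivative_commute[OF UNIV_times_punctured smooth z])
    have d1: "((\<lambda>\<nu>. frechet_derivative ?F (at (z, \<nu>)) (v, 0)) has_derivative
       (\<lambda>t. frechet_derivative (\<lambda>x. frechet_derivative ?F (at x) (v, 0)) (at (z, \<mu>)) (0, t))) (at \<mu>)"
      using slice_has_derivative(2)[OF smooth_on_has_derivative[OF smooth_on_frechet[OF smooth] z, of "(v, 0)"]] .
    have d2: "((\<lambda>\<nu>. frechet_derivative ?F (at (z, \<nu>)) (v, 0)) has_derivative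
       (\<lambda>t. \<Phi> z \<mu> ** xi ((t * (- inverse \<mu>)) *s surface_form z v \<mu>) +
         frechet_derivative ?F (at (z, \<mu>)) (0, t) ** xi (mc_form z v \<mu>))) (at \<mu>)"
    proof (rule has_derivative_transform_within_open)
      show "((\<lambda>\<nu>. \<Phi> z \<nu> ** xi (mc_form z v \<nu>)) has_derivative
       (\<lambda>t. \<Phi> z \<mu> ** xi ((t * (- inverse \<mu>)) *s surface_form z v \<mu>) +
         frechet_derivative ?F (at (z, \<mu>)) (0, t) ** xi (mc_form z v \<mu>))) (at \<mu>)"
        using slice_has_derivative(2)[OF joint_deriv[OF assms, of z]]
        by (intro bounded_bilinear.FDERIV[OF bounded_bilinear_cmat_mult]
            bounded_linear.has_derivative[OF bounded_linear_xi] mc_form_deriv assms) simp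
      fix \<nu> :: complex assume "\<nu> \<in> - {0}"
      then have "\<nu> \<noteq> 0" by simp
      show "\<Phi> z \<nu> ** xi (mc_form z v \<nu>) = frechet_derivative ?F (at (z, \<nu>)) (v, 0)"
        using has_derivative_unique[OF framing_deriv[OF \<open>\<nu> \<noteq> 0\<close>]
            slice_has_derivative(1)[OF joint_deriv[OF \<open>\<nu> \<noteq> 0\<close>, of z], simplified]]
        by (simp add: fun_eq_iff)
    qed (use assms in \<open>auto simp: open_Compl\<close>)
    show ?thesis
      using fun_cong[OF has_derivative_unique[OF d1 d2], of 1]
      unfolding c mderiv_eq[OF assms] by (simp add: add.commute)
  qed
  ultimately show ?thesis by simp
qed

text \<open>Differentiate \<Phi> ** transpose \<Phi> = 1 in the loop parameter. It follows that the
  associated surface takes values in so(3,C).\<close>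

lemma mderiv_skew:
  assumes "\<mu> \<noteq> 0"
  shows "mderiv (\<Phi> z) \<mu> ** transpose (\<Phi> z \<mu>) \<in> so3C"
proof -
  let ?F = "\<lambda>(z, \<mu>). \<Phi> z \<mu>"
  have d: "((\<lambda>\<nu>. \<Phi> z \<nu>) has_derivative (\<lambda>t. frechet_derivative ?F (at (z, \<mu>)) (0, t))) (at \<mu>)"
    using slice_has_derivative(2)[OF joint_deriv[OF assms, of z]] by simp
  have 1: "((\<lambda>\<nu>. \<Phi> z \<nu> ** transpose (\<Phi> z \<nu>)) has_derivative
     (\<lambda>t. \<Phi> z \<mu> ** transpose (frechet_derivative ?F (at (z, \<mu>)) (0, t))
         + frechet_derivative ?F (at (z, \<mu>)) (0, t) ** transpose (\<Phi> z \<mu>))) (at \<mu>)"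
    by (intro bounded_bilinear.FDERIV[OF bounded_bilinear_cmat_mult] d
            bounded_linear.has_derivative[OF bounded_linear_transpose])
  have 2: "((\<lambda>\<nu>. \<Phi> z \<nu> ** transpose (\<Phi> z \<nu>)) has_derivative (\<lambda>t. 0)) (at \<mu>)"
    by (rule has_derivative_transform_within_open[OF has_derivative_const[of "mat 1"], of "- {0}"])
      (use assms SO3C_transpose[OF SO] in \<open>auto simp: open_Compl\<close>)
  have "\<Phi> z \<mu> ** transpose (mderiv (\<Phi> z) \<mu>) + mderiv (\<Phi> z) \<mu> ** transpose (\<Phi> z \<mu>) = 0"
    using fun_cong[OF has_derivative_unique[OF 1 2], of 1] by (simp add: mderiv_eq[OF assms])
  then show ?thesis
    unfolding so3C_def by (simp add: matrix_transpose_mul eq_neg_iff_add_eq_0)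
qed

lemma assoc_surface_eq:
  "\<mu> \<noteq> 0 \<Longrightarrow> assoc_surface \<Phi> \<mu> z = (- \<i> * \<mu>) *\<^sub>m (mderiv (\<Phi> z) \<mu> ** transpose (\<Phi> z \<mu>))"
  by (simp add: assoc_surface_def SO3C_inv[OF SO])

lemma assoc_surface_so3C: "\<mu> \<noteq> 0 \<Longrightarrow> assoc_surface \<Phi> \<mu> z \<in> so3C"
  by (simp add: assoc_surface_eq mscale_so3C mderiv_skew)

lemma smooth_on_assoc_surface: "\<mu> \<noteq> 0 \<Longrightarrow> smooth_on UNIV (assoc_surface \<Phi> \<mu>)"
  unfolding smooth_on_cong[OF open_UNIV assoc_surface_eq]
  by (intro smooth_on_bounded_linear[OF open_UNIV bounded_linear_mscale]
      smooth_on_bilinear[OF open_UNIV bounded_bilinear_cmat_mult]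
      smooth_on_bounded_linear[OF open_UNIV bounded_linear_transpose] smooth_on_framing smooth_on_mderiv)

text \<open>The terms containing \<open>mderiv\<close> cancel because \<open>xi\<close> is skew.
  Only the parameter derivative of the Maurer-Cartan form survives, conjugated by \<Phi>, and the
  scalars multiply to (-i \<mu>) (-1/\<mu>) = i.\<close>

lemma assoc_surface_deriv:
  assumes "\<mu> \<noteq> 0"
  shows "(assoc_surface \<Phi> \<mu> has_derivative (\<lambda>v. xi (\<Phi> z \<mu> *v (\<i> *s surface_form z v \<mu>)))) (at z)"
proof -
  note M = SO[OF assms]
  have "(assoc_surface \<Phi> \<mu> has_derivative (\<lambda>v. (- \<i> * \<mu>) *\<^sub>m
     (mderiv (\<Phi> z) \<mu> ** transpose (\<Phi> z \<mu> ** xi (mc_form z v \<mu>)) +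
      (mderiv (\<Phi> z) \<mu> ** xi (mc_form z v \<mu>) + \<Phi> z \<mu> ** xi (- inverse \<mu> *s surface_form z v \<mu>)) ** transpose (\<Phi> z \<mu>)))) (at z)"
    unfolding assoc_surface_eq[OF assms, abs_def]
    by (intro bounded_linear.has_derivative[OF bounded_linear_mscale]
        bounded_bilinear.FDERIV[OF bounded_bilinear_cmat_mult] mderiv_deriv framing_deriv
            bounded_linear.has_derivative[OF bounded_linear_transpose] assms)
  moreover have "(- \<i> * \<mu>) *\<^sub>m
     (mderiv (\<Phi> z) \<mu> ** transpose (\<Phi> z \<mu> ** xi (mc_form z v \<mu>)) +
      (mderiv (\<Phi> z) \<mu> ** xi (mc_form z v \<mu>) + \<Phi> z \<mu> ** xi (- inverse \<mu> *s surface_form z v \<mu>)) ** transpose (\<Phi> z \<mu>))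
     = xi (\<Phi> z \<mu> *v (\<i> *s surface_form z v \<mu>))" for v
  proof -
    have "mderiv (\<Phi> z) \<mu> ** transpose (\<Phi> z \<mu> ** xi (mc_form z v \<mu>)) =
        - (mderiv (\<Phi> z) \<mu> ** xi (mc_form z v \<mu>) ** transpose (\<Phi> z \<mu>))"
      by (simp add: matrix_transpose_mul transpose_xi cmat_eq_iff cmat_mult_nth algebra_simps)
    moreover have "\<Phi> z \<mu> ** xi (- inverse \<mu> *s surface_form z v \<mu>) ** transpose (\<Phi> z \<mu>) =
        xi (\<Phi> z \<mu> *v (- inverse \<mu> *s surface_form z v \<mu>))"
      using SO3C_conj_xi[OF M] by (simp add: SO3C_inv[OF M])
    ultimately have "(mderiv (\<Phi> z) \<mu> ** transpose (\<Phi> z \<mu> ** xi (mc_form z v \<mu>)) +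
      (mderiv (\<Phi> z) \<mu> ** xi (mc_form z v \<mu>) + \<Phi> z \<mu> ** xi (- inverse \<mu> *s surface_form z v \<mu>)) ** transpose (\<Phi> z \<mu>))
     = xi (\<Phi> z \<mu> *v (- inverse \<mu> *s surface_form z v \<mu>))"
      by (simp add: bounded_bilinear.add_left[OF bounded_bilinear_cmat_mult])
    then show ?thesis
      using assms by (simp only: xi_smult[symmetric] cmat_vec_linear) simp
  qed
  ultimately show ?thesis by simp
qed

lemma assoc_normal_eq: "\<mu> \<noteq> 0 \<Longrightarrow> assoc_normal \<Phi> \<mu> z = xi (\<Phi> z \<mu> *v e1)"
  by (simp add: assoc_normal_def phi0_def SO3C_conj_xi SO)

end

section \<open>Isotropic lines and simple factors\<close>

definition line :: "cvec \<Rightarrow> cvec set" where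
  "line u = range (\<lambda>t. t *s u)"

lemma line_mem: "t *s u \<in> line u" "u \<in> line u"
  unfolding line_def by (auto intro: range_eqI[of _ _ 1])

lemma line_smult:
  assumes "c \<noteq> 0"
  shows "line (c *s u) = line u"
proof (intro equalityI subsetI)
  fix x assume "x \<in> line (c *s u)"
  then show "x \<in> line u" by (auto simp: line_def)
next
  fix x assume "x \<in> line u"
  then obtain t where "x = t *s u" by (auto simp: line_def)
  then have "x = (t / c) *s (c *s u)" using assms by simp
  then show "x \<in> line (c *s u)" unfolding line_def by (rule range_eqI)
qed

lemma line_image:
  fixes M :: cmat
  shows "(\<lambda>v. M *v v) ` line u = line (M *v u)"
  by (simp add: line_def image_image cmat_vec_linear)

lemma isotropic_line_iff: "isotropic_line L \<longleftrightarrow> (\<exists>u. u \<noteq> 0 \<and> cform u u = 0 \<and> L = line u)"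
proof
  assume L: "isotropic_line L"
  then obtain S where S: "S \<subseteq> L" "vec.independent S" "L \<subseteq> vec.span S" "card S = 1"
    using vec.basis_exists[of L] unfolding isotropic_line_def by metis
  then obtain u where u: "S = {u}" using card_1_singletonE by blast
  have "vec.span S \<subseteq> L"
    using L S(1) vec.span_minimal unfolding isotropic_line_def by blast
  then have "L = line u"
    using S(3) by (auto simp: u vec.span_singleton line_def)
  moreover have "u \<noteq> 0"
    using S(2) vec.dependent_zero[of S] by (auto simp: u)
  moreover have "cform u u = 0"
    using L S(1) by (simp add: isotropic_line_def u)
  ultimately show "\<exists>u. u \<noteq> 0 \<and> cform u u = 0 \<and> L = line u" by blast
next
  assume "\<exists>u. u \<noteq> 0 \<and> cform u u = 0 \<and> L = line u"
  then obtain u where u: "u \<noteq> 0" "cform u u = 0" and L: "L = vec.span {u}"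
    by (auto simp: line_def vec.span_singleton)
  have "vec.dim L = 1"
    unfolding L using vec.dim_eq_card_independent[of "{u}"] u(1) by simp
  moreover have "cform x y = 0" if "x \<in> L" "y \<in> L" for x y
    using that u(2) by (auto simp: L vec.span_singleton cform_linear)
  ultimately show "isotropic_line L"
    unfolding isotropic_line_def L using vec.subspace_span by blast
qed

lemma Qmat_vec: "(Qmat *v u) $ 1 = u$1" "(Qmat *v u) $ 2 = - u$2" "(Qmat *v u) $ 3 = - u$3"
  by (simp_all add: cmat_vec_nth Qmat_def)

lemma Qim_line: "Qim (line u) = line (Qmat *v u)"
  by (simp add: Qim_def line_image)

text \<open>A fixed line is spanned by an eigenvector of Q. The eigenvalue 1 would make it a
  multiple of e1, which is not isotropic; the eigenvalue -1 means first coordinate 0.\<close>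

lemma Qim_line_eq_iff:
  assumes "u \<noteq> 0" "cform u u = 0"
  shows "Qim (line u) = line u \<longleftrightarrow> u $ 1 = 0"
proof
  assume "Qim (line u) = line u"
  then obtain t where t: "Qmat *v u = t *s u"
    using line_mem(2) unfolding Qim_line by (metis line_def rangeE)
  show "u $ 1 = 0"
  proof (rule ccontr)
    assume "u $ 1 \<noteq> 0"
    then have "t = 1" using t Qmat_vec[of u] by auto
    then have "u $ 2 = 0" "u $ 3 = 0" using t Qmat_vec[of u] by auto
    then show False using assms(2) \<open>u $ 1 \<noteq> 0\<close> by (simp add: cform_3)
  qed
next
  assume "u $ 1 = 0"
  then have "Qmat *v u = (-1) *s u" by (simp add: cvec_eq_iff Qmat_vec)
  then show "Qim (line u) = line u" using line_smult[of "-1"] by (simp add: Qim_line)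
qed

text \<open>An isotropic line \<open>L\<close> with \<open>Q L \<noteq> L\<close> is spanned by \<open>e1 + m\<close> for a unique \<open>m\<close> with
  \<open>(m, e1) = 0\<close> and \<open>(m, m) = -1\<close>; then \<open>L0\<close> is spanned by \<open>e1 \<times> m\<close>, and
  \<open>e1 + m\<close>, \<open>e1 \<times> m\<close>, \<open>e1 - m\<close> are eigenvectors of \<open>xi (e1 \<times> m)\<close> with eigenvalues 1, 0, -1.\<close>

locale isotropic_frame =
  fixes m :: cvec
  assumes m_1: "m $ 1 = 0" and m_m: "cform m m = -1"
begin

definition n :: cvec where "n = ccross e1 m"

lemma n_nth: "n $ 1 = 0" "n $ 2 = - m $ 3" "n $ 3 = m $ 2"
  by (simp_all add: n_def m_1 e1_nth)

lemma m_eq: "m$2 * m$2 + m$3 * m$3 = -1"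
  using m_m m_1 by (simp add: cform_3)

text \<open>Orthogonal expansion in e1, m, n; the minus signs come from (m, m) = (n, n) =
  -1.\<close>

lemma frame_expand: "v = v$1 *s e1 - cform v m *s m - cform v n *s n"
proof -
  have "v$2 + m$2 * (m$2 * v$2) = - (m$3 * (m$3 * v$2))"
    "v$3 + m$3 * (m$3 * v$3) = - (m$2 * (m$2 * v$3))"
    using m_eq by algebra+
  then show ?thesis
    by (simp add: cvec_eq_iff n_nth m_1 cform_3 e1_nth algebra_simps)
qed

text \<open>The three eigenvectors of \<open>xi n\<close> form a basis, so identities between
  functions of \<open>xi n\<close> can be checked on them.\<close>

lemma matrix_eqI:
  fixes M M' :: cmat
  assumes "M *v (e1 + m) = M' *v (e1 + m)" "M *v n = M' *v n" "M *v (e1 - m) = M' *v (e1 - m)"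
  shows "M = M'"
proof -
  have "M *v v = M' *v v" for v
  proof -
    have "x *s e1 - p *s m - q *s n = ((x - p) / 2) *s (e1 + m) + (- q) *s n + ((x + p) / 2) *s (e1 - m)" for x p q
      by (simp add: cvec_eq_iff e1_nth n_nth m_1 field_simps)
    from trans[OF frame_expand this] obtain x y z where v: "v = x *s (e1 + m) + y *s n + z *s (e1 - m)"
      by blast
    show ?thesis unfolding v bounded_bilinear.add_right[OF bounded_bilinear_cmat_vec, of _ "x *s (e1 + m) + y *s n" "z *s (e1 - m)"]
        bounded_bilinear.add_right[OF bounded_bilinear_cmat_vec, of _ "x *s (e1 + m)" "y *s n"] cmat_vec_linear(4)
      by (simp only: assms)
  qed
  then show ?thesis by (simp add: matrix_eq)
qed

lemma xi_n:
  "xi n *v (e1 + m) = e1 + m" "xi n *v n = 0" "xi n *v (e1 - m) = - (e1 - m)"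
proof -
  have "m$2 * m$2 = -1 - m$3 * m$3" using m_eq by algebra
  then show "xi n *v (e1 + m) = e1 + m" "xi n *v n = 0" "xi n *v (e1 - m) = - (e1 - m)"
    unfolding ccross_xi by (simp_all add: cvec_eq_iff n_nth m_1 e1_nth)
qed

text \<open>The spectral projections of \<open>xi n\<close>: the Lagrange polynomials (x^2 + x)/2, 1
  - x^2, (x^2 - x)/2 for the eigenvalues 1, 0, -1, evaluated at \<open>xi n\<close>.\<close>

definition Pplus :: cmat where "Pplus = (1/2) *\<^sub>m (xi n ** xi n + xi n)"
definition Pzero :: cmat where "Pzero = mat 1 - xi n ** xi n"
definition Pminus :: cmat where "Pminus = (1/2) *\<^sub>m (xi n ** xi n - xi n)"

lemma mscale_vec: "(c *\<^sub>m M) *v v = c *s (M *v v)"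
  by (simp add: cvec_eq_iff cmat_vec_nth algebra_simps)

lemma mat_vec_add: "(M + M') *v v = M *v v + M' *v v" "(M - M') *v v = M *v v - M' *v v" for M M' :: cmat
  by (simp_all add: cvec_eq_iff cmat_vec_nth algebra_simps)

lemma half_vec: "(1/2) *s (v + v) = v" for v :: cvec
  by (simp add: cvec_eq_iff)

lemma P_apply:
  "Pplus *v (e1 + m) = e1 + m" "Pplus *v n = 0" "Pplus *v (e1 - m) = 0"
  "Pzero *v (e1 + m) = 0" "Pzero *v n = n" "Pzero *v (e1 - m) = 0"
  "Pminus *v (e1 + m) = 0" "Pminus *v n = 0" "Pminus *v (e1 - m) = e1 - m"
proof -
  have X: "(xi n ** xi n) *v v = xi n *v (xi n *v v)" for v
    by (simp add: matrix_vector_mul_assoc)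
  have Y: "xi n *v (- (e1 - m)) = e1 - m"
    by (simp only: cmat_vec_linear(3) xi_n minus_minus)
  note S = Pplus_def Pzero_def Pminus_def mscale_vec mat_vec_add X xi_n Y
  show "Pplus *v (e1 + m) = e1 + m" "Pplus *v n = 0" "Pplus *v (e1 - m) = 0"
  "Pzero *v (e1 + m) = 0" "Pzero *v n = n" "Pzero *v (e1 - m) = 0"
  "Pminus *v (e1 + m) = 0" "Pminus *v n = 0" "Pminus *v (e1 - m) = e1 - m"
    by (simp_all only: S half_vec) (simp_all add: cvec_eq_iff)
qed

lemma L0_line: "L0 (line (e1 + m)) = line n"
proof (intro set_eqI iffI)
  fix v assume "v \<in> L0 (line (e1 + m))"
  then have *: "cform (a + b) v = 0" if "a \<in> line (e1 + m)" "b \<in> line (Qmat *v (e1 + m))" for a b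
    using that by (simp add: L0_def Qim_line)
  \<comment> \<open>The test vectors are e1 + m and (e1 + m) + (e1 - m) = 2 e1; together they say
    that v is orthogonal to e1 and m.\<close>
  have "cform (1 *s (e1 + m) + 0 *s (Qmat *v (e1 + m))) v = 0"
    "cform (1 *s (e1 + m) + 1 *s (Qmat *v (e1 + m))) v = 0"
    by (intro * line_mem)+
  then have "v$1 = 0" "cform v m = 0"
    by (simp_all add: cform_3 Qmat_vec m_1 e1_nth algebra_simps)
  then have "v = (- cform v n) *s n"
    by (intro trans[OF frame_expand[of v]]) (simp add: cvec_eq_iff)
  then show "v \<in> line n" using line_mem(1) by metis
next
  fix v assume "v \<in> line n"
  then obtain t where v: "v = t *s n" unfolding line_def by blast
  have "cform (x *s (e1 + m) + y *s (Qmat *v (e1 + m))) v = 0" for x y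
    by (simp add: v cform_3 Qmat_vec m_1 n_nth e1_nth algebra_simps)
  then show "v \<in> L0 (line (e1 + m))"
    unfolding L0_def Qim_line unfolding line_def by blast
qed

lemma Q_m: "Qmat *v (e1 + m) = e1 - m"
  by (simp add: cvec_eq_iff Qmat_vec m_1 e1_nth)

text \<open>\<open>proj3\<close> is a definite description. Its uniqueness is taken as the last
  hypothesis so that \<open>matrix_eqI\<close> can serve for each order of the three
  summands.\<close>

lemma proj3_eqI:
  assumes "P *v a = a" "P *v b = 0" "P *v c = 0"
    and "\<And>M. M *v a = P *v a \<Longrightarrow> M *v b = P *v b \<Longrightarrow> M *v c = P *v c \<Longrightarrow> M = P"
  shows "proj3 (line a) (line b) (line c) = P"
  unfolding proj3_def
proof (rule the_equality)
  show "(\<forall>v\<in>line a. P *v v = v) \<and> (\<forall>v\<in>line b. P *v v = 0) \<and> (\<forall>v\<in>line c. P *v v = 0)"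
    using assms(1-3) unfolding line_def by (simp add: cmat_vec_linear(4))
  fix M assume "(\<forall>v\<in>line a. M *v v = v) \<and> (\<forall>v\<in>line b. M *v v = 0) \<and> (\<forall>v\<in>line c. M *v v = 0)"
  then show "M = P" by (intro assms(4)) (simp_all add: assms(1-3) line_mem(2))
qed

text \<open>For nonzero \<open>r\<close> this is the exponential of (ln r) \<open>xi n\<close>,
  written without a logarithm; it is multiplicative in \<open>r\<close>.\<close>

definition hmat :: "complex \<Rightarrow> cmat" where
  "hmat r = r *\<^sub>m Pplus + Pzero + inverse r *\<^sub>m Pminus"

lemma simple_factor_eq:
  "simple_factor \<alpha> (line (e1 + m)) \<mu> = hmat ((\<alpha> - \<mu>) / (\<alpha> + \<mu>))"
proof -
  have "proj3 (line (e1 + m)) (line n) (line (e1 - m)) = Pplus"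
    by (rule proj3_eqI[OF P_apply(1,2,3)]) (rule matrix_eqI)
  moreover have "proj3 (line n) (line (e1 + m)) (line (e1 - m)) = Pzero"
    by (rule proj3_eqI[OF P_apply(5,4,6)]) (rule matrix_eqI)
  moreover have "proj3 (line (e1 - m)) (line (e1 + m)) (line n) = Pminus"
    by (rule proj3_eqI[OF P_apply(9,7,8)]) (rule matrix_eqI)
  ultimately show ?thesis
    by (simp add: simple_factor_def hmat_def L0_line Qim_line Q_m)
qed

lemma hmat_apply:
  "hmat r *v (e1 + m) = r *s (e1 + m)" "hmat r *v n = n" "hmat r *v (e1 - m) = inverse r *s (e1 - m)"
  by (simp_all only: hmat_def mat_vec_add mscale_vec P_apply) (simp_all add: cvec_eq_iff)

lemma hmat_mult: "hmat r ** hmat s = hmat (r * s)"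
  by (rule matrix_eqI)
    (simp_all only: matrix_vector_mul_assoc[symmetric] hmat_apply cmat_vec_linear(4) vec.scale_scale, simp_all add: mult.commute)

lemma hmat_1: "hmat 1 = mat 1"
  by (rule matrix_eqI) (simp_all only: hmat_apply matrix_vector_mul_lid, simp_all)

lemma hmat_inverse:
  assumes "r \<noteq> 0"
  shows "hmat r ** hmat (inverse r) = mat 1" "hmat (inverse r) ** hmat r = mat 1"
  using assms by (simp_all add: hmat_mult hmat_1)

text \<open>\<open>xi n\<close> is skew and its square symmetric, so transposition exchanges
  \<open>Pplus\<close> and \<open>Pminus\<close>, that is r and 1/r.\<close>

lemma transpose_hmat: "transpose (hmat r) = hmat (inverse r)"
proof -
  have "transpose (xi n ** xi n) = xi n ** xi n"
    by (simp add: matrix_transpose_mul transpose_xi cmat_eq_iff cmat_mult_nth)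
  then have t: "(xi n ** xi n) $ j $ i = (xi n ** xi n) $ i $ j" for i j
    by (metis (no_types) transpose_def vec_lambda_beta)
  have x: "xi n $ j $ i = - xi n $ i $ j" for i j
  proof -
    have "transpose (xi n) $ i $ j = (- xi n) $ i $ j" by (simp only: transpose_xi)
    then show ?thesis by (simp add: transpose_def)
  qed
  have "transpose (hmat r) $ i $ j = hmat (inverse r) $ i $ j" for i j
  proof -
    have "transpose (hmat r) $ i $ j = hmat r $ j $ i" by (simp add: transpose_def)
    also have "\<dots> = r * (1/2 * ((xi n ** xi n) $ i $ j + - xi n $ i $ j)) +
        ((mat 1 :: cmat) $ j $ i - (xi n ** xi n) $ i $ j)
        + inverse r * (1/2 * ((xi n ** xi n) $ i $ j - - xi n $ i $ j))"
      unfolding hmat_def Pplus_def Pzero_def Pminus_def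
      by (simp only: vector_add_component vector_minus_component mscale_nth t[of j i] x[of j i])
    also have "\<dots> = hmat (inverse r) $ i $ j"
      unfolding hmat_def Pplus_def Pzero_def Pminus_def
      by (simp add: mat_def algebra_simps)
    finally show ?thesis .
  qed
  then show ?thesis by (simp add: cmat_eq_iff)
qed

text \<open>The determinant is 1 because \<open>hmat r\<close> is the square of an orthogonal matrix.\<close>

lemma hmat_SO3C:
  assumes "r \<noteq> 0"
  shows "hmat r \<in> SO3C"
proof -
  have "hmat r = hmat (csqrt r) ** hmat (csqrt r)"
    using power2_csqrt[of r] by (simp add: hmat_mult power2_eq_square)
  moreover have "det (hmat (csqrt r)) * det (transpose (hmat (csqrt r))) = det (mat 1 :: cmat)"
    using assms by (simp only: det_mul[symmetric] transpose_hmat hmat_inverse(1) csqrt_eq_0 not_False_eq_True)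
  ultimately have "det (hmat r) = 1"
    by (simp add: det_mul det_transpose)
  then show ?thesis
    using hmat_inverse[OF assms] by (simp add: SO3C_def orthogonal_matrix_def transpose_hmat)
qed

lemma hmat_e1: "hmat r *v e1 = ((r + inverse r) / 2) *s e1 + ((r - inverse r) / 2) *s m"
proof -
  have "e1 = (1/2) *s ((e1 + m) + (e1 - m))" by (simp add: cvec_eq_iff)
  then have "hmat r *v e1 = (1/2) *s (hmat r *v (e1 + m) + hmat r *v (e1 - m))"
    using cmat_vec_linear(4)[of "hmat r" "1/2" "(e1 + m) + (e1 - m)"]
    by (simp only: bounded_bilinear.add_right[OF bounded_bilinear_cmat_vec, of "hmat r" "e1 + m" "e1 - m"])
  then show ?thesis by (simp only: hmat_apply) (simp add: cvec_eq_iff field_simps)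
qed

text \<open>The factor is the exponential of (ln r) \<open>xi n\<close> with constant
  \<open>n\<close>, so its logarithmic derivative is the derivative of ln ((\<alpha> - \<mu>) /
  (\<alpha> + \<mu>)) times \<open>xi n\<close>.\<close>

lemma simple_factor_log_derivative:
  assumes "\<alpha> \<noteq> 0" "\<alpha> \<noteq> \<mu>" "\<alpha> \<noteq> - \<mu>"
  shows "matrix_inv (simple_factor \<alpha> (line (e1 + m)) \<mu>) ** mderiv (simple_factor \<alpha> (line (e1 + m))) \<mu>
    = (- 2 * \<alpha> / (\<alpha>\<^sup>2 - \<mu>\<^sup>2)) *\<^sub>m xi n"
proof -
  define r where "r = (\<alpha> - \<mu>) / (\<alpha> + \<mu>)"
  have nz: "\<alpha> - \<mu> \<noteq> 0" "\<alpha> + \<mu> \<noteq> 0" using assms by (auto simp: eq_neg_iff_add_eq_0)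
  then have r: "r \<noteq> 0" by (simp add: r_def)
  have inv: "matrix_inv (simple_factor \<alpha> (line (e1 + m)) \<mu>) = hmat (inverse r)"
    unfolding simple_factor_eq r_def[symmetric] by (rule matrix_inv_eqI hmat_inverse r)+
  \<comment> \<open>The derivatives of r and of 1/r as coefficients of \<open>Pplus\<close> and
    \<open>Pminus\<close>.\<close>
  define D where "D = (- 2 * \<alpha> / (\<alpha> + \<mu>)\<^sup>2) *\<^sub>m Pplus + (2 * \<alpha> / (\<alpha> - \<mu>)\<^sup>2) *\<^sub>m Pminus"
  have "((\<lambda>\<nu>. simple_factor \<alpha> (line (e1 + m)) \<nu> $ i $ j) has_field_derivative D $ i $ j) (at \<mu>)" for i j
    unfolding simple_factor_eq hmat_def D_def vector_add_component mscale_nth inverse_divide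
    by (rule derivative_eq_intros refl nz)+ (use nz in \<open>simp add: field_simps power2_eq_square\<close>)
  then have "mderiv (simple_factor \<alpha> (line (e1 + m))) \<mu> = D"
    by (simp add: mderiv_def cmat_eq_iff DERIV_imp_deriv)
  moreover have "hmat (inverse r) ** D = (- 2 * \<alpha> / (\<alpha>\<^sup>2 - \<mu>\<^sup>2)) *\<^sub>m xi n"
  proof (rule matrix_eqI)
    have sq: "\<alpha>\<^sup>2 - \<mu>\<^sup>2 = (\<alpha> - \<mu>) * (\<alpha> + \<mu>)" by (simp add: power2_eq_square algebra_simps)
    have c: "- 2 * \<alpha> / (\<alpha> + \<mu>)\<^sup>2 * inverse r = - 2 * \<alpha> / (\<alpha>\<^sup>2 - \<mu>\<^sup>2)"
       "2 * \<alpha> / (\<alpha> - \<mu>)\<^sup>2 * r = 2 * \<alpha> / (\<alpha>\<^sup>2 - \<mu>\<^sup>2)"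
      unfolding sq unfolding r_def power2_eq_square using nz by simp_all
    have D: "D *v (e1 + m) = (- 2 * \<alpha> / (\<alpha> + \<mu>)\<^sup>2) *s (e1 + m)" "D *v n = 0"
      "D *v (e1 - m) = (2 * \<alpha> / (\<alpha> - \<mu>)\<^sup>2) *s (e1 - m)"
      unfolding D_def mat_vec_add mscale_vec P_apply by simp_all
    show "hmat (inverse r) ** D *v (e1 + m) = (- 2 * \<alpha> / (\<alpha>\<^sup>2 - \<mu>\<^sup>2)) *\<^sub>m xi n *v (e1 + m)"
      "hmat (inverse r) ** D *v n = (- 2 * \<alpha> / (\<alpha>\<^sup>2 - \<mu>\<^sup>2)) *\<^sub>m xi n *v n"
      by (simp_all only: matrix_vector_mul_assoc[symmetric] D mscale_vec cmat_vec_linear(4) hmat_apply xi_n vec.scale_scale c)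
        simp
    have "hmat (inverse r) ** D *v (e1 - m) = (2 * \<alpha> / (\<alpha>\<^sup>2 - \<mu>\<^sup>2)) *s (e1 - m)"
      by (simp only: matrix_vector_mul_assoc[symmetric] D cmat_vec_linear(4) hmat_apply inverse_inverse_eq vec.scale_scale c)
    then show "hmat (inverse r) ** D *v (e1 - m) = (- 2 * \<alpha> / (\<alpha>\<^sup>2 - \<mu>\<^sup>2)) *\<^sub>m xi n *v (e1 - m)"
      by (simp only: mscale_vec xi_n) (simp add: cvec_eq_iff)
  qed
  ultimately show ?thesis by (simp add: inv)
qed

end

text \<open>The displacement comes from the logarithmic derivative, the normal from applying
  \<open>hmat (inverse r)\<close> to e1. Its coefficients (1/r + r)/2 and (1/r - r)/2 play the roles
  of cosh and sinh, and the second one reappears in the displacement.\<close>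

lemma (in framing) dressed_eq:
  assumes "lam \<noteq> 0" "\<alpha> \<noteq> 0" "\<alpha> \<noteq> lam" "\<alpha> \<noteq> - lam"
    and L: "Ltilde \<Phi> \<alpha> L z = line (e1 + m)" and m: "m $ 1 = 0" "cform m m = -1"
  shows "dressed_surface \<Phi> lam \<alpha> L z =
      assoc_surface \<Phi> lam z + xi ((- \<i> * (2 * \<alpha> * lam / (\<alpha>\<^sup>2 - lam\<^sup>2))) *s (\<Phi> z lam *v ccross e1 m))"
    and "dressed_normal \<Phi> lam \<alpha> L z =
      xi (((\<alpha>\<^sup>2 + lam\<^sup>2) / (\<alpha>\<^sup>2 - lam\<^sup>2)) *s (\<Phi> z lam *v e1) + (2 * \<alpha> * lam / (\<alpha>\<^sup>2 - lam\<^sup>2)) *s (\<Phi> z lam *v m))"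
proof -
  interpret isotropic_frame m using m by unfold_locales
  note M = SO[OF assms(1), of z]
  let ?h = "simple_factor \<alpha> (line (e1 + m))"
  have "\<Phi> z lam ** matrix_inv (?h lam) ** mderiv ?h lam ** matrix_inv (\<Phi> z lam) =
     xi (\<Phi> z lam *v ((- 2 * \<alpha> / (\<alpha>\<^sup>2 - lam\<^sup>2)) *s n))"
    unfolding SO3C_conj_xi[OF M, symmetric] xi_smult simple_factor_log_derivative[OF assms(2-4), symmetric]
    by (simp add: matrix_mul_assoc)
  then show "dressed_surface \<Phi> lam \<alpha> L z =
      assoc_surface \<Phi> lam z + xi ((- \<i> * (2 * \<alpha> * lam / (\<alpha>\<^sup>2 - lam\<^sup>2))) *s (\<Phi> z lam *v ccross e1 m))"
    unfolding dressed_surface_def Let_def L by (simp add: cmat_vec_linear xi_smult[symmetric] n_def[symmetric] mult_ac)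
  define r where "r = (\<alpha> - lam) / (\<alpha> + lam)"
  have nz: "\<alpha> - lam \<noteq> 0" "\<alpha> + lam \<noteq> 0" using assms by (auto simp: eq_neg_iff_add_eq_0)
  have r: "r \<noteq> 0" using nz by (simp add: r_def)
  have h: "?h lam = hmat r" by (simp add: simple_factor_eq r_def)
  have i: "matrix_inv (hmat r) = hmat (inverse r)" by (rule matrix_inv_eqI hmat_inverse r)+
  have i': "matrix_inv (hmat (inverse r)) = hmat r" by (rule matrix_inv_eqI hmat_inverse r)+
  have "\<Phi> z lam ** matrix_inv (?h lam) ** phi0 ** ?h lam ** matrix_inv (\<Phi> z lam) =
     \<Phi> z lam ** (hmat (inverse r) ** xi e1 ** matrix_inv (hmat (inverse r))) ** matrix_inv (\<Phi> z lam)"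
    unfolding h i i' phi0_def by (simp add: matrix_mul_assoc)
  also have "\<dots> = xi (\<Phi> z lam *v (hmat (inverse r) *v e1))"
    using r by (simp add: SO3C_conj_xi hmat_SO3C M)
  also have "hmat (inverse r) *v e1 = ((\<alpha>\<^sup>2 + lam\<^sup>2) / (\<alpha>\<^sup>2 - lam\<^sup>2)) *s e1 + (2 * \<alpha> * lam / (\<alpha>\<^sup>2 - lam\<^sup>2)) *s m"
  proof -
    have sq: "\<alpha>\<^sup>2 - lam\<^sup>2 = (\<alpha> - lam) * (\<alpha> + lam)" by (simp add: power2_eq_square algebra_simps)
    have "(inverse r + r) / 2 = (\<alpha>\<^sup>2 + lam\<^sup>2) / (\<alpha>\<^sup>2 - lam\<^sup>2)" "(inverse r - r) / 2 = 2 * \<alpha> * lam / (\<alpha>\<^sup>2 - lam\<^sup>2)"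
    proof -
      have half: "x * 2 / d / 2 = x / d" for x d :: complex by simp
      have i: "inverse r = (\<alpha> + lam) * (\<alpha> + lam) / (\<alpha>\<^sup>2 - lam\<^sup>2)" and
        ii: "r = (\<alpha> - lam) * (\<alpha> - lam) / (\<alpha>\<^sup>2 - lam\<^sup>2)"
        using nz unfolding sq by (simp_all add: r_def)
      have "(\<alpha> + lam) * (\<alpha> + lam) + (\<alpha> - lam) * (\<alpha> - lam) = (\<alpha>\<^sup>2 + lam\<^sup>2) * 2"
        "(\<alpha> + lam) * (\<alpha> + lam) - (\<alpha> - lam) * (\<alpha> - lam) = (2 * \<alpha> * lam) * 2"
        by algebra+
      then have "inverse r + r = (\<alpha>\<^sup>2 + lam\<^sup>2) * 2 / (\<alpha>\<^sup>2 - lam\<^sup>2)"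
        "inverse r - r = (2 * \<alpha> * lam) * 2 / (\<alpha>\<^sup>2 - lam\<^sup>2)"
        unfolding i by (subst ii, simp only: add_divide_distrib[symmetric] diff_divide_distrib[symmetric])+
      then show "(inverse r + r) / 2 = (\<alpha>\<^sup>2 + lam\<^sup>2) / (\<alpha>\<^sup>2 - lam\<^sup>2)"
        "(inverse r - r) / 2 = 2 * \<alpha> * lam / (\<alpha>\<^sup>2 - lam\<^sup>2)"
        by (simp_all only: half)
    qed
    then show ?thesis by (simp only: hmat_e1 inverse_inverse_eq)
  qed
  finally show "dressed_normal \<Phi> lam \<alpha> L z =
      xi (((\<alpha>\<^sup>2 + lam\<^sup>2) / (\<alpha>\<^sup>2 - lam\<^sup>2)) *s (\<Phi> z lam *v e1) + (2 * \<alpha> * lam / (\<alpha>\<^sup>2 - lam\<^sup>2)) *s (\<Phi> z lam *v m))"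
    unfolding dressed_normal_def Let_def L by (simp add: cmat_vec_linear)
qed

section \<open>Moving frames\<close>

text \<open>Coordinates in the basis e1, m, n, in which the bilinear form is diag(1, -1,
  -1).\<close>

definition frame_comb :: "cvec \<Rightarrow> complex \<Rightarrow> complex \<Rightarrow> complex \<Rightarrow> cvec" where
  "frame_comb m x y w = x *s e1 + y *s m + w *s ccross e1 m"

lemma frame_comb_nth:
  assumes "m $ 1 = 0"
  shows "frame_comb m x y w $ 1 = x" "frame_comb m x y w $ 2 = y * m $ 2 - w * m $ 3"
    "frame_comb m x y w $ 3 = y * m $ 3 + w * m $ 2"
  using assms by (simp_all add: frame_comb_def e1_nth)

lemma cform_frame_comb:
  assumes "m $ 1 = 0" "cform m m = -1"
  shows "cform (frame_comb m x y w) (frame_comb m x' y' w') = x * x' - y * y' - w * w'"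
proof -
  have m: "m$2 * m$2 + m$3 * m$3 = -1" using assms by (simp add: cform_3)
  show ?thesis unfolding cform_3 frame_comb_nth[OF assms(1)] using m by algebra
qed

lemma has_derivative_cform_const:
  assumes "open U" "z \<in> U" "\<And>w. w \<in> U \<Longrightarrow> cform (X w) (X w) = c" "(X has_derivative X') (at z)"
  shows "cform (X' v) (X z) = 0"
proof -
  have 1: "((\<lambda>w. cform (X w) (X w)) has_derivative (\<lambda>v. cform (X z) (X' v) + cform (X' v) (X z))) (at z)"
    by (rule bounded_bilinear.FDERIV[OF bounded_bilinear_cform assms(4,4)])
  have 2: "((\<lambda>w. cform (X w) (X w)) has_derivative (\<lambda>v. 0)) (at z)"
    by (rule has_derivative_transform_within_open[OF has_derivative_const assms(1,2)]) (simp add: assms(3))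
  have "cform (X z) (X' v) + cform (X' v) (X z) = 0"
    using fun_cong[OF has_derivative_unique[OF 1 2]] .
  then show ?thesis by (simp add: cform_commute[of "X z"])
qed

lemma has_derivative_nth_const:
  fixes X :: "complex \<Rightarrow> cvec"
  assumes "open U" "z \<in> U" "\<And>w. w \<in> U \<Longrightarrow> X w $ i = c" "(X has_derivative X') (at z)"
  shows "X' v $ i = 0"
proof -
  have 1: "((\<lambda>w. X w $ i) has_derivative (\<lambda>v. X' v $ i)) (at z)"
    by (rule bounded_linear.has_derivative[OF bounded_linear_vec_nth assms(4)])
  have 2: "((\<lambda>w. X w $ i) has_derivative (\<lambda>v. 0)) (at z)"
    by (rule has_derivative_transform_within_open[OF has_derivative_const assms(1,2)]) (simp add: assms(3))
  show ?thesis using fun_cong[OF has_derivative_unique[OF 1 2]] .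
qed

context framing
begin

text \<open>The scalar product of the m^C-part of \<open>mc_form\<close> with \<open>u\<close>. The
  frame coordinates along m and n are its negatives, because m and n have square -1.\<close>

definition mc_coeff :: "complex \<Rightarrow> complex \<Rightarrow> complex \<Rightarrow> cvec \<Rightarrow> complex" where
  "mc_coeff \<mu> z v u = (inverse \<mu> * v) * cform (A z) u + (\<mu> * cnj v) * cform (B z) u"

definition surface_coeff :: "complex \<Rightarrow> complex \<Rightarrow> complex \<Rightarrow> cvec \<Rightarrow> complex" where
  "surface_coeff \<mu> z v u = (inverse \<mu> * v) * cform (A z) u - (\<mu> * cnj v) * cform (B z) u"

lemma mc_form_eq:
  assumes "m $ 1 = 0" "cform m m = -1"
  shows "mc_form z v \<mu> = frame_comb m (k z v) (- mc_coeff \<mu> z v m) (- mc_coeff \<mu> z v (ccross e1 m))"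
proof -
  have m: "m$2 * m$2 + m$3 * m$3 = -1" using assms by (simp add: cform_3)
  show ?thesis
    unfolding cvec_eq_iff frame_comb_nth[OF assms(1)] mc_form_def mc_coeff_def cform_3
    apply (simp add: A_1 B_1 assms(1) e1_nth)
    using m by algebra
qed

lemma surface_form_eq:
  assumes "m $ 1 = 0" "cform m m = -1"
  shows "surface_form z v \<mu> = frame_comb m 0 (- surface_coeff \<mu> z v m) (- surface_coeff \<mu> z v (ccross e1 m))"
proof -
  have m: "m$2 * m$2 + m$3 * m$3 = -1" using assms by (simp add: cform_3)
  show ?thesis
    unfolding cvec_eq_iff frame_comb_nth[OF assms(1)] surface_form_def surface_coeff_def cform_3
    apply (simp add: A_1 B_1 assms(1) e1_nth)
    using m by algebra
qed

end

section \<open>Structure equations of the frame \<Phi> e1, \<Phi> m, \<Phi> n\<close>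

locale moving_frame = framing +
  fixes U :: "complex set" and m :: "complex \<Rightarrow> cvec" and m' :: "complex \<Rightarrow> complex \<Rightarrow> cvec"
  assumes open_U: "open U"
    and m_1: "z \<in> U \<Longrightarrow> m z $ 1 = 0" and m_m: "z \<in> U \<Longrightarrow> cform (m z) (m z) = -1"
    and m_deriv: "z \<in> U \<Longrightarrow> (m has_derivative m' z) (at z)"
begin

definition n :: "complex \<Rightarrow> cvec" where "n z = ccross e1 (m z)"

text \<open>The connection coefficient between \<Phi> m and \<Phi> n: the turning of m in the plane
  orthogonal to e1, corrected by the k-part of the Maurer-Cartan form. It is the same for all loop
  parameters.\<close>

definition nu :: "complex \<Rightarrow> complex \<Rightarrow> complex" where
  "nu z v = cform (m' z v) (n z) - k z v"

text \<open>Differentiating (m, e1) = 0 and (m, m) = -1 leaves only a component along n.\<close>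

lemma m'_eq:
  assumes "z \<in> U"
  shows "m' z v = frame_comb (m z) 0 0 (- (nu z v + k z v))"
proof -
  interpret fr: isotropic_frame "m z" using assms m_1 m_m by unfold_locales auto
  have "m' z v $ 1 = 0"
    by (rule has_derivative_nth_const[OF open_U assms _ m_deriv[OF assms]]) (simp add: m_1)
  moreover have "cform (m' z v) (m z) = 0"
    by (rule has_derivative_cform_const[OF open_U assms _ m_deriv[OF assms]]) (simp add: m_m)
  ultimately show ?thesis
    using fr.frame_expand[of "m' z v"] unfolding nu_def frame_comb_def n_def fr.n_def
    by (simp add: cvec_eq_iff)
qed

lemma frame_m:
  assumes "\<mu> \<noteq> 0" "z \<in> U"
  shows "((\<lambda>w. \<Phi> w \<mu> *v m w) has_derivative
    (\<lambda>v. \<Phi> z \<mu> *v frame_comb (m z) (- mc_coeff \<mu> z v (n z)) 0 (- nu z v))) (at z)"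
proof -
  have m: "m z $ 2 * m z $ 2 + m z $ 3 * m z $ 3 = -1" using assms m_1 m_m[of z] by (simp add: cform_3)
  have "m' z v + ccross (mc_form z v \<mu>) (m z) = frame_comb (m z) (- mc_coeff \<mu> z v (n z)) 0 (- nu z v)" for v
    unfolding m'_eq[OF assms(2)] mc_form_eq[OF m_1[OF assms(2)] m_m[OF assms(2)]]
      cvec_eq_iff vector_add_component ccross_nth frame_comb_nth[OF m_1[OF assms(2)]]
      m_1[OF assms(2)] n_def[symmetric]
    using m by algebra
  then show ?thesis using rotated_deriv[OF assms(1) m_deriv[OF assms(2)]] by simp
qed

lemma frame_n:
  assumes "\<mu> \<noteq> 0" "z \<in> U"
  shows "((\<lambda>w. \<Phi> w \<mu> *v n w) has_derivative
    (\<lambda>v. \<Phi> z \<mu> *v frame_comb (m z) (mc_coeff \<mu> z v (m z)) (nu z v) 0)) (at z)"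
proof -
  have m: "m z $ 2 * m z $ 2 + m z $ 3 * m z $ 3 = -1" using assms m_1 m_m[of z] by (simp add: cform_3)
  have d: "(n has_derivative (\<lambda>v. ccross e1 (m' z v))) (at z)"
    unfolding n_def[abs_def]
    by (rule bounded_linear.has_derivative[OF bounded_bilinear.bounded_linear_right[OF bounded_bilinear_ccross] m_deriv[OF assms(2)]])
  have "ccross e1 (m' z v) + ccross (mc_form z v \<mu>) (n z) = frame_comb (m z) (mc_coeff \<mu> z v (m z)) (nu z v) 0" for v
    unfolding m'_eq[OF assms(2)] mc_form_eq[OF m_1[OF assms(2)] m_m[OF assms(2)]] n_def
      cvec_eq_iff vector_add_component ccross_nth frame_comb_nth[OF m_1[OF assms(2)]]
      m_1[OF assms(2)] e1_nth
    using m by algebra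
  then show ?thesis using rotated_deriv[OF assms(1) d] by simp
qed

lemma frame_e1:
  assumes "\<mu> \<noteq> 0" "z \<in> U"
  shows "((\<lambda>w. \<Phi> w \<mu> *v e1) has_derivative
    (\<lambda>v. \<Phi> z \<mu> *v frame_comb (m z) 0 (- mc_coeff \<mu> z v (n z)) (mc_coeff \<mu> z v (m z)))) (at z)"
proof -
  have "ccross (mc_form z v \<mu>) e1 = frame_comb (m z) 0 (- mc_coeff \<mu> z v (n z)) (mc_coeff \<mu> z v (m z))" for v
    unfolding mc_form_eq[OF m_1[OF assms(2)] m_m[OF assms(2)]] n_def
      cvec_eq_iff ccross_nth frame_comb_nth[OF m_1[OF assms(2)]] e1_nth
    by simp
  then show ?thesis using rotated_deriv[OF assms(1), of "\<lambda>_. e1" "\<lambda>_. 0" z] by simp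
qed

lemma frame_comb_linear:
  "frame_comb u x y w + frame_comb u x' y' w' = frame_comb u (x + x') (y + y') (w + w')"
  "c *s frame_comb u x y w = frame_comb u (c * x) (c * y) (c * w)"
  by (simp_all add: frame_comb_def cvec_eq_iff algebra_simps)

text \<open>The factor \<open>\<kappa>\<close> stays arbitrary: 0 gives the associated surface,
  \<open>- \<i> * D\<close> the dressed one, and in the converse it is an unknown.\<close>

lemma transformed_surface_deriv:
  assumes "\<mu> \<noteq> 0" "z \<in> U"
    and "\<forall>w\<in>U. F' w = assoc_surface \<Phi> \<mu> w + xi (\<kappa> *s (\<Phi> w \<mu> *v n w))"
  shows "(F' has_derivative (\<lambda>v. xi (\<Phi> z \<mu> *v frame_comb (m z) (\<kappa> * mc_coeff \<mu> z v (m z))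
    (- \<i> * surface_coeff \<mu> z v (m z) + \<kappa> * nu z v) (- \<i> * surface_coeff \<mu> z v (n z))))) (at z)"
proof -
  have "((\<lambda>w. assoc_surface \<Phi> \<mu> w + xi (\<kappa> *s (\<Phi> w \<mu> *v n w))) has_derivative
     (\<lambda>v. xi (\<Phi> z \<mu> *v (\<i> *s surface_form z v \<mu>)) +
        xi (\<kappa> *s (\<Phi> z \<mu> *v frame_comb (m z) (mc_coeff \<mu> z v (m z)) (nu z v) 0)))) (at z)"
    by (intro has_derivative_add assoc_surface_deriv assms(1) frame_n[OF assms(1,2)]
        bounded_linear.has_derivative[OF bounded_linear_xi]
        bounded_linear.has_derivative[OF bounded_bilinear.bounded_linear_right[OF bounded_bilinear_smult]])
  then have "((\<lambda>w. assoc_surface \<Phi> \<mu> w + xi (\<kappa> *s (\<Phi> w \<mu> *v n w))) has_derivative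
     (\<lambda>v. xi (\<Phi> z \<mu> *v frame_comb (m z) (\<kappa> * mc_coeff \<mu> z v (m z))
    (- \<i> * surface_coeff \<mu> z v (m z) + \<kappa> * nu z v) (- \<i> * surface_coeff \<mu> z v (n z))))) (at z)"
    unfolding xi_add[symmetric] cmat_vec_linear(4)[symmetric] cmat_vec_linear(1)[symmetric]
      surface_form_eq[OF m_1[OF assms(2)] m_m[OF assms(2)]] frame_comb_linear n_def
    by simp
  then show ?thesis
    by (rule has_derivative_transform_within_open[OF _ open_U assms(2)]) (simp add: assms(3))
qed

lemma transformed_normal_deriv:
  assumes "\<mu> \<noteq> 0" "z \<in> U"
    and "\<forall>w\<in>U. N' w = xi (C *s (\<Phi> w \<mu> *v e1) + D *s (\<Phi> w \<mu> *v m w))"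
  shows "(N' has_derivative (\<lambda>v. xi (\<Phi> z \<mu> *v frame_comb (m z) (- D * mc_coeff \<mu> z v (n z))
    (- C * mc_coeff \<mu> z v (n z)) (C * mc_coeff \<mu> z v (m z) - D * nu z v)))) (at z)"
proof -
  have "((\<lambda>w. xi (C *s (\<Phi> w \<mu> *v e1) + D *s (\<Phi> w \<mu> *v m w))) has_derivative
     (\<lambda>v. xi (C *s (\<Phi> z \<mu> *v frame_comb (m z) 0 (- mc_coeff \<mu> z v (n z)) (mc_coeff \<mu> z v (m z))) +
        D *s (\<Phi> z \<mu> *v frame_comb (m z) (- mc_coeff \<mu> z v (n z)) 0 (- nu z v))))) (at z)"
    by (intro has_derivative_add frame_m[OF assms(1,2)] frame_e1[OF assms(1,2)]
        bounded_linear.has_derivative[OF bounded_linear_xi]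
        bounded_linear.has_derivative[OF bounded_bilinear.bounded_linear_right[OF bounded_bilinear_smult]])
  then have "((\<lambda>w. xi (C *s (\<Phi> w \<mu> *v e1) + D *s (\<Phi> w \<mu> *v m w))) has_derivative
     (\<lambda>v. xi (\<Phi> z \<mu> *v frame_comb (m z) (- D * mc_coeff \<mu> z v (n z))
    (- C * mc_coeff \<mu> z v (n z)) (C * mc_coeff \<mu> z v (m z) - D * nu z v)))) (at z)"
    unfolding cmat_vec_linear(4)[symmetric] cmat_vec_linear(1)[symmetric] frame_comb_linear by simp
  then show ?thesis
    by (rule has_derivative_transform_within_open[OF _ open_U assms(2)]) (simp add: assms(3))
qed

lemma bform_rotated:
  assumes "\<mu> \<noteq> 0" "z \<in> U"
  shows "bform (xi (\<Phi> z \<mu> *v frame_comb (m z) x y w)) (xi (\<Phi> z \<mu> *v frame_comb (m z) x' y' w')) = x * x' - y * y' - w * w'"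
  using assms by (simp add: bform_xi SO3C_cform SO cform_frame_comb m_1 m_m)

end

section \<open>Dressing by simple factors gives Bianchi-Baecklund transforms\<close>

text \<open>With P = v / lam and R = lam cnj v one has P = dx + i dy and R = dx - i dy, so P^2 + R^2
  = 2 (dx^2 - dy^2) and P R = dx^2 + dy^2. Diagonal forms are those with equal coefficients of P^2
  and R^2.\<close>

lemma curvature_line_form:
  "c * ((inverse lam * v)\<^sup>2 + (lam * cnj v)\<^sup>2) + d * ((inverse lam * v) * (lam * cnj v)) =
    (2 * c + d) * (dxl lam v)\<^sup>2 + (d - 2 * c) * (dyl lam v)\<^sup>2"
proof -
  have "4 * (dxl lam v)\<^sup>2 = (inverse lam * v + lam * cnj v)\<^sup>2"
    by (simp add: dxl_def power_divide)
  moreover have "4 * (dyl lam v)\<^sup>2 = - (inverse lam * v - lam * cnj v)\<^sup>2"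
    by (simp add: dyl_def power_divide power_mult_distrib)
  ultimately show ?thesis by algebra
qed

text \<open>The real directions 1, i and 1 + i already give three independent equations for the
  complex coefficients.\<close>

lemma quadratic_form_eq_0:
  assumes "lam \<noteq> 0"
    and "\<And>v. a * (inverse lam * v)\<^sup>2 + b * (lam * cnj v)\<^sup>2 + c * ((inverse lam * v) * (lam * cnj v)) = 0"
  shows "a = 0" "b = 0" "c = 0"
proof -
  define s where "s = inverse lam"
  have s: "s * lam = 1" using assms(1) by (simp add: s_def)
  have "a * s\<^sup>2 + b * lam\<^sup>2 + c * (s * lam) = 0"
    using assms(2)[of 1] by (simp add: s_def)
  moreover have "- a * s\<^sup>2 - b * lam\<^sup>2 + c * (s * lam) = 0"
    using assms(2)[of \<i>] by (simp add: s_def power_mult_distrib) (simp add: mult.commute mult.left_commute)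
  moreover have "a * (s\<^sup>2 * (2 * \<i>)) - b * (lam\<^sup>2 * (2 * \<i>)) + c * (s * lam * 2) = 0"
    using assms(2)[of "1 + \<i>"] by (simp add: s_def power2_eq_square algebra_simps)
  ultimately have "c = 0 \<and> a * s\<^sup>2 = 0 \<and> b * lam\<^sup>2 = 0"
    unfolding s using i_squared by algebra
  then show "a = 0" "b = 0" "c = 0" using s assms(1) by auto
qed

text \<open>The number c + i s has inverse c - i s, so it is nonzero and \<sigma> = -i Ln (c + i s)
  works.\<close>

lemma complex_cos_sin:
  fixes c s :: complex
  assumes "c\<^sup>2 + s\<^sup>2 = 1"
  obtains \<sigma> where "cos \<sigma> = c" "sin \<sigma> = s"
proof -
  define w where "w = c + \<i> * s"
  have w: "w * (c - \<i> * s) = 1"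
    unfolding w_def using assms by (simp add: power2_eq_square algebra_simps)
  then have w0: "w \<noteq> 0" by auto
  have iw: "inverse w = c - \<i> * s" using w by (rule inverse_unique)
  have e: "exp (\<i> * (- \<i> * Ln w)) = w" "exp (- (\<i> * (- \<i> * Ln w))) = c - \<i> * s"
    using w0 iw by (simp_all add: exp_minus)
  show ?thesis
  proof
    show "cos (- \<i> * Ln w) = c" "sin (- \<i> * Ln w) = s"
      unfolding cos_exp_eq sin_exp_eq e by (simp_all add: w_def field_simps)
  qed
qed

section \<open>Fundamental forms of a surface displaced along \<Phi> n\<close>

context moving_frame
begin

lemma smooth_on_n: "smooth_on U m \<Longrightarrow> smooth_on U n"
  unfolding n_def[abs_def]
  by (rule smooth_on_bounded_linear[OF open_U bounded_bilinear.bounded_linear_right[OF bounded_bilinear_ccross]])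

lemma smooth_on_rotated:
  assumes "\<mu> \<noteq> 0" "smooth_on U X"
  shows "smooth_on U (\<lambda>w. \<Phi> w \<mu> *v X w)"
  by (rule smooth_on_bilinear[OF open_U bounded_bilinear_cmat_vec smooth_on_subset[OF smooth_on_framing[OF assms(1)]] assms(2)])
    simp

text \<open>The hypothesis \<open>tangent\<close> is orthogonality of dF' and N' in frame
  coordinates; \<open>CD\<close> makes N' a unit normal.\<close>

lemma csurface_on_transformed:
  assumes "\<mu> \<noteq> 0" "smooth_on U m"
    and F': "\<forall>w\<in>U. F' w = assoc_surface \<Phi> \<mu> w + xi (\<kappa> *s (\<Phi> w \<mu> *v n w))"
    and N': "\<forall>w\<in>U. N' w = xi (C *s (\<Phi> w \<mu> *v e1) + D *s (\<Phi> w \<mu> *v m w))"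
    and CD: "C\<^sup>2 - D\<^sup>2 = 1"
    and tangent: "\<And>z v. z \<in> U \<Longrightarrow> \<kappa> * mc_coeff \<mu> z v (m z) * C - (- \<i> * surface_coeff \<mu> z v (m z) + \<kappa> * nu z v) * D = 0"
  shows "csurface_on U F' N'"
  unfolding csurface_on_def
proof (intro conjI ballI allI)
  show "open U" by (rule open_U)
  show "smooth_on U F'"
    by (rule smooth_on_cong[OF open_U bspec[OF F'], THEN iffD2], assumption) (intro smooth_on_add open_U smooth_on_subset[OF smooth_on_assoc_surface[OF assms(1)]]
        smooth_on_bounded_linear[OF open_U bounded_linear_xi]
        smooth_on_bounded_linear[OF open_U bounded_bilinear.bounded_linear_right[OF bounded_bilinear_smult]]
        smooth_on_rotated assms(1) smooth_on_n assms(2) subset_UNIV)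
  show "smooth_on U N'"
    by (rule smooth_on_cong[OF open_U bspec[OF N'], THEN iffD2], assumption) (intro smooth_on_add open_U
        smooth_on_bounded_linear[OF open_U bounded_linear_xi]
        smooth_on_bounded_linear[OF open_U bounded_bilinear.bounded_linear_right[OF bounded_bilinear_smult]]
        smooth_on_rotated assms(1,2) smooth_on_const)
  fix z assume z: "z \<in> U"
  show "F' z \<in> so3C"
    using assoc_surface_so3C[OF assms(1), of z] xi_vee[of "assoc_surface \<Phi> \<mu> z"] xi_so3C
    unfolding bspec[OF F' z] by (metis xi_add)
  show "N' z \<in> so3C" unfolding bspec[OF N' z] by (rule xi_so3C)
  have N: "N' z = xi (\<Phi> z \<mu> *v frame_comb (m z) C D 0)"
    unfolding bspec[OF N' z] cmat_vec_linear(4)[symmetric] cmat_vec_linear(1)[symmetric] frame_comb_def by simp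
  show "bform (N' z) (N' z) = 1"
    unfolding N bform_rotated[OF assms(1) z] using CD by (simp add: power2_eq_square)
  show "bform (pd v F' z) (N' z) = 0" for v
    unfolding N frechet_derivative_eqI[OF transformed_surface_deriv[OF assms(1) z F']] bform_rotated[OF assms(1) z]
    using tangent[OF z] by simp
qed

lemma fform1_transformed:
  assumes "\<mu> \<noteq> 0" "z \<in> U"
    and F': "\<forall>w\<in>U. F' w = assoc_surface \<Phi> \<mu> w + xi (\<kappa> *s (\<Phi> w \<mu> *v n w))"
  shows "fform1 F' z v = (\<kappa> * mc_coeff \<mu> z v (m z))\<^sup>2 - (- \<i> * surface_coeff \<mu> z v (m z) + \<kappa> * nu z v)\<^sup>2
    + (surface_coeff \<mu> z v (n z))\<^sup>2"
  unfolding fform1_def frechet_derivative_eqI[OF transformed_surface_deriv[OF assms]] bform_rotated[OF assms(1,2)]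
  using i_squared by algebra

lemma fform2_transformed:
  assumes "\<mu> \<noteq> 0" "z \<in> U"
    and F': "\<forall>w\<in>U. F' w = assoc_surface \<Phi> \<mu> w + xi (\<kappa> *s (\<Phi> w \<mu> *v n w))"
    and N': "\<forall>w\<in>U. N' w = xi (C *s (\<Phi> w \<mu> *v e1) + D *s (\<Phi> w \<mu> *v m w))"
  shows "fform2 F' N' z v = \<kappa> * D * mc_coeff \<mu> z v (m z) * mc_coeff \<mu> z v (n z)
     - C * mc_coeff \<mu> z v (n z) * (- \<i> * surface_coeff \<mu> z v (m z) + \<kappa> * nu z v)
     - \<i> * surface_coeff \<mu> z v (n z) * (C * mc_coeff \<mu> z v (m z) - D * nu z v)"
  unfolding fform2_def frechet_derivative_eqI[OF transformed_surface_deriv[OF assms(1,2) F']]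
    frechet_derivative_eqI[OF transformed_normal_deriv[OF assms(1,2) N']] bform_rotated[OF assms(1,2)]
  by (simp add: algebra_simps)

end

lemma cform_self_frame:
  assumes "m $ 1 = 0" "cform m m = -1" "u $ 1 = 0"
  shows "(cform u m)\<^sup>2 + (cform u (ccross e1 m))\<^sup>2 = - cform u u"
proof -
  have m: "m$2 * m$2 + m$3 * m$3 = -1" using assms by (simp add: cform_3)
  show ?thesis unfolding cform_3 assms ccross_nth e1_nth using m by algebra
qed

text \<open>The normalisation is read off from the surface at parameter 1, but A and B do not depend
  on the parameter, so it serves the whole associated family.\<close>

locale associated_framing = framing +
  assumes A_A: "cform (A z) (A z) = -1/4" and B_B: "cform (B z) (B z) = -1/4"

locale associated_moving_frame = moving_frame + associated_framing
begin

lemma frame_norms: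
  assumes "z \<in> U"
  shows "(cform (A z) (m z))\<^sup>2 + (cform (A z) (n z))\<^sup>2 = 1/4"
    "(cform (B z) (m z))\<^sup>2 + (cform (B z) (n z))\<^sup>2 = 1/4"
  unfolding n_def using cform_self_frame[OF m_1[OF assms] m_m[OF assms]] A_1 B_1 A_A B_B by simp_all

text \<open>The case \<kappa> = 0, C = 1, D = 0 of the displaced surface. By
  \<open>frame_norms\<close> the terms (v / \<mu>)^2 and (\<mu> cnj v)^2 of the first form both have
  coefficient 1/4, and in the second form they cancel.\<close>

lemma curvature_line_assoc_surface:
  assumes "\<mu> \<noteq> 0" "smooth_on U m"
  shows "csurface_on U (assoc_surface \<Phi> \<mu>) (assoc_normal \<Phi> \<mu>)"
    and "curvature_line_coord \<mu> U (assoc_surface \<Phi> \<mu>) (assoc_normal \<Phi> \<mu>)"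
proof -
  have F: "\<forall>w\<in>U. assoc_surface \<Phi> \<mu> w = assoc_surface \<Phi> \<mu> w + xi (0 *s (\<Phi> w \<mu> *v n w))"
    by (simp add: xi_0)
  have N: "\<forall>w\<in>U. assoc_normal \<Phi> \<mu> w = xi (1 *s (\<Phi> w \<mu> *v e1) + 0 *s (\<Phi> w \<mu> *v m w))"
    by (simp add: assoc_normal_eq[OF assms(1)])
  show "csurface_on U (assoc_surface \<Phi> \<mu>) (assoc_normal \<Phi> \<mu>)"
    by (rule csurface_on_transformed[OF assms F N]) auto
  show "curvature_line_coord \<mu> U (assoc_surface \<Phi> \<mu>) (assoc_normal \<Phi> \<mu>)"
    unfolding curvature_line_coord_def
  proof (intro ballI conjI)
    fix z assume z: "z \<in> U"
    define p q p' q' where pq: "p = cform (A z) (m z)" "q = cform (A z) (n z)"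
      "p' = cform (B z) (m z)" "q' = cform (B z) (n z)"
    define c :: complex where "c = 1/4"
    have n: "p\<^sup>2 + q\<^sup>2 = c" "p'\<^sup>2 + q'\<^sup>2 = c" using frame_norms[OF z] by (simp_all add: pq c_def)
    have "fform1 (assoc_surface \<Phi> \<mu>) z v = c * ((inverse \<mu> * v)\<^sup>2 + (\<mu> * cnj v)\<^sup>2)
        + (-2 * (p * p' + q * q')) * ((inverse \<mu> * v) * (\<mu> * cnj v))" for v
    proof -
      have "(0 * (P * p + R * p'))\<^sup>2 - (- \<i> * (P * p - R * p') + 0 * t)\<^sup>2 + (P * q - R * q')\<^sup>2 =
          c * (P\<^sup>2 + R\<^sup>2) + (-2 * (p * p' + q * q')) * (P * R)" for P R t
      proof -
        have 1: "c * (P\<^sup>2 + R\<^sup>2) = (p\<^sup>2 + q\<^sup>2) * P\<^sup>2 + (p'\<^sup>2 + q'\<^sup>2) * R\<^sup>2"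
          unfolding n by (simp add: distrib_left)
        have 2: "(0 * x)\<^sup>2 - (- \<i> * y + 0 * t)\<^sup>2 = y\<^sup>2" for x y
          by (simp add: power_mult_distrib)
        show ?thesis unfolding 1 2 by algebra
      qed
      then show ?thesis
        unfolding fform1_transformed[OF assms(1) z F] surface_coeff_def mc_coeff_def pq[symmetric] .
    qed
    then show "\<exists>E G. \<forall>v. fform1 (assoc_surface \<Phi> \<mu>) z v = E * (dxl \<mu> v)\<^sup>2 + G * (dyl \<mu> v)\<^sup>2"
      unfolding curvature_line_form by blast
    have "fform2 (assoc_surface \<Phi> \<mu>) (assoc_normal \<Phi> \<mu>) z v = 0 * ((inverse \<mu> * v)\<^sup>2 + (\<mu> * cnj v)\<^sup>2)
        + (2 * \<i> * (p * q' - p' * q)) * ((inverse \<mu> * v) * (\<mu> * cnj v))" for v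
      unfolding fform2_transformed[OF assms(1) z F N] surface_coeff_def mc_coeff_def pq[symmetric]
      by (simp add: algebra_simps)
    then have "\<forall>v. fform2 (assoc_surface \<Phi> \<mu>) (assoc_normal \<Phi> \<mu>) z v =
        (2 * \<i> * (p * q' - p' * q)) * ((dxl \<mu> v)\<^sup>2 + (dyl \<mu> v)\<^sup>2)"
      unfolding curvature_line_form by (simp add: algebra_simps)
    then show "\<exists>H. \<forall>v. fform2 (assoc_surface \<Phi> \<mu>) (assoc_normal \<Phi> \<mu>) z v =
        H * ((dxl \<mu> v)\<^sup>2 + (dyl \<mu> v)\<^sup>2)" by blast
  qed
qed

lemma curvature_line_transformed:
  assumes "\<mu> \<noteq> 0" "smooth_on U m"
    and F': "\<forall>w\<in>U. F' w = assoc_surface \<Phi> \<mu> w + xi ((- \<i> * D) *s (\<Phi> w \<mu> *v n w))"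
    and N': "\<forall>w\<in>U. N' w = xi (C *s (\<Phi> w \<mu> *v e1) + D *s (\<Phi> w \<mu> *v m w))"
    and CD: "C\<^sup>2 - D\<^sup>2 = 1"
    and nu: "\<And>z v. z \<in> U \<Longrightarrow> D * nu z v = C * mc_coeff \<mu> z v (m z) - surface_coeff \<mu> z v (m z)"
  shows "csurface_on U F' N'" and "curvature_line_coord \<mu> U F' N'"
proof -
  show "csurface_on U F' N'"
  proof (rule csurface_on_transformed[OF assms(1,2) F' N' CD])
    show "- \<i> * D * mc_coeff \<mu> z v (m z) * C - (- \<i> * surface_coeff \<mu> z v (m z) + - \<i> * D * nu z v) * D = 0" if "z \<in> U" for z v
      using nu[OF that, of v] by algebra
  qed
  show "curvature_line_coord \<mu> U F' N'"
    unfolding curvature_line_coord_def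
  proof (intro ballI conjI)
    fix z assume z: "z \<in> U"
    define p q p' q' where pq: "p = cform (A z) (m z)" "q = cform (A z) (n z)"
      "p' = cform (B z) (m z)" "q' = cform (B z) (n z)"
    define c :: complex where "c = 1/4"
    have n: "p\<^sup>2 + q\<^sup>2 = c" "p'\<^sup>2 + q'\<^sup>2 = c" using frame_norms[OF z] by (simp_all add: pq c_def)
    \<comment> \<open>The hypothesis on \<open>nu\<close> turns the m-coordinate of dF' into -i C
      times \<open>mc_coeff\<close>. By C^2 - D^2 = 1 the first form is then the square of
      \<open>mc_coeff\<close> at m plus that of \<open>surface_coeff\<close> at n.\<close>
    have y: "- \<i> * b + - \<i> * D * t = - \<i> * C * a" if "D * t = C * a - b" for a b t
      using that by algebra
    have "fform1 F' z v = c * ((inverse \<mu> * v)\<^sup>2 + (\<mu> * cnj v)\<^sup>2)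
        + (2 * (p * p' - q * q')) * ((inverse \<mu> * v) * (\<mu> * cnj v))" for v
    proof -
      have "(- \<i> * D * (P * p + R * p'))\<^sup>2 - (- \<i> * C * (P * p + R * p'))\<^sup>2 + (P * q - R * q')\<^sup>2 =
          c * (P\<^sup>2 + R\<^sup>2) + (2 * (p * p' - q * q')) * (P * R)" for P R
      proof -
        have 1: "c * (P\<^sup>2 + R\<^sup>2) = (p\<^sup>2 + q\<^sup>2) * P\<^sup>2 + (p'\<^sup>2 + q'\<^sup>2) * R\<^sup>2"
          unfolding n by (simp add: distrib_left)
        show ?thesis unfolding 1 using i_squared CD by algebra
      qed
      then show ?thesis
        unfolding fform1_transformed[OF assms(1) z F'] y[OF nu[OF z]] unfolding surface_coeff_def mc_coeff_def pq[symmetric] .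
    qed
    then show "\<exists>E G. \<forall>v. fform1 F' z v = E * (dxl \<mu> v)\<^sup>2 + G * (dyl \<mu> v)\<^sup>2"
      unfolding curvature_line_form by blast
    have "fform2 F' N' z v = 0 * ((inverse \<mu> * v)\<^sup>2 + (\<mu> * cnj v)\<^sup>2)
        + (2 * \<i> * (p * q' + p' * q)) * ((inverse \<mu> * v) * (\<mu> * cnj v))" for v
    proof -
      have "(- \<i> * D) * D * (P * p + R * p') * (P * q + R * q')
          - C * (P * q + R * q') * (- \<i> * C * (P * p + R * p'))
          - \<i> * (P * q - R * q') * (C * (P * p + R * p') - (C * (P * p + R * p') - (P * p - R * p')))
         = 0 * (P\<^sup>2 + R\<^sup>2) + (2 * \<i> * (p * q' + p' * q)) * (P * R)" for P R
        using i_squared CD by algebra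
      then show ?thesis
        unfolding fform2_transformed[OF assms(1) z F' N'] y[OF nu[OF z]] nu[OF z] unfolding surface_coeff_def mc_coeff_def pq[symmetric] .
    qed
    then have "\<forall>v. fform2 F' N' z v =
        (2 * \<i> * (p * q' + p' * q)) * ((dxl \<mu> v)\<^sup>2 + (dyl \<mu> v)\<^sup>2)"
      unfolding curvature_line_form by (simp add: algebra_simps)
    then show "\<exists>H. \<forall>v. fform2 F' N' z v =
        H * ((dxl \<mu> v)\<^sup>2 + (dyl \<mu> v)\<^sup>2)" by blast
  qed
qed

end

text \<open>Only \<open>exp \<beta>\<close> is prescribed, so every branch of the logarithm is
  covered.\<close>

lemma exp_eq_sinh_cosh:
  fixes \<alpha> lam :: complex
  assumes "\<alpha> \<noteq> 0" "lam \<noteq> 0" "exp \<beta> = \<alpha> / lam"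
  shows "sinh \<beta> = (\<alpha>\<^sup>2 - lam\<^sup>2) / (2 * \<alpha> * lam)" "cosh \<beta> = (\<alpha>\<^sup>2 + lam\<^sup>2) / (2 * \<alpha> * lam)"
proof -
  have e: "exp (- \<beta>) = lam / \<alpha>" by (simp add: exp_minus assms)
  show "sinh \<beta> = (\<alpha>\<^sup>2 - lam\<^sup>2) / (2 * \<alpha> * lam)"
    unfolding sinh_field_def e assms(3) using assms(1,2) by (simp add: field_simps power2_eq_square)
  show "cosh \<beta> = (\<alpha>\<^sup>2 + lam\<^sup>2) / (2 * \<alpha> * lam)"
    unfolding cosh_field_def e assms(3) using assms(1,2) by (simp add: field_simps power2_eq_square)
qed

section \<open>Transport of a constant line by the inverse of \<Phi> at \<alpha>\<close>

context framing
begin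

text \<open>By \<open>transported_deriv\<close> the generator of the transported line moves by minus
  this cross product; its component along n determines the turning of m.\<close>

lemma dressing_derivative:
  assumes "m $ 1 = 0" "cform m m = -1"
  shows "cform (ccross (mc_form z v \<mu>) (e1 + m)) (ccross e1 m) = - (k z v + mc_coeff \<mu> z v m)"
proof -
  have m: "m$2 * m$2 + m$3 * m$3 = -1" using assms by (simp add: cform_3)
  show ?thesis
    unfolding mc_form_eq[OF assms] cform_3 ccross_nth frame_comb_nth[OF assms(1)] vector_add_component e1_nth assms(1)
    using m by algebra
qed

lemma Ltilde_line:
  "\<mu> \<noteq> 0 \<Longrightarrow> Ltilde \<Phi> \<mu> (line u) z = line (transpose (\<Phi> z \<mu>) *v u)"
  by (simp add: Ltilde_def line_image SO3C_inv SO)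

lemma transported_deriv:
  assumes "\<mu> \<noteq> 0"
  shows "((\<lambda>w. transpose (\<Phi> w \<mu>) *v u) has_derivative
    (\<lambda>v. - ccross (mc_form z v \<mu>) (transpose (\<Phi> z \<mu>) *v u))) (at z)"
proof -
  have "((\<lambda>w. transpose (\<Phi> w \<mu>) *v u) has_derivative
    (\<lambda>v. transpose (\<Phi> z \<mu> ** xi (mc_form z v \<mu>)) *v u)) (at z)"
    by (rule bounded_linear.has_derivative[OF bounded_bilinear.bounded_linear_left[OF bounded_bilinear_cmat_vec]
        bounded_linear.has_derivative[OF bounded_linear_transpose framing_deriv[OF assms]]])
  moreover have "transpose (\<Phi> z \<mu> ** xi (mc_form z v \<mu>)) *v u = - ccross (mc_form z v \<mu>) (transpose (\<Phi> z \<mu>) *v u)" for v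
    unfolding matrix_transpose_mul transpose_xi matrix_vector_mul_assoc[symmetric] ccross_xi[symmetric]
    by (simp add: cvec_eq_iff cmat_vec_nth)
  ultimately show ?thesis by simp
qed

end

context associated_framing
begin

text \<open>Pulling back a constant line forces \<open>nu\<close> to be \<open>mc_coeff\<close> at
  \<alpha>; \<open>shift\<close> rewrites this as the tangency condition at \<open>lam\<close>, the
  hypothesis of \<open>curvature_line_transformed\<close>.\<close>

lemma dressed_in_BB:
  assumes lam: "lam \<noteq> 0" and \<alpha>: "\<alpha> \<noteq> 0" "\<alpha> \<noteq> lam" "\<alpha> \<noteq> - lam"
    and L: "isotropic_line L" and \<beta>: "exp \<beta> = \<alpha> / lam"
  shows "(dressed_surface \<Phi> lam \<alpha> L, dressed_normal \<Phi> lam \<alpha> L)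
    \<in> BB \<beta> lam (regular_set \<Phi> \<alpha> L) (assoc_surface \<Phi> lam) (assoc_normal \<Phi> lam)"
proof -
  obtain u where u: "u \<noteq> 0" "cform u u = 0" "L = line u"
    using L isotropic_line_iff by blast
  define l where "l = (\<lambda>w. transpose (\<Phi> w \<alpha>) *v u)"
  define U where "U = regular_set \<Phi> \<alpha> L"
  have Lt: "Ltilde \<Phi> \<alpha> L w = line (l w)" for w
    by (simp add: u(3) Ltilde_line[OF \<alpha>(1)] l_def)
  have l0: "l w \<noteq> 0" "cform (l w) (l w) = 0" for w
  proof -
    show "l w \<noteq> 0"
      using SO3C_mult_transpose(2)[OF SO[OF \<alpha>(1)], of w u] u(1) by (auto simp: l_def)
    show "cform (l w) (l w) = 0"
      using u(2) by (simp add: l_def SO3C_cform SO3C_transpose_mem SO \<alpha>(1))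
  qed
  have U: "U = {w. l w $ 1 \<noteq> 0}"
    unfolding U_def regular_set_def Lt using Qim_line_eq_iff[OF l0] by auto
  have smooth_l: "smooth_on UNIV l"
    unfolding l_def
    by (rule smooth_on_bounded_linear[OF open_UNIV bounded_bilinear.bounded_linear_left[OF bounded_bilinear_cmat_vec]
        smooth_on_bounded_linear[OF open_UNIV bounded_linear_transpose smooth_on_framing[OF \<alpha>(1)]]])
  have open_U: "open U"
    unfolding U using smooth_on_imp_continuous_on[OF smooth_l]
    by (intro open_Collect_neq continuous_intros)
  \<comment> \<open>By \<open>Qim_line_eq_iff\<close> regularity means that the first coordinate of
    l is nonzero, so the line has a generator e1 + m.\<close>
  define m where "m = (\<lambda>w. inverse (l w $ 1) *s l w + - e1)"
  have e1_m: "l w = l w $ 1 *s (e1 + m w)" if "w \<in> U" for w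
    using that by (simp add: m_def U cvec_eq_iff)
  have m1: "m w $ 1 = 0" if "w \<in> U" for w
    using that by (simp add: m_def U e1_nth)
  have mm: "cform (m w) (m w) = -1" if "w \<in> U" for w
  proof -
    have "(l w $ 1)\<^sup>2 * (cform (m w) (m w) + 1) = 0"
      using l0(2)[of w] m1[OF that] unfolding cform_3
      by (subst (asm) (1 2 3 4 5 6) e1_m[OF that]) (simp add: e1_nth power2_eq_square algebra_simps)
    then show ?thesis using that by (simp add: U eq_neg_iff_add_eq_0)
  qed
  have smooth_m: "smooth_on U m"
    unfolding m_def using smooth_on_subset[OF smooth_l, of U]
    by (intro smooth_on_add open_U smooth_on_bilinear[OF open_U bounded_bilinear_smult] smooth_on_const
        smooth_on_inverse smooth_on_bounded_linear[OF open_U bounded_linear_vec_nth]) (auto simp: U)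
  define m' where "m' = (\<lambda>z v. frechet_derivative m (at z) v)"
  interpret associated_moving_frame \<Phi> A B k U m m'
    by unfold_locales (use open_U m1 mm smooth_on_has_derivative[OF smooth_m] in \<open>auto simp: m'_def\<close>)
  have nu_eq: "nu z v = mc_coeff \<alpha> z v (m z)" if z: "z \<in> U" for z v
  proof -
    define c where "c = (\<lambda>w. l w $ 1)"
    define l' where "l' = (\<lambda>v. - ccross (mc_form z v \<alpha>) (l z))"
    have dl: "(l has_derivative l') (at z)"
      unfolding l_def l'_def by (rule transported_deriv[OF \<alpha>(1)])
    have dc: "(c has_derivative (\<lambda>v. l' v $ 1)) (at z)"
      unfolding c_def by (rule bounded_linear.has_derivative[OF bounded_linear_vec_nth dl])
    have "((\<lambda>w. c w *s (e1 + m w)) has_derivative (\<lambda>v. c z *s (0 + m' z v) + (l' v $ 1) *s (e1 + m z))) (at z)"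
      by (intro bounded_bilinear.FDERIV[OF bounded_bilinear_smult dc] has_derivative_add has_derivative_const m_deriv z)
    then have "(l has_derivative (\<lambda>v. c z *s (0 + m' z v) + (l' v $ 1) *s (e1 + m z))) (at z)"
      by (rule has_derivative_transform_within_open[OF _ open_U z]) (unfold c_def, rule e1_m[symmetric])
    note l'_eq = fun_cong[OF has_derivative_unique[OF dl this], of v]
    \<comment> \<open>n is orthogonal to e1 + m, so pairing with n removes the derivative of the
      scale factor \<open>c\<close>.\<close>
    have "cform (c z *s (0 + q) + t *s (e1 + m z)) (n z) = c z * cform q (n z)" for q t
      by (simp add: n_def cform_3 e1_nth m1[OF z] algebra_simps)
    from trans[OF arg_cong[OF l'_eq, where f = "\<lambda>x. cform x (n z)"] this]
    have "cform (l' v) (n z) = c z * cform (m' z v) (n z)" .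
    moreover have "cform (l' v) (n z) = c z * (k z v + mc_coeff \<alpha> z v (m z))"
    proof -
      have "l' v = (- c z) *s ccross (mc_form z v \<alpha>) (e1 + m z)"
        unfolding l'_def by (subst e1_m[OF z]) (simp add: c_def cvec_eq_iff algebra_simps)
      then show ?thesis
        by (simp only: cform_linear n_def dressing_derivative[OF m1[OF z] mm[OF z]]) (simp add: algebra_simps)
    qed
    moreover have "c z \<noteq> 0" using z by (simp add: U c_def)
    ultimately have "k z v + mc_coeff \<alpha> z v (m z) = cform (m' z v) (n z)" by simp
    then show ?thesis by (simp only: nu_def algebra_simps)
  qed
  define C where "C = (\<alpha>\<^sup>2 + lam\<^sup>2) / (\<alpha>\<^sup>2 - lam\<^sup>2)"
  define D where "D = 2 * \<alpha> * lam / (\<alpha>\<^sup>2 - lam\<^sup>2)"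
  define d where "d = \<alpha>\<^sup>2 - lam\<^sup>2"
  have d: "d \<noteq> 0"
  proof
    assume "d = 0"
    then have "\<alpha>\<^sup>2 = lam\<^sup>2" by (simp add: d_def)
    then show False using \<alpha> power2_eq_iff by blast
  qed
  have Cd: "C * d = \<alpha>\<^sup>2 + lam\<^sup>2" and Dd: "D * d = 2 * \<alpha> * lam"
    using d by (simp_all add: C_def D_def d_def)
  have CD: "C\<^sup>2 - D\<^sup>2 = 1"
  proof -
    have "(C\<^sup>2 - D\<^sup>2) * d\<^sup>2 = 1 * d\<^sup>2"
      using Cd Dd d_def by algebra
    then show ?thesis using d by simp
  qed
  have D0: "D \<noteq> 0" using Dd \<alpha>(1) lam by auto
  \<comment> \<open>The factors C - 1 and C + 1 split the form at \<alpha> into C times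
    \<open>mc_coeff\<close> minus \<open>surface_coeff\<close>, both at \<open>lam\<close>.\<close>
  have shift: "D * inverse \<alpha> = (C - 1) * inverse lam" "D * \<alpha> = (C + 1) * lam"
  proof -
    have "(D * lam) * d = ((C - 1) * \<alpha>) * d" "(D * \<alpha>) * d = ((C + 1) * lam) * d"
      using Cd Dd d_def by algebra+
    then have "D * lam = (C - 1) * \<alpha>" "D * \<alpha> = (C + 1) * lam" using d by simp_all
    then show "D * inverse \<alpha> = (C - 1) * inverse lam" "D * \<alpha> = (C + 1) * lam"
      using \<alpha>(1) lam by (simp_all add: field_simps)
  qed
  have nu: "D * nu z v = C * mc_coeff lam z v (m z) - surface_coeff lam z v (m z)" if "z \<in> U" for z v
  proof -
    have "D * nu z v = (D * inverse \<alpha>) * (v * cform (A z) (m z)) + (D * \<alpha>) * (cnj v * cform (B z) (m z))"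
      unfolding nu_eq[OF that] mc_coeff_def by (simp add: algebra_simps)
    also have "\<dots> = C * mc_coeff lam z v (m z) - surface_coeff lam z v (m z)"
      unfolding shift mc_coeff_def surface_coeff_def by (simp add: algebra_simps)
    finally show ?thesis .
  qed
  let ?F = "assoc_surface \<Phi> lam" and ?N = "assoc_normal \<Phi> lam"
  let ?F' = "dressed_surface \<Phi> lam \<alpha> L" and ?N' = "dressed_normal \<Phi> lam \<alpha> L"
  have line_m: "Ltilde \<Phi> \<alpha> L w = line (e1 + m w)" if "w \<in> U" for w
    unfolding Lt by (subst e1_m[OF that], rule line_smult) (use that in \<open>simp add: U\<close>)
  have F': "\<forall>w\<in>U. ?F' w = ?F w + xi ((- \<i> * D) *s (\<Phi> w lam *v n w))"
    using dressed_eq(1)[OF lam \<alpha> line_m m1 mm] by (simp add: D_def n_def)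
  have N': "\<forall>w\<in>U. ?N' w = xi (C *s (\<Phi> w lam *v e1) + D *s (\<Phi> w lam *v m w))"
    using dressed_eq(2)[OF lam \<alpha> line_m m1 mm] by (simp add: C_def D_def)
  have E: "\<Phi> w lam *v e1 = \<Phi> w lam *v frame_comb (m w) 1 0 0" "\<Phi> w lam *v n w = \<Phi> w lam *v frame_comb (m w) 0 0 1" for w
    by (simp_all add: frame_comb_def n_def cmat_vec_linear)
  have N'_frame_comb: "\<forall>w\<in>U. ?N' w = xi (\<Phi> w lam *v frame_comb (m w) C D 0)"
    using N' by (simp add: frame_comb_def cmat_vec_linear)
  have N_N': "bform (?N w) (?N' w) = C" if "w \<in> U" for w
    unfolding assoc_normal_eq[OF lam] bspec[OF N'_frame_comb that] E by (subst bform_rotated[OF lam that]) simp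
  have "bianchi_baecklund lam U ?F ?N ?F' ?N'"
    unfolding bianchi_baecklund_def
  proof (intro conjI ballI)
    show "csurface_on U ?F ?N" "curvature_line_coord lam U ?F ?N"
      by (rule curvature_line_assoc_surface[OF lam smooth_m])+
    show "csurface_on U ?F' ?N'" "curvature_line_coord lam U ?F' ?N'"
      by (rule curvature_line_transformed[OF lam smooth_m F' N' CD nu], assumption)+
    show "bform (?F' z - ?F z) (?N z) = 0" "bform (?F' z - ?F z) (?N' z) = 0" if z: "z \<in> U" for z
      unfolding bspec[OF F' z] bspec[OF N'_frame_comb z] add_diff_cancel_left' assoc_normal_eq[OF lam] E
        cmat_vec_linear(4)[symmetric] frame_comb_linear(2) bform_rotated[OF lam z] by simp_all
    have "bform (?F' z - ?F z) (?F' z - ?F z) = D\<^sup>2" if z: "z \<in> U" for z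
      unfolding bspec[OF F' z] add_diff_cancel_left' E
        cmat_vec_linear(4)[symmetric] frame_comb_linear(2) bform_rotated[OF lam z] using i_squared by algebra
    then show "\<exists>c. c \<noteq> 0 \<and> (\<forall>z\<in>U. bform (?F' z - ?F z) (?F' z - ?F z) = c)"
      using D0 by (intro exI[of _ "D\<^sup>2"]) simp
    show "\<exists>c. \<forall>z\<in>U. bform (?N z) (?N' z) = c" using N_N' by blast
  qed
  moreover have "\<beta> \<notin> {\<i> * of_int n * of_real pi | n. True}"
  proof
    assume "\<beta> \<in> {\<i> * of_int n * of_real pi | n. True}"
    then obtain j :: int where "\<beta> = \<i> * of_int j * of_real pi" by blast
    then have "exp \<beta> * exp \<beta> = exp ((2 * of_int j * pi) * \<i>)"
      unfolding exp_add[symmetric] by (simp add: algebra_simps)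
    also have "\<dots> = 1" by (rule exp_integer_2pi) simp
    finally have "\<alpha>\<^sup>2 = lam\<^sup>2" using lam by (simp add: \<beta> power2_eq_square field_simps)
    then show False using d by (simp add: d_def)
  qed
  moreover have "\<exists>\<sigma> u. sin \<sigma> \<noteq> 0 \<and> cot \<sigma> = - \<i> * cosh \<beta> \<and>
        (\<forall>z\<in>U. ?F' z - ?F z = (1 / sinh \<beta>) *\<^sub>m u z \<and> bform (u z) (u z) = 1 \<and>
           bform (?N z) (?N' z) = cos \<sigma> \<and> commutator (?N z) (?N' z) = sin \<sigma> *\<^sub>m u z)"
  proof -
    have "C\<^sup>2 + (\<i> * D)\<^sup>2 = 1" using CD by (simp add: power_mult_distrib)
    \<comment> \<open>C = coth \<beta> and D = 1 / sinh \<beta>, so cot \<sigma> = C / (i D) = -i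
      cosh \<beta>.\<close>
    then obtain \<sigma> where \<sigma>: "cos \<sigma> = C" "sin \<sigma> = \<i> * D" by (rule complex_cos_sin)
    \<comment> \<open>The factor -i normalises \<Phi> n, whose square is -1, and matches the signs
      of both the displacement D u and the cross product i D u.\<close>
    define u where "u = (\<lambda>z. xi ((- \<i>) *s (\<Phi> z lam *v n z)))"
    have sinh: "1 / sinh \<beta> = D" and cosh: "cosh \<beta> = C / D"
      unfolding exp_eq_sinh_cosh[OF \<alpha>(1) lam \<beta>] C_def D_def using d by (simp_all add: d_def)
    show ?thesis
    proof (intro exI[of _ \<sigma>] exI[of _ u] conjI ballI)
      show "sin \<sigma> \<noteq> 0" "cot \<sigma> = - \<i> * cosh \<beta>"
        using D0 by (simp_all add: \<sigma> cot_def cosh field_simps)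
      fix z assume z: "z \<in> U"
      show "?F' z - ?F z = (1 / sinh \<beta>) *\<^sub>m u z"
        unfolding bspec[OF F' z] sinh u_def xi_smult[symmetric] by (simp add: mult.commute)
      show "bform (u z) (u z) = 1"
        unfolding u_def E cmat_vec_linear(4)[symmetric] frame_comb_linear(2) bform_rotated[OF lam z] by simp
      show "bform (?N z) (?N' z) = cos \<sigma>" using N_N'[OF z] \<sigma> by simp
      have "ccross (frame_comb (m z) 1 0 0) (frame_comb (m z) C D 0) = D *s n z"
        by (simp add: frame_comb_def n_def cvec_eq_iff m1[OF z] e1_nth algebra_simps)
      then show "commutator (?N z) (?N' z) = sin \<sigma> *\<^sub>m u z"
        unfolding assoc_normal_eq[OF lam] bspec[OF N'_frame_comb z] E(1) commutator_xi SO3C_ccross[OF SO[OF lam]]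
          u_def xi_smult[symmetric] \<sigma> cmat_vec_linear(4)[symmetric] by (simp add: mult_ac)
    qed
  qed
  ultimately show ?thesis by (simp add: BB_def U_def)
qed

end

section \<open>Bianchi-Baecklund transforms arise by dressing\<close>

text \<open>Near a point where \<open>f\<^sub>j\<close> does not vanish, \<open>f / f\<^sub>j\<close> has derivative 0.\<close>

lemma parallel_imp_constant_line:
  fixes f :: "complex \<Rightarrow> cvec"
  assumes "open U" "connected U"
    and f: "\<And>z. z \<in> U \<Longrightarrow> f z \<noteq> 0"
    and df: "\<And>z. z \<in> U \<Longrightarrow> (f has_derivative (\<lambda>v. \<theta> z v *s f z)) (at z)"
    and ab: "a \<in> U" "b \<in> U"
  shows "\<exists>t. t \<noteq> 0 \<and> f b = t *s f a"
proof (rule connected_equivalence_relation[OF assms(2) ab, where R = "\<lambda>a b. \<exists>t. t \<noteq> 0 \<and> f b = t *s f a"])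
  fix x y assume "\<exists>t. t \<noteq> 0 \<and> f y = t *s f x"
  then obtain t where "t \<noteq> 0" "f y = t *s f x" by blast
  then have "inverse t \<noteq> 0" "f x = inverse t *s f y" by simp_all
  then show "\<exists>t. t \<noteq> 0 \<and> f x = t *s f y" by blast
next
  fix x y z assume "\<exists>t. t \<noteq> 0 \<and> f y = t *s f x" "\<exists>t. t \<noteq> 0 \<and> f z = t *s f y"
  then obtain t s where "t \<noteq> 0" "f y = t *s f x" "s \<noteq> 0" "f z = s *s f y" by blast
  then have "s * t \<noteq> 0" "f z = (s * t) *s f x" by simp_all
  then show "\<exists>t. t \<noteq> 0 \<and> f z = t *s f x" by blast
next
  fix x assume x: "x \<in> U"
  obtain j where j: "f x $ j \<noteq> 0" using f[OF x] by (auto simp: vec_eq_iff)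
  have dj: "((\<lambda>w. f w $ j) has_derivative (\<lambda>v. \<theta> z v * f z $ j)) (at z)" if "z \<in> U" for z
    using bounded_linear.has_derivative[OF bounded_linear_vec_nth[of j] df[OF that]] by simp
  have "continuous_on U (\<lambda>w. f w $ j)"
    using dj by (intro continuous_at_imp_continuous_on ballI has_derivative_continuous)
  then have "open (U \<inter> (\<lambda>w. f w $ j) -` (- {0}))"
    by (intro continuous_open_preimage assms(1)) (auto simp: open_Compl)
  then obtain e where e: "e > 0" "ball x e \<subseteq> U \<inter> (\<lambda>w. f w $ j) -` (- {0})"
    using x j open_contains_ball_eq by blast
  define g where "g = (\<lambda>w. inverse (f w $ j) *s f w)"
  have "(g has_derivative (\<lambda>v. 0)) (at z within ball x e)" if z: "z \<in> ball x e" for z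
  proof -
    have zU: "z \<in> U" and zj: "f z $ j \<noteq> 0" using e z by auto
    have "(g has_derivative (\<lambda>v. inverse (f z $ j) *s (\<theta> z v *s f z) +
       (- (inverse (f z $ j) * (\<theta> z v * f z $ j) * inverse (f z $ j))) *s f z)) (at z)"
      unfolding g_def
      by (intro bounded_bilinear.FDERIV[OF bounded_bilinear_smult] df zU Deriv.has_derivative_inverse zj dj)
    then have "(g has_derivative (\<lambda>v. 0)) (at z)"
      by (rule has_derivative_eq_rhs) (use zj in \<open>simp add: fun_eq_iff cvec_eq_iff\<close>)
    then show ?thesis by (rule has_derivative_at_withinI)
  qed
  then obtain c where c: "\<And>z. z \<in> ball x e \<Longrightarrow> g z = c"
    using has_derivative_zero_constant[of "ball x e" g] by auto
  have eqv: "\<exists>t. t \<noteq> 0 \<and> f y = t *s f x" if y: "y \<in> ball x e" for y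
  proof -
    have "x \<in> ball x e" using e by simp
    then have "g y = g x" using c y by simp
    moreover have yj: "f y $ j \<noteq> 0" using e y by auto
    ultimately have "f y = (f y $ j * inverse (f x $ j)) *s f x"
      using j unfolding g_def by (metis (no_types) left_inverse right_inverse vec.scale_one vec.scale_scale)
    moreover have "f y $ j * inverse (f x $ j) \<noteq> 0" using yj j by simp
    ultimately show ?thesis by blast
  qed
  show "\<exists>T. openin (top_of_set U) T \<and> x \<in> T \<and> (\<forall>y\<in>T. \<exists>t. t \<noteq> 0 \<and> f y = t *s f x)"
  proof (intro exI[of _ "ball x e"] conjI ballI)
    show "openin (top_of_set U) (ball x e)"
      using e assms(1) by (auto intro: open_subset)
    show "x \<in> ball x e" using e by simp
    show "\<exists>t. t \<noteq> 0 \<and> f y = t *s f x" if "y \<in> ball x e" for y by (rule eqv[OF that])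
  qed
qed

section \<open>Rank and comparison of coefficients\<close>

lemma not_immersedI:
  assumes "pd 1 F z = s *\<^sub>m X" "pd \<i> F z = t *\<^sub>m X"
  shows "\<not> immersed_at F z"
proof
  assume i: "immersed_at F z"
  have 0: "a = 0 \<and> b = 0" if "a * s + b * t = 0" for a b
  proof -
    have "a *\<^sub>m pd 1 F z + b *\<^sub>m pd \<i> F z = (a * s + b * t) *\<^sub>m X"
      unfolding assms by (simp add: cmat_eq_iff algebra_simps)
    also have "\<dots> = 0" unfolding that by (simp add: cmat_eq_iff)
    finally show ?thesis using i by (simp add: immersed_at_def)
  qed
  \<comment> \<open>The pair (t, -s) is always a relation; it is trivial only if both partial
    derivatives vanish, and then (1, 0) is one.\<close>
  from 0[of t "- s"] have "s = 0" "t = 0" by simp_all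
  then show False using 0[of 1 0] by simp
qed

lemma bform_add: "bform (M + M') X = bform M X + bform M' X"
  by (simp add: bform_def trace_def sum_3 cmat_mult_nth algebra_simps add_divide_distrib)

lemma linear_form_eq_0:
  assumes "lam \<noteq> 0" and "\<And>v. a * (inverse lam * v) + b * (lam * cnj v) = 0"
  shows "a = 0" "b = 0"
proof -
  have "a * inverse lam + b * lam = 0" "a * inverse lam - b * lam = 0"
    using assms(2)[of 1] assms(2)[of \<i>] by (simp_all add: algebra_simps)
  then have "2 * (a * inverse lam) = 0" "2 * (b * lam) = 0" by algebra+
  then show "a = 0" "b = 0" using assms(1) by simp_all
qed

text \<open>Extracts from diagonality that the squares of v / lam and lam cnj v have the same
  coefficient; \<open>r\<close> and \<open>s\<close> rewrite the right side in the basis of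
  \<open>curvature_line_form\<close>.\<close>

lemma diagonal_form_coeffs:
  assumes "lam \<noteq> 0"
    and "\<And>v. a * (inverse lam * v)\<^sup>2 + b * (lam * cnj v)\<^sup>2 + c * ((inverse lam * v) * (lam * cnj v)) =
      E * (dxl lam v)\<^sup>2 + G * (dyl lam v)\<^sup>2"
  shows "a = (E - G) / 4" "b = (E - G) / 4"
proof -
  define r where "r = (E - G) / 4"
  define s where "s = (E + G) / 2"
  have r: "2 * r + s = E" "s - 2 * r = G" by (simp_all add: r_def s_def field_simps)
  have "(a - r) * (inverse lam * v)\<^sup>2 + (b - r) * (lam * cnj v)\<^sup>2
      + (c - s) * ((inverse lam * v) * (lam * cnj v)) = 0" for v
    using assms(2)[of v] curvature_line_form[of r lam v s] unfolding r by algebra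
  from quadratic_form_eq_0[OF assms(1) this] show "a = (E - G) / 4" "b = (E - G) / 4"
    by (simp_all add: r_def)
qed

context associated_moving_frame
begin

text \<open>If \<open>\<kappa>\<^sup>2 \<noteq> - D\<^sup>2\<close> the curvature line conditions force \<open>A\<close> and \<open>B\<close> to be parallel to the same
  vector \<open>m\<close> or \<open>n\<close>, and then both surfaces have rank at most 1.\<close>

lemma transform_constants:
  assumes lam: "lam \<noteq> 0" and z: "z \<in> U" and \<kappa>: "\<kappa> \<noteq> 0" and CD: "C\<^sup>2 - D\<^sup>2 = 1"
    and F': "\<forall>w\<in>U. F' w = assoc_surface \<Phi> lam w + xi (\<kappa> *s (\<Phi> w lam *v n w))"
    and N': "\<forall>w\<in>U. N' w = xi (C *s (\<Phi> w lam *v e1) + D *s (\<Phi> w lam *v m w))"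
    and tangent: "\<And>v. bform (pd v F' z) (N' z) = 0"
    and I: "\<And>v. fform1 F' z v = E * (dxl lam v)\<^sup>2 + G * (dyl lam v)\<^sup>2"
    and II: "\<And>v. fform2 F' N' z v = H * ((dxl lam v)\<^sup>2 + (dyl lam v)\<^sup>2)"
    and immersed: "immersed_at (assoc_surface \<Phi> lam) z \<or> immersed_at F' z"
  shows "D \<noteq> 0" "\<kappa>\<^sup>2 + D\<^sup>2 = 0"
proof -
  define p q p' q' where pq: "p = cform (A z) (m z)" "q = cform (A z) (n z)"
    "p' = cform (B z) (m z)" "q' = cform (B z) (n z)"
  define P where "P = (\<lambda>v. inverse lam * v)"
  define R where "R = (\<lambda>v. lam * cnj v)"
  have norms: "p\<^sup>2 + q\<^sup>2 = 1/4" "p'\<^sup>2 + q'\<^sup>2 = 1/4" using frame_norms[OF z] by (simp_all add: pq)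
  have ab: "mc_coeff lam z v (m z) = P v * p + R v * p'" "mc_coeff lam z v (n z) = P v * q + R v * q'"
    "surface_coeff lam z v (m z) = P v * p - R v * p'" "surface_coeff lam z v (n z) = P v * q - R v * q'" for v
    by (simp_all add: mc_coeff_def surface_coeff_def pq P_def R_def)
  have F: "\<forall>w\<in>U. assoc_surface \<Phi> lam w = assoc_surface \<Phi> lam w + xi (0 *s (\<Phi> w lam *v n w))"
    by (simp add: xi_0)
  note dF' = transformed_surface_deriv[OF lam z F']
  have pdF: "pd v (assoc_surface \<Phi> lam) z = xi (\<Phi> z lam *v frame_comb (m z) 0 (- \<i> * (P v * p - R v * p')) (- \<i> * (P v * q - R v * q')))" for v
    unfolding frechet_derivative_eqI[OF transformed_surface_deriv[OF lam z F]] ab by simp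
  have pdF': "pd v F' z = xi (\<Phi> z lam *v frame_comb (m z) (\<kappa> * (P v * p + R v * p'))
      (- \<i> * (P v * p - R v * p') + \<kappa> * nu z v) (- \<i> * (P v * q - R v * q')))" for v
    unfolding frechet_derivative_eqI[OF dF'] ab by simp
  have N: "N' z = xi (\<Phi> z lam *v frame_comb (m z) C D 0)"
    unfolding bspec[OF N' z] frame_comb_def by (simp add: cmat_vec_linear)
  have tan: "\<kappa> * (P v * p + R v * p') * C = (- \<i> * (P v * p - R v * p') + \<kappa> * nu z v) * D" for v
    using tangent[of v] unfolding pdF' N bform_rotated[OF lam z] by simp
  have mscale_frame_comb: "xi (\<Phi> z lam *v frame_comb (m z) (c * x) (c * y) (c * w)) = c *\<^sub>m xi (\<Phi> z lam *v frame_comb (m z) x y w)" for c x y w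
    unfolding frame_comb_linear(2)[symmetric] cmat_vec_linear(4) xi_smult ..
  have rank_F_n: "\<not> immersed_at (assoc_surface \<Phi> lam) z" if "p = 0" "p' = 0"
    by (rule not_immersedI; unfold pdF; rule trans[OF _ mscale_frame_comb[of _ 0 0 1]]; simp add: that)
  have rank_F_m: "\<not> immersed_at (assoc_surface \<Phi> lam) z" if "q = 0" "q' = 0"
    by (rule not_immersedI; unfold pdF; rule trans[OF _ mscale_frame_comb[of _ 0 1 0]]; simp add: that)
  have I': "(\<kappa> * (P v * p + R v * p'))\<^sup>2 - (- \<i> * (P v * p - R v * p') + \<kappa> * nu z v)\<^sup>2
      + (P v * q - R v * q')\<^sup>2 = E * (dxl lam v)\<^sup>2 + G * (dyl lam v)\<^sup>2" for v
    using I[of v] unfolding fform1_transformed[OF lam z F'] ab .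
  have PR: "(dxl lam v)\<^sup>2 + (dyl lam v)\<^sup>2 = P v * R v" for v
    using curvature_line_form[of 0 lam v 1] by (simp add: P_def R_def)
  have II': "\<kappa> * D * (P v * p + R v * p') * (P v * q + R v * q')
     - C * (P v * q + R v * q') * (- \<i> * (P v * p - R v * p') + \<kappa> * nu z v)
     - \<i> * (P v * q - R v * q') * (C * (P v * p + R v * p') - D * nu z v) = H * (P v * R v)" for v
    using II[of v] unfolding fform2_transformed[OF lam z F' N'] ab PR .
  show D: "D \<noteq> 0"
  proof
    assume D: "D = 0"
    then have C: "C \<noteq> 0" using CD by auto
    have "p * P v + p' * R v = 0" for v
      using tan[of v] D C \<kappa> by (simp add: mult.commute)
    then have p: "p = 0" "p' = 0"
      using linear_form_eq_0[OF lam, of p p'] unfolding P_def R_def by blast+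
    \<comment> \<open>With D = 0 tangency gives p = p' = 0, and the second form factors as a product
      of linear forms that is a multiple of P R. Both coefficients q, q' of \<open>f\<close> are
      nonzero, so \<open>f\<close> is proportional to neither P nor R, which forces \<open>g\<close>
      to vanish.\<close>
    define f where "f = (\<lambda>v. P v * q + R v * q')"
    define g where "g = (\<lambda>v. C * \<kappa> * nu z v)"
    have fg: "f v * g v = - H * (P v * R v)" for v
      using II'[of v] D p unfolding f_def g_def by algebra
    \<comment> \<open>\<open>nu\<close> is not linear by definition; the additivity needed here is
      recovered from the derivative of F' by pairing with \<Phi> m.\<close>
    have "linear (\<lambda>v. pd v F' z)"
      using has_derivative_linear[OF dF'] unfolding frechet_derivative_eqI[OF dF', abs_def] .
    then have "pd (1 + \<i>) F' z = pd 1 F' z + pd \<i> F' z" by (rule linear_add)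
    then have "bform (pd (1 + \<i>) F' z) (xi (\<Phi> z lam *v frame_comb (m z) 0 1 0)) =
        bform (pd 1 F' z) (xi (\<Phi> z lam *v frame_comb (m z) 0 1 0)) + bform (pd \<i> F' z) (xi (\<Phi> z lam *v frame_comb (m z) 0 1 0))"
      by (simp only: bform_add)
    then have "\<kappa> * nu z (1 + \<i>) = \<kappa> * nu z 1 + \<kappa> * nu z \<i>"
      unfolding pdF' bform_rotated[OF lam z] p by algebra
    then have g_add: "g (1 + \<i>) = g 1 + g \<i>" using \<kappa> by (simp add: g_def algebra_simps)
    have f_add: "f (1 + \<i>) = f 1 + f \<i>" by (simp add: f_def P_def R_def algebra_simps)
    have PR1: "P 1 * R 1 = 1" "P \<i> * R \<i> = 1" "P (1 + \<i>) * R (1 + \<i>) = 2"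
      using lam by (simp_all add: P_def R_def algebra_simps)
    have "f 1 * g 1 = - H" "f \<i> * g \<i> = - H" "(f 1 + f \<i>) * (g 1 + g \<i>) = - H * 2"
      using fg[of 1] fg[of \<i>] fg[of "1 + \<i>"] unfolding PR1 f_add g_add by simp_all
    then have "((f 1)\<^sup>2 + (f \<i>)\<^sup>2) * g 1 = 0" "((f 1)\<^sup>2 + (f \<i>)\<^sup>2) * g \<i> = 0"
      by algebra+
    moreover have "(f 1)\<^sup>2 + (f \<i>)\<^sup>2 = 4 * (q * q')"
    proof -
      have "f 1 = P 1 * q + R 1 * q'" "f \<i> = \<i> * (P 1 * q - R 1 * q')"
        by (simp_all add: f_def P_def R_def algebra_simps)
      then show ?thesis using PR1(1) i_squared by algebra
    qed
    moreover have "q * q' \<noteq> 0" using norms p by auto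
    ultimately have "g 1 = 0" "g \<i> = 0" by simp_all
    then have nu: "nu z 1 = 0" "nu z \<i> = 0" using C \<kappa> by (simp_all add: g_def)
    have "\<not> immersed_at F' z"
      by (rule not_immersedI; unfold pdF'; rule trans[OF _ mscale_frame_comb[of _ 0 0 1]]; simp add: p nu)
    then show False using immersed rank_F_n p by blast
  qed
  show "\<kappa>\<^sup>2 + D\<^sup>2 = 0"
  proof (rule ccontr)
    assume K: "\<kappa>\<^sup>2 + D\<^sup>2 \<noteq> 0"
    \<comment> \<open>Tangency solved for the m-coordinate of dF'. Eliminating \<open>nu\<close>
      from the forms, multiplied by D^2 and \<kappa> D respectively, leaves quadratic polynomials in
      P and R.\<close>
    have nu': "- \<i> * (P v * p - R v * p') + \<kappa> * nu z v = (P v * p + R v * p') * (\<kappa> * C / D)" for v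
      using tan[of v] D by (simp add: field_simps)
    have "(D\<^sup>2 * q\<^sup>2 - \<kappa>\<^sup>2 * p\<^sup>2) * (P v)\<^sup>2 + (D\<^sup>2 * q'\<^sup>2 - \<kappa>\<^sup>2 * p'\<^sup>2) * (R v)\<^sup>2
        + (- 2 * D\<^sup>2 * q * q' - 2 * \<kappa>\<^sup>2 * p * p') * (P v * R v)
      = (D\<^sup>2 * E) * (dxl lam v)\<^sup>2 + (D\<^sup>2 * G) * (dyl lam v)\<^sup>2" for v
      using I'[of v] tan[of v] CD by algebra
    note co = diagonal_form_coeffs[OF lam this[unfolded P_def R_def]]
    \<comment> \<open>Equal coefficients of P^2 and R^2 in the first form; as p^2 + q^2 = p'^2 +
      q'^2, this yields p^2 = p'^2.\<close>
    have 1: "D\<^sup>2 * q\<^sup>2 - \<kappa>\<^sup>2 * p\<^sup>2 = D\<^sup>2 * q'\<^sup>2 - \<kappa>\<^sup>2 * p'\<^sup>2"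
      by (rule trans[OF co(1) co(2)[symmetric]])
    have "(\<kappa>\<^sup>2 + D\<^sup>2) * (p\<^sup>2 - p'\<^sup>2) = 0"
    proof -
      define c :: complex where "c = 1/4"
      have "p\<^sup>2 + q\<^sup>2 = c" "p'\<^sup>2 + q'\<^sup>2 = c" using norms by (simp_all add: c_def)
      then have "q\<^sup>2 = c - p\<^sup>2" "q'\<^sup>2 = c - p'\<^sup>2" by (simp_all add: algebra_simps)
      with 1 show ?thesis by (simp add: algebra_simps)
    qed
    then have pp: "p\<^sup>2 = p'\<^sup>2" using K by simp
    have "(- (\<kappa>\<^sup>2 + D\<^sup>2) * (p * q)) * (P v)\<^sup>2 + (- (\<kappa>\<^sup>2 + D\<^sup>2) * (p' * q')) * (R v)\<^sup>2
        + ((D\<^sup>2 - \<kappa>\<^sup>2) * (p * q' + p' * q) - \<kappa> * D * H) * (P v * R v) = 0" for v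
      using II'[of v] tan[of v] CD i_squared by algebra
    \<comment> \<open>The second form has no P^2 and R^2 terms, so p q = p' q' = 0. Together with
      p^2 = p'^2 either p = p' = 0 or q = q' = 0.\<close>
    note qf = quadratic_form_eq_0(1,2)[OF lam this[unfolded P_def R_def]]
    have "- (\<kappa>\<^sup>2 + D\<^sup>2) \<noteq> 0" using K neg_equal_0_iff_equal by blast
    with qf have pq0: "p * q = 0" "p' * q' = 0" unfolding mult_eq_0_iff by blast+
    show False
    proof (cases "p = 0")
      case True
      then have p: "p = 0" "p' = 0" using pp by auto
      have "\<not> immersed_at F' z"
        by (rule not_immersedI; unfold pdF' nu'; rule trans[OF _ mscale_frame_comb[of _ 0 0 1]]; simp add: p)
      then show False using immersed rank_F_n p by blast
    next
      case False
      then have q: "q = 0" "q' = 0" using pp pq0 by auto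
      have "\<not> immersed_at F' z"
      proof (rule not_immersedI)
        have rank1: "pd v F' z = (P v * p + R v * p') *\<^sub>m xi (\<Phi> z lam *v frame_comb (m z) \<kappa> (\<kappa> * C / D) 0)" for v
          unfolding pdF' nu' mscale_frame_comb[symmetric] by (simp add: q mult.commute)
        show "pd 1 F' z = (P 1 * p + R 1 * p') *\<^sub>m xi (\<Phi> z lam *v frame_comb (m z) \<kappa> (\<kappa> * C / D) 0)"
          "pd \<i> F' z = (P \<i> * p + R \<i> * p') *\<^sub>m xi (\<Phi> z lam *v frame_comb (m z) \<kappa> (\<kappa> * C / D) 0)"
          by (rule rank1)+
      qed
      then show False using immersed rank_F_m q by blast
    qed
  qed
qed

text \<open>The dressing parameter is \<open>\<alpha> = lam (C + 1) / D\<close>, i.e. \<open>coth \<beta> = C\<close> and \<open>1 / sinh \<beta> = D\<close>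
  for \<open>\<alpha> = lam exp \<beta>\<close>; the line spanned by \<open>\<Phi>\<^sub>\<alpha> (e1 + m)\<close> is then constant.\<close>

lemma transform_is_dressing:
  assumes lam: "lam \<noteq> 0" and conn: "connected U" and z1: "z1 \<in> U"
    and CD: "C\<^sup>2 - D\<^sup>2 = 1" and D: "D \<noteq> 0"
    and F': "\<forall>w\<in>U. F' w = assoc_surface \<Phi> lam w + xi ((- \<i> * D) *s (\<Phi> w lam *v n w))"
    and N': "\<forall>w\<in>U. N' w = xi (C *s (\<Phi> w lam *v e1) + D *s (\<Phi> w lam *v m w))"
    and tangent: "\<And>z v. z \<in> U \<Longrightarrow> bform (pd v F' z) (N' z) = 0"
  shows "\<exists>\<alpha> L. \<alpha> \<notin> {0, lam, - lam} \<and> isotropic_line L \<and> U \<subseteq> regular_set \<Phi> \<alpha> L \<and>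
    (\<forall>z\<in>U. F' z = dressed_surface \<Phi> lam \<alpha> L z \<and> N' z = dressed_normal \<Phi> lam \<alpha> L z)"
proof -
  define \<alpha> where "\<alpha> = lam * (C + 1) / D"
  have \<alpha>D: "\<alpha> * D = lam * (C + 1)" using D by (simp add: \<alpha>_def)
  have C1: "C + 1 \<noteq> 0"
  proof
    assume "C + 1 = 0"
    then have "C = -1" by (simp add: eq_neg_iff_add_eq_0)
    then show False using CD D by simp
  qed
  have \<alpha>0: "\<alpha> \<noteq> 0" using lam C1 D by (simp add: \<alpha>_def)
  have diff: "(\<alpha>\<^sup>2 - lam\<^sup>2) * D\<^sup>2 = 2 * lam\<^sup>2 * (C + 1)" using \<alpha>D CD by algebra
  have d: "\<alpha>\<^sup>2 - lam\<^sup>2 \<noteq> 0" using diff lam C1 by auto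
  then have \<alpha>_lam: "\<alpha> \<noteq> lam" "\<alpha> \<noteq> - lam" by auto
  have C_eq: "(\<alpha>\<^sup>2 + lam\<^sup>2) / (\<alpha>\<^sup>2 - lam\<^sup>2) = C" and D_eq: "2 * \<alpha> * lam / (\<alpha>\<^sup>2 - lam\<^sup>2) = D"
  proof -
    have "(C * (\<alpha>\<^sup>2 - lam\<^sup>2)) * D\<^sup>2 = (\<alpha>\<^sup>2 + lam\<^sup>2) * D\<^sup>2" "(D * (\<alpha>\<^sup>2 - lam\<^sup>2)) * D\<^sup>2 = (2 * \<alpha> * lam) * D\<^sup>2"
      using \<alpha>D CD by algebra+
    then have "C * (\<alpha>\<^sup>2 - lam\<^sup>2) = \<alpha>\<^sup>2 + lam\<^sup>2" "D * (\<alpha>\<^sup>2 - lam\<^sup>2) = 2 * \<alpha> * lam" using D by auto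
    then show "(\<alpha>\<^sup>2 + lam\<^sup>2) / (\<alpha>\<^sup>2 - lam\<^sup>2) = C" "2 * \<alpha> * lam / (\<alpha>\<^sup>2 - lam\<^sup>2) = D"
      using d by (metis nonzero_mult_div_cancel_right)+
  qed
  have shift: "D * inverse \<alpha> = (C - 1) * inverse lam" "D * \<alpha> = (C + 1) * lam"
  proof -
    have "(D * lam) * D = ((C - 1) * \<alpha>) * D" using \<alpha>D CD by algebra
    then have "D * lam = (C - 1) * \<alpha>" using D by simp
    then show "D * inverse \<alpha> = (C - 1) * inverse lam" using \<alpha>0 lam by (simp add: field_simps)
    show "D * \<alpha> = (C + 1) * lam" using \<alpha>D by (simp add: mult.commute)
  qed
  \<comment> \<open>Up to a factor i, tangency is D times the equation for D \<open>nu\<close> at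
    \<open>lam\<close>; \<open>shift\<close> then moves the coefficients to \<alpha>.\<close>
  have nu: "nu z v = mc_coeff \<alpha> z v (m z)" if z: "z \<in> U" for z v
  proof -
    have N: "N' z = xi (\<Phi> z lam *v frame_comb (m z) C D 0)"
      unfolding bspec[OF N' z] frame_comb_def by (simp add: cmat_vec_linear)
    have "- \<i> * D * mc_coeff lam z v (m z) * C - (- \<i> * surface_coeff lam z v (m z) + - \<i> * D * nu z v) * D = 0"
      using tangent[OF z, of v] unfolding N frechet_derivative_eqI[OF transformed_surface_deriv[OF lam z F']] bform_rotated[OF lam z]
      by simp
    then have "D * (D * nu z v) = D * (C * mc_coeff lam z v (m z) - surface_coeff lam z v (m z))"
      using i_squared by algebra
    then have "D * nu z v = C * mc_coeff lam z v (m z) - surface_coeff lam z v (m z)" using D by simp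
    also have "\<dots> = (D * inverse \<alpha>) * (v * cform (A z) (m z)) + (D * \<alpha>) * (cnj v * cform (B z) (m z))"
      unfolding shift mc_coeff_def surface_coeff_def by (simp add: algebra_simps)
    also have "\<dots> = D * mc_coeff \<alpha> z v (m z)" unfolding mc_coeff_def by (simp add: algebra_simps)
    finally show ?thesis using D by simp
  qed
  define f where "f = (\<lambda>w. \<Phi> w \<alpha> *v e1 + \<Phi> w \<alpha> *v m w)"
  have f: "f w = \<Phi> w \<alpha> *v (e1 + m w)" for w by (simp add: f_def cmat_vec_linear)
  have f_back: "transpose (\<Phi> w \<alpha>) *v f w = e1 + m w" for w
    unfolding f by (rule SO3C_mult_transpose(1)[OF SO[OF \<alpha>0]])
  have e1_m: "e1 + m w \<noteq> 0" "cform (e1 + m w) (e1 + m w) = 0" "(e1 + m w) $ 1 = 1" if "w \<in> U" for w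
  proof -
    show 1: "(e1 + m w) $ 1 = 1" using m_1[OF that] by (simp add: e1_nth)
    then show "e1 + m w \<noteq> 0" by (metis zero_index zero_neq_one)
    show "cform (e1 + m w) (e1 + m w) = 0"
      using m_1[OF that] m_m[OF that] by (simp add: cform_3 e1_nth add.assoc)
  qed
  have f0: "f w \<noteq> 0" if "w \<in> U" for w
    using f_back[of w] e1_m(1)[OF that] by auto
  have df: "(f has_derivative (\<lambda>v. (- mc_coeff \<alpha> z v (n z)) *s f z)) (at z)" if z: "z \<in> U" for z
  proof -
    \<comment> \<open>The value of \<open>nu\<close> cancels the n-coordinate; the rest is a
      multiple of e1 + m, so the derivative of \<open>f\<close> is a multiple of
      \<open>f\<close>.\<close>
    have "frame_comb (m z) 0 (- mc_coeff \<alpha> z v (n z)) (mc_coeff \<alpha> z v (m z)) + frame_comb (m z) (- mc_coeff \<alpha> z v (n z)) 0 (- nu z v)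
        = (- mc_coeff \<alpha> z v (n z)) *s (e1 + m z)" for v
      unfolding frame_comb_linear(1) nu[OF z] by (simp add: frame_comb_def cvec_eq_iff algebra_simps)
    then show ?thesis
      using has_derivative_add[OF frame_e1[OF \<alpha>0 z] frame_m[OF \<alpha>0 z]]
      unfolding cmat_vec_linear(1)[symmetric] f cmat_vec_linear(4)[symmetric] unfolding f_def by simp
  qed
  \<comment> \<open>The line spanned by \<open>f\<close> is the same at all points of the connected
    set \<open>U\<close>, and \<open>z1\<close> merely represents it.\<close>
  define L where "L = line (f z1)"
  have L: "Ltilde \<Phi> \<alpha> L w = line (e1 + m w)" if w: "w \<in> U" for w
  proof -
    obtain t where t: "t \<noteq> 0" "f w = t *s f z1"
      using parallel_imp_constant_line[OF open_U conn f0 df z1 w] by blast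
    then have "L = line (f w)" unfolding L_def t(2) by (simp only: line_smult[OF t(1)])
    then show ?thesis by (simp add: Ltilde_line[OF \<alpha>0] f_back)
  qed
  have "cform (f z1) (f z1) = 0"
    unfolding f using e1_m(2)[OF z1] by (simp only: SO3C_cform[OF SO[OF \<alpha>0]])
  then have "isotropic_line L"
    unfolding isotropic_line_iff L_def using f0[OF z1] by blast
  moreover have "U \<subseteq> regular_set \<Phi> \<alpha> L"
  proof
    fix w assume w: "w \<in> U"
    show "w \<in> regular_set \<Phi> \<alpha> L"
      unfolding regular_set_def mem_Collect_eq L[OF w]
      using Qim_line_eq_iff[OF e1_m(1,2)[OF w]] e1_m(3)[OF w] by (metis zero_neq_one)
  qed
  moreover have "F' z = dressed_surface \<Phi> lam \<alpha> L z \<and> N' z = dressed_normal \<Phi> lam \<alpha> L z" if z: "z \<in> U" for z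
    using dressed_eq[OF lam \<alpha>0 \<alpha>_lam L[OF z] m_1[OF z] m_m[OF z]] bspec[OF F' z] bspec[OF N' z]
    unfolding C_eq D_eq n_def by simp
  ultimately show ?thesis
    using \<alpha>0 \<alpha>_lam by (intro exI[of _ \<alpha>] exI[of _ L]) auto
qed

end

text \<open>A continuous function with at most two values on a connected set.\<close>

lemma connected_square_constant:
  fixes g :: "complex \<Rightarrow> complex"
  assumes "connected U" "continuous_on U g" "\<And>z. z \<in> U \<Longrightarrow> (g z)\<^sup>2 = c" "a \<in> U" "b \<in> U"
  shows "g a = g b"
proof -
  have "g ` U \<subseteq> {csqrt c, - csqrt c}"
    using assms(3) power2_eq_iff[of _ "csqrt c"] by auto
  then have "finite (g ` U)" using finite_subset by blast
  then have "g constant_on U"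
    using continuous_finite_range_constant[OF assms(1,2)] by blast
  then show ?thesis using assms(4,5) unfolding constant_on_def by auto
qed

context associated_framing
begin

text \<open>Brings the pair into the form of \<open>moving_frame\<close>, with \<Phi> n the
  normalised displacement. The defining conditions hold for N' and -N' alike, so the normal is
  recovered only up to a global sign.\<close>

lemma bianchi_baecklund_is_dressing:
  assumes lam: "lam \<noteq> 0" and conn: "connected U" and z1: "z1 \<in> U"
    and immersed: "immersed_at (assoc_surface \<Phi> lam) z1 \<or> immersed_at F' z1"
    and bb: "bianchi_baecklund lam U (assoc_surface \<Phi> lam) (assoc_normal \<Phi> lam) F' N'"
  shows "\<exists>\<alpha> L. \<alpha> \<notin> {0, lam, - lam} \<and> isotropic_line L \<and> U \<subseteq> regular_set \<Phi> \<alpha> L \<and>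
    (\<forall>z\<in>U. F' z = dressed_surface \<Phi> lam \<alpha> L z) \<and>
    ((\<forall>z\<in>U. N' z = dressed_normal \<Phi> lam \<alpha> L z) \<or> (\<forall>z\<in>U. N' z = - dressed_normal \<Phi> lam \<alpha> L z))"
proof -
  let ?F = "assoc_surface \<Phi> lam" and ?N = "assoc_normal \<Phi> lam"
  note SO' = SO[OF lam]
  have sF: "csurface_on U F' N'" and cF: "curvature_line_coord lam U F' N'"
    and open_U: "open U" and smF': "smooth_on U F'" and smN': "smooth_on U N'"
    using bb by (auto simp: bianchi_baecklund_def csurface_on_def)
  obtain c where c: "c \<noteq> 0" "\<forall>z\<in>U. bform (F' z - ?F z) (F' z - ?F z) = c"
    using bb by (auto simp: bianchi_baecklund_def)
  obtain C where C: "\<forall>z\<in>U. bform (?N z) (N' z) = C"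
    using bb by (auto simp: bianchi_baecklund_def)
  define w where "w = (\<lambda>z. vee (F' z) + - vee (?F z))"
  define nv where "nv = (\<lambda>z. vee (N' z))"
  have F'w: "F' z = ?F z + xi (w z)" if "z \<in> U" for z
  proof -
    have "F' z \<in> so3C" using sF that by (simp add: csurface_on_def)
    then have "xi (w z) = F' z - ?F z"
      unfolding w_def xi_add xi_minus using xi_vee assoc_surface_so3C[OF lam] by simp
    then show ?thesis by simp
  qed
  have N'v: "N' z = xi (nv z)" if "z \<in> U" for z
    using sF that by (simp add: csurface_on_def nv_def xi_vee)
  have rel: "cform (w z) (w z) = c" "cform (w z) (\<Phi> z lam *v e1) = 0" "cform (w z) (nv z) = 0"
    "cform (\<Phi> z lam *v e1) (nv z) = C" "cform (nv z) (nv z) = 1" if z: "z \<in> U" for z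
  proof -
    have W: "F' z - ?F z = xi (w z)" using F'w[OF z] by simp
    have "bform (F' z - ?F z) (F' z - ?F z) = c" "bform (F' z - ?F z) (?N z) = 0"
      "bform (F' z - ?F z) (N' z) = 0" "bform (?N z) (N' z) = C" "bform (N' z) (N' z) = 1"
      using c(2) C bb sF z by (simp_all add: bianchi_baecklund_def csurface_on_def)
    then show "cform (w z) (w z) = c" "cform (w z) (\<Phi> z lam *v e1) = 0" "cform (w z) (nv z) = 0"
      "cform (\<Phi> z lam *v e1) (nv z) = C" "cform (nv z) (nv z) = 1"
      unfolding W N'v[OF z] assoc_normal_eq[OF lam] bform_xi .
  qed
  \<comment> \<open>Chosen so that the rescaled displacement has square -1, as n must; which root
    fits the normal is decided at the end.\<close>
  define \<kappa> where "\<kappa> = csqrt (- c)"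
  have \<kappa>: "\<kappa>\<^sup>2 = - c" "\<kappa> \<noteq> 0" using c(1) by (simp_all add: \<kappa>_def)
  define \<nu> where "\<nu> = (\<lambda>z. transpose (\<Phi> z lam) *v (inverse \<kappa> *s w z))"
  \<comment> \<open>Solves \<open>ccross e1 m = \<nu>\<close> for \<nu> orthogonal to e1, so that
    the vector \<open>n\<close> of the frame is \<nu>.\<close>
  define m where "m = (\<lambda>z. ccross (\<nu> z) e1)"
  have \<nu>: "\<nu> z $ 1 = 0" "cform (\<nu> z) (\<nu> z) = -1" "\<kappa> *s (\<Phi> z lam *v \<nu> z) = w z" if z: "z \<in> U" for z
  proof -
    have tr: "cform (transpose (\<Phi> z lam) *v x) e1 = cform x (\<Phi> z lam *v e1)" for x
      by (simp add: cform_transpose)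
    have "cform (\<nu> z) e1 = 0"
      unfolding \<nu>_def tr using rel(2)[OF z] by (simp add: cform_linear)
    then show "\<nu> z $ 1 = 0" by (simp add: cform_3 e1_nth)
    have "inverse \<kappa> * (inverse \<kappa> * c) = -1"
      using \<kappa> c(1) by (simp add: field_simps power2_eq_square)
    then show "cform (\<nu> z) (\<nu> z) = -1"
      unfolding \<nu>_def SO3C_cform[OF SO3C_transpose_mem[OF SO']] using rel(1)[OF z] by (simp add: cform_linear)
    show "\<kappa> *s (\<Phi> z lam *v \<nu> z) = w z"
      unfolding \<nu>_def SO3C_mult_transpose[OF SO'] using \<kappa>(2) by simp
  qed
  have m1: "m z $ 1 = 0" and mm: "cform (m z) (m z) = -1" and nm: "ccross e1 (m z) = \<nu> z" if z: "z \<in> U" for z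
    using \<nu>(1,2)[OF z] by (simp_all add: m_def cform_3 cvec_eq_iff e1_nth algebra_simps)
  note sm_intros = smooth_on_bilinear[OF open_U bounded_bilinear_cmat_vec]
    smooth_on_bounded_linear[OF open_U bounded_linear_transpose]
    smooth_on_bounded_linear[OF open_U bounded_bilinear.bounded_linear_right[OF bounded_bilinear_smult]]
    smooth_on_subset[OF smooth_on_framing[OF lam]]
  have sm_w: "smooth_on U w" and sm_nv: "smooth_on U nv"
    unfolding w_def nv_def
    by (intro smooth_on_add open_U smooth_on_bounded_linear[OF open_U bounded_linear_vee] smF' smN'
        smooth_on_bounded_linear[OF open_U bounded_linear_minus[OF bounded_linear_vee]]
        smooth_on_subset[OF smooth_on_assoc_surface[OF lam]] subset_UNIV)+
  have sm_m: "smooth_on U m"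
    unfolding m_def \<nu>_def
    by (intro smooth_on_bounded_linear[OF open_U bounded_bilinear.bounded_linear_left[OF bounded_bilinear_ccross]]
        sm_intros sm_w subset_UNIV)
  define m' where "m' = (\<lambda>z v. frechet_derivative m (at z) v)"
  interpret associated_moving_frame \<Phi> A B k U m m'
    by unfold_locales (use open_U m1 mm smooth_on_has_derivative[OF sm_m] in \<open>auto simp: m'_def\<close>)
  have n_eq: "n z = \<nu> z" if "z \<in> U" for z using nm[OF that] by (simp add: n_def)
  have F'n: "\<forall>z\<in>U. F' z = ?F z + xi (\<kappa> *s (\<Phi> z lam *v n z))"
    using F'w \<nu>(3) n_eq by simp
  define y where "y = (\<lambda>z. transpose (\<Phi> z lam) *v nv z)"
  \<comment> \<open>The coordinate of the rotated-back normal along m, negated because (m, m) = -1.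
    Its coordinate along n vanishes, as N' is orthogonal to F' - F.\<close>
  define D where "D = (\<lambda>z. - cform (y z) (m z))"
  have y: "y z = C *s e1 + D z *s m z" and D2: "(D z)\<^sup>2 = C\<^sup>2 - 1" and \<Phi>y: "\<Phi> z lam *v y z = nv z"
    if z: "z \<in> U" for z
  proof -
    interpret fr: isotropic_frame "m z" using m1[OF z] mm[OF z] by unfold_locales
    show \<Phi>y: "\<Phi> z lam *v y z = nv z" unfolding y_def by (rule SO3C_mult_transpose[OF SO'])
    have "cform (\<Phi> z lam *v e1) (\<Phi> z lam *v y z) = C" using rel(4)[OF z] \<Phi>y by simp
    then have "cform e1 (y z) = C" by (simp only: SO3C_cform[OF SO'])
    then have y1: "y z $ 1 = C" by (simp add: cform_3 e1_nth)
    have "cform (\<kappa> *s (\<Phi> z lam *v \<nu> z)) (\<Phi> z lam *v y z) = 0" using rel(3)[OF z] \<Phi>y \<nu>(3)[OF z] by simp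
    then have "cform (\<nu> z) (y z) = 0" using \<kappa>(2) by (simp add: SO3C_cform[OF SO'] cform_linear)
    then have "cform (y z) fr.n = 0" using nm[OF z] by (simp add: fr.n_def cform_commute)
    then show yz: "y z = C *s e1 + D z *s m z"
      using fr.frame_expand[of "y z"] y1 by (simp add: D_def cvec_eq_iff)
    have "cform (y z) (y z) = 1"
      using rel(5)[OF z] unfolding \<Phi>y[symmetric] by (simp add: SO3C_cform[OF SO'])
    then have "C\<^sup>2 - (D z)\<^sup>2 = 1"
      unfolding yz using m1[OF z] mm[OF z]
      by (simp add: cform_linear power2_eq_square) (simp add: cform_3 e1_nth)
    then show "(D z)\<^sup>2 = C\<^sup>2 - 1" by (simp add: algebra_simps)
  qed
  have smooth_D: "smooth_on U D"
    unfolding D_def y_def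
    by (intro smooth_on_bounded_linear[OF open_U bounded_linear_minus[OF bounded_linear_ident]]
        smooth_on_bilinear[OF open_U bounded_bilinear_cform] sm_intros sm_nv sm_m subset_UNIV)
  \<comment> \<open>The constant angle fixes only the square of \<open>D\<close>; continuity on the
    connected set \<open>U\<close> fixes its sign.\<close>
  have D_const: "D z = D z1" if "z \<in> U" for z
    by (rule connected_square_constant[OF conn smooth_on_imp_continuous_on[OF smooth_D] D2 that z1])
  define d where "d = D z1"
  have CD: "C\<^sup>2 - d\<^sup>2 = 1" using D2[OF z1] by (simp add: d_def)
  have N'n: "\<forall>z\<in>U. N' z = xi (C *s (\<Phi> z lam *v e1) + d *s (\<Phi> z lam *v m z))"
  proof
    fix z assume z: "z \<in> U"
    have "nv z = \<Phi> z lam *v (C *s e1 + d *s m z)"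
      using \<Phi>y[OF z] y[OF z] D_const[OF z] by (simp add: d_def)
    then show "N' z = xi (C *s (\<Phi> z lam *v e1) + d *s (\<Phi> z lam *v m z))"
      using N'v[OF z] by (simp add: cmat_vec_linear)
  qed
  have tangent: "bform (pd v F' z) (N' z) = 0" if "z \<in> U" for z v
    using sF that by (simp add: csurface_on_def)
  obtain E G H where EGH: "\<And>v. fform1 F' z1 v = E * (dxl lam v)\<^sup>2 + G * (dyl lam v)\<^sup>2"
    "\<And>v. fform2 F' N' z1 v = H * ((dxl lam v)\<^sup>2 + (dyl lam v)\<^sup>2)"
    using cF z1 unfolding curvature_line_coord_def by blast
  note const = transform_constants[OF lam z1 \<kappa>(2) CD F'n N'n tangent[OF z1] EGH immersed]
  have "(\<kappa> - \<i> * d) * (\<kappa> + \<i> * d) = 0" using const(2) i_squared by algebra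
  then consider "\<kappa> = - \<i> * d" | "\<kappa> = - \<i> * (- d)" by (auto simp: eq_neg_iff_add_eq_0)
  then show ?thesis
  proof cases
    case 1
    show ?thesis
      using transform_is_dressing[OF lam conn z1 CD const(1) F'n[unfolded 1] N'n tangent] by blast
  next
    \<comment> \<open>The other root: for -N' the pair (C, d) becomes (-C, -d), and \<kappa> = -i
      (-d) has the form required for dressing.\<close>
    case 2
    have N'm: "\<forall>z\<in>U. - N' z = xi ((- C) *s (\<Phi> z lam *v e1) + (- d) *s (\<Phi> z lam *v m z))"
      using N'n by (simp add: xi_minus[symmetric])
    have t: "bform (pd v F' z) (- N' z) = 0" if "z \<in> U" for z v
      using tangent[OF that, of v] by (simp add: bform_def trace_def sum_3 cmat_mult_nth algebra_simps)
    obtain \<alpha> L where aL: "\<alpha> \<notin> {0, lam, - lam}" "isotropic_line L" "U \<subseteq> regular_set \<Phi> \<alpha> L"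
      "\<forall>z\<in>U. F' z = dressed_surface \<Phi> lam \<alpha> L z \<and> - N' z = dressed_normal \<Phi> lam \<alpha> L z"
      using transform_is_dressing[OF lam conn z1 _ _ F'n[unfolded 2] N'm t] CD const(1) by auto
    then have "\<forall>z\<in>U. N' z = - dressed_normal \<Phi> lam \<alpha> L z" by (metis minus_minus)
    then show ?thesis using aL by blast
  qed
qed

end

section \<open>Normalisation of A and B by the first fundamental form\<close>

lemma extended_framing_is_associated_framing:
  assumes framing: "extended_framing \<phi> \<Phi>"
    and first_form: "\<And>z v. fform1 (assoc_surface \<Phi> 1) z v =
          complex_of_real ((cosh (\<omega> z))\<^sup>2 * (Re v)\<^sup>2 + (sinh (\<omega> z))\<^sup>2 * (Im v)\<^sup>2)"
  shows "\<exists>A B k. associated_framing \<Phi> A B k"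
proof -
  obtain A \<kappa> B where AB: "\<And>z. A z \<in> m_cplx" "\<And>z. B z \<in> m_cplx" "\<And>z v. \<kappa> z v \<in> k_real"
    and MC: "\<And>z v \<mu>. \<mu> \<noteq> 0 \<Longrightarrow> matrix_inv (\<Phi> z \<mu>) ** pd v (\<lambda>w. \<Phi> w \<mu>) z =
             inverse \<mu> *\<^sub>m (v *\<^sub>m A z) + \<kappa> z v + \<mu> *\<^sub>m (cnj v *\<^sub>m B z)"
    using framing unfolding extended_framing_def by blast
  have m_cplx: "xi (vee M) = M \<and> vee M $ 1 = 0" if M: "M \<in> m_cplx" for M
  proof -
    obtain a b where "M = xi (a *s axis 2 1 + b *s axis 3 1)"
      using M unfolding m_cplx_def xi_add xi_smult by blast
    then show ?thesis by (simp add: axis_def)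
  qed
  have k_real: "xi (vee M $ 1 *s e1) = M" if M: "M \<in> k_real" for M
  proof -
    obtain t where "M = xi (complex_of_real t *s e1)"
      using M unfolding k_real_def xi_smult by blast
    then show ?thesis by (simp add: axis_def)
  qed
  have L: "\<Phi> z \<in> Lambda_hol" for z using framing by (simp add: extended_framing_def)
  interpret framing \<Phi> "\<lambda>z. vee (A z)" "\<lambda>z. vee (B z)" "\<lambda>z v. vee (\<kappa> z v) $ 1"
  proof
    show "\<Phi> z \<mu> \<in> SO3C" if "\<mu> \<noteq> 0" for z \<mu> using L[of z] that by (simp add: Lambda_hol_def)
    show "(\<lambda>\<mu>. \<Phi> z \<mu> $ i $ j) holomorphic_on - {0}" for z i j using L[of z] by (simp add: Lambda_hol_def)
    show "smooth_on (UNIV \<times> - {0}) (\<lambda>(z, \<mu>). \<Phi> z \<mu>)" using framing by (simp add: extended_framing_def)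
    show "vee (A z) $ 1 = 0" "vee (B z) $ 1 = 0" for z using m_cplx AB by blast+
    show "matrix_inv (\<Phi> z \<mu>) ** pd v (\<lambda>w. \<Phi> w \<mu>) z =
      xi ((inverse \<mu> * v) *s vee (A z) + vee (\<kappa> z v) $ 1 *s e1 + (\<mu> * cnj v) *s vee (B z))" if "\<mu> \<noteq> 0" for z \<mu> v
      unfolding MC[OF that] vec.scale_scale[symmetric] xi_add xi_smult k_real[OF AB(3), unfolded xi_smult]
        m_cplx[OF AB(1), THEN conjunct1] m_cplx[OF AB(2), THEN conjunct1] ..
  qed
  have "cform (vee (A z)) (vee (A z)) = -1/4 \<and> cform (vee (B z)) (vee (B z)) = -1/4" for z
  proof -
    define a b c where "a = cform (vee (A z)) (vee (A z))" "b = cform (vee (B z)) (vee (B z))"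
      "c = cform (vee (A z)) (vee (B z))"
    define ch sh where "ch = (complex_of_real (cosh (\<omega> z)))\<^sup>2" "sh = (complex_of_real (sinh (\<omega> z)))\<^sup>2"
    \<comment> \<open>At parameter 1 the surface has differential i (A dz - B d(cnj z)) in the
      frame, so the coefficient of dz^2 is -(A, A); in the given first form it is (cosh^2 -
      sinh^2)/4 = 1/4.\<close>
    have I: "- (v * v * a - 2 * (v * cnj v) * c + cnj v * cnj v * b) =
        ch * (of_real (Re v))\<^sup>2 + sh * (of_real (Im v))\<^sup>2" for v
    proof -
      have "fform1 (assoc_surface \<Phi> 1) z v = cform (\<i> *s surface_form z v 1) (\<i> *s surface_form z v 1)"
        unfolding fform1_def frechet_derivative_eqI[OF assoc_surface_deriv[OF one_neq_zero]] bform_xi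
        by (rule SO3C_cform[OF SO[OF one_neq_zero]])
      also have "\<dots> = - (v * v * a - 2 * (v * cnj v) * c + cnj v * cnj v * b)"
        unfolding a_b_c_def surface_form_def
        by (simp add: cform_linear cform_commute[of "vee (B z)" "vee (A z)"] algebra_simps)
      finally show ?thesis unfolding first_form by (simp add: ch_sh_def)
    qed
    have "ch - sh = (complex_of_real ((cosh (\<omega> z))\<^sup>2 - (sinh (\<omega> z))\<^sup>2))" by (simp add: ch_sh_def)
    then have cs: "ch - sh = 1" by (simp add: cosh_square_eq)
    \<comment> \<open>The directions 1, i and 1 + i determine the three coefficients.\<close>
    have 1: "- (a - 2 * c + b) = ch" using I[of 1] by simp
    have 2: "a + 2 * c + b = sh" using I[of \<i>] by (simp add: algebra_simps)
    have 3: "- (2 * \<i> * a - 4 * c - 2 * \<i> * b) = ch + sh" using I[of "1 + \<i>"] by (simp add: algebra_simps)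
    have "4 * c = ch + sh" unfolding 1[symmetric] 2[symmetric] by simp
    then have "(2 * \<i>) * a = (2 * \<i>) * b" using 3 by (simp add: algebra_simps)
    then have ab: "a = b" by simp
    have "- (a * 4) = 1" using cs unfolding 1[symmetric] 2[symmetric] ab by (simp add: algebra_simps)
    then have "a * 4 = -1" by (metis minus_minus)
    then have "a = -1 / 4" by (metis nonzero_mult_div_cancel_right zero_neq_numeral)
    with ab show ?thesis by (simp add: a_b_c_def)
  qed
  then have "associated_framing \<Phi> (\<lambda>z. vee (A z)) (\<lambda>z. vee (B z)) (\<lambda>z v. vee (\<kappa> z v) $ 1)"
    by unfold_locales auto
  then show ?thesis by blast
qed

theorem theorem7:
  fixes \<phi> :: "complex \<Rightarrow> real^3"
    and \<Phi> :: "complex \<Rightarrow> complex \<Rightarrow> complex^3^3"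
    and \<omega> :: "complex \<Rightarrow> real"
    and z0 lam :: complex
  assumes harmonic: "harmonic_sphere_map \<phi>"
    and nonconformal: "\<And>z. \<not> conformal_at \<phi> z"
    and framing: "extended_framing \<phi> \<Phi>"
    and base_point: "\<And>\<mu>. \<mu> \<noteq> 0 \<Longrightarrow> \<Phi> z0 \<mu> = mat 1"
    and sinh_gordon: "smooth_on UNIV \<omega>" "\<And>z. laplacian \<omega> z + sinh (\<omega> z) * cosh (\<omega> z) = 0"
    and first_form: "\<And>z v. fform1 (assoc_surface \<Phi> 1) z v =
          complex_of_real ((cosh (\<omega> z))\<^sup>2 * (Re v)\<^sup>2 + (sinh (\<omega> z))\<^sup>2 * (Im v)\<^sup>2)"
    and second_form: "\<And>z. \<exists>H. \<forall>v. fform2 (assoc_surface \<Phi> 1) (assoc_normal \<Phi> 1) z v =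
          complex_of_real (H * ((Re v)\<^sup>2 + (Im v)\<^sup>2))"
    and lambda: "lam \<noteq> 0"
  shows
    "(\<forall>\<alpha> L. \<alpha> \<notin> {0, lam, - lam} \<and> isotropic_line L \<and> Qim L \<noteq> L \<longrightarrow>
        (\<forall>\<beta>. exp \<beta> = \<alpha> / lam \<longrightarrow>
          (dressed_surface \<Phi> lam \<alpha> L, dressed_normal \<Phi> lam \<alpha> L)
            \<in> BB \<beta> lam (regular_set \<Phi> \<alpha> L) (assoc_surface \<Phi> lam) (assoc_normal \<Phi> lam)))
     \<and>
     (\<forall>U F' N'. connected U \<and>
        (\<exists>z\<in>U. immersed_at (assoc_surface \<Phi> lam) z \<or> immersed_at F' z) \<and>
        bianchi_baecklund lam U (assoc_surface \<Phi> lam) (assoc_normal \<Phi> lam) F' N' \<longrightarrow>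
        (\<exists>\<alpha> L. \<alpha> \<notin> {0, lam, - lam} \<and> isotropic_line L \<and> (z0 \<in> U \<longrightarrow> Qim L \<noteq> L) \<and>
           U \<subseteq> regular_set \<Phi> \<alpha> L \<and>
           (\<forall>z\<in>U. F' z = dressed_surface \<Phi> lam \<alpha> L z) \<and>
           ((\<forall>z\<in>U. N' z = dressed_normal \<Phi> lam \<alpha> L z) \<or>
            (\<forall>z\<in>U. N' z = - dressed_normal \<Phi> lam \<alpha> L z))))"
proof -
  obtain A B k where "associated_framing \<Phi> A B k"
    using extended_framing_is_associated_framing[OF framing first_form] by blast
  then interpret associated_framing \<Phi> A B k .
  \<comment> \<open>At \<open>z0\<close> the framing is the identity, so the transported line is L
    itself and regularity there is the condition on L.\<close>
  have base: "Qim L \<noteq> L" if "z0 \<in> regular_set \<Phi> \<alpha> L" "\<alpha> \<noteq> 0" for \<alpha> L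
  proof -
    have "matrix_inv (mat 1 :: cmat) = mat 1" by (rule matrix_inv_eqI) simp_all
    then have "Ltilde \<Phi> \<alpha> L z0 = L" by (simp add: Ltilde_def base_point[OF that(2)])
    then show ?thesis using that(1) by (simp add: regular_set_def)
  qed
  show ?thesis
  proof (intro conjI allI impI)
    fix \<alpha> L \<beta> assume "\<alpha> \<notin> {0, lam, - lam} \<and> isotropic_line L \<and> Qim L \<noteq> L" "exp \<beta> = \<alpha> / lam"
    then show "(dressed_surface \<Phi> lam \<alpha> L, dressed_normal \<Phi> lam \<alpha> L)
            \<in> BB \<beta> lam (regular_set \<Phi> \<alpha> L) (assoc_surface \<Phi> lam) (assoc_normal \<Phi> lam)"
      by (intro dressed_in_BB lambda) auto
  next
    fix U F' N'
    assume *: "connected U \<and>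
        (\<exists>z\<in>U. immersed_at (assoc_surface \<Phi> lam) z \<or> immersed_at F' z) \<and>
        bianchi_baecklund lam U (assoc_surface \<Phi> lam) (assoc_normal \<Phi> lam) F' N'"
    then obtain z1 where z1: "z1 \<in> U" "immersed_at (assoc_surface \<Phi> lam) z1 \<or> immersed_at F' z1" by blast
    from bianchi_baecklund_is_dressing[OF lambda _ z1] *
    obtain \<alpha> L where "\<alpha> \<notin> {0, lam, - lam}" "isotropic_line L" "U \<subseteq> regular_set \<Phi> \<alpha> L"
      "\<forall>z\<in>U. F' z = dressed_surface \<Phi> lam \<alpha> L z"
      "(\<forall>z\<in>U. N' z = dressed_normal \<Phi> lam \<alpha> L z) \<or> (\<forall>z\<in>U. N' z = - dressed_normal \<Phi> lam \<alpha> L z)"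
      by blast
    moreover from this have "z0 \<in> U \<longrightarrow> Qim L \<noteq> L" using base[of \<alpha> L] by auto
    ultimately show "\<exists>\<alpha> L. \<alpha> \<notin> {0, lam, - lam} \<and> isotropic_line L \<and> (z0 \<in> U \<longrightarrow> Qim L \<noteq> L) \<and>
           U \<subseteq> regular_set \<Phi> \<alpha> L \<and>
           (\<forall>z\<in>U. F' z = dressed_surface \<Phi> lam \<alpha> L z) \<and>
           ((\<forall>z\<in>U. N' z = dressed_normal \<Phi> lam \<alpha> L z) \<or>
            (\<forall>z\<in>U. N' z = - dressed_normal \<Phi> lam \<alpha> L z))" by blast
  qed
qed

end
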